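(* Fix a field $\mathbb{F}$ and an integer $i\ge 0$. Let $\Gamma$ be a connected graph with an essential vertex such that $\Delta^i_\Gamma>1$. Then, with coefficients in $\mathbb{F}$, as $k\to\infty$, \[\dim_{\mathbb{F}} T_i(\Gamma)_k\;\sim\;\sum_{W}\frac{1}{(\Delta^i_\Gamma-1)!}\prod_{w\in W}(d(w)-2)\,k^{\Delta^i_\Gamma-1},\] where $W$ ranges over sets of essential vertices of cardinality $i$ such that $\Delta^W_\Gamma=\Delta^i_\Gamma$.
   Context: A graph $\Gamma$ is a finite $1$-dimensional CW complex with set of vertices ($0$-cells) $V$ and set of edges (open $1$-cells) $E$. A half-edge is a point in the preimage of a vertex under the attaching map of a $1$-cell, so each edge determines two half-edges; a half-edge $h$ has a vertex $v(h)$ and an edge $e(h)$. $H(v)$ is the set of half-edges at $v$ and $d(v)=|H(v)|$. A vertex $v$ is essential if $d(v)\ge 3$. For a set $W$ of essential vertices, $\Delta^W_\Gamma$ is the number of connected components of the complement of $W$ in $\Gamma$, and $\Delta^i_\Gamma=\max_{|W|=i}\Delta^W_\Gamma$ over sets $W$ of essential vertices (the hypothesis $\Delta^i_\Gamma>1$ includes that such sets exist). $B_k(\Gamma)$ is the unordered configuration space of $k$ distinct points in $\Gamma$ and $B(\Gamma)=\bigsqcup_{k\ge 0}B_k(\Gamma)$. Homology has coefficients in $R=\mathbb{F}$; $H_i(B(\Gamma))=\bigoplus_k H_i(B_k(\Gamma))$ is graded by $k$. It is a graded module over $R[E]$ (each $e\in E$ in degree $1$) via edge stabilization (the action of $e$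 replaces the particles on the closure of $e$ by the averages of consecutive particles and endpoints, adding one particle). Equivalently, there is a natural isomorphism of bigraded $R[E]$-modules $H_*(B(\Gamma))\cong H_*(S(\Gamma))$, where $S(\Gamma)=R[E]\otimes_{\mathbb Z}\bigotimes_{v\in V}S(v)$, $S(v)=\mathbb{Z}\langle\varnothing,v,h\in H(v)\rangle$, with (homological degree, number of particles) $|\varnothing|=(0,0)$, $|v|=|e|=(0,1)$, $|h|=(1,1)$, and $R[E]$-linear differential determined (with the usual tensor product signs) by $\partial h=e(h)-v(h)$, $\partial v=\partial\varnothing=0$. Factors $\varnothing$ and tensor symbols are omitted. For distinct half-edges $h_1,h_2,h_3$ at a vertex $w$, with $e_j=e(h_j)$, the star class $\alpha_{123}\in H_1(B_2(\Gamma))$ is the class of $e_3(h_1-h_2)+e_2(h_3-h_1)+e_1(h_2-h_3)$. For a set $W$ of essential vertices, a $W$-torus is a class in $H_{|W|}(B_{2|W|}(\Gamma))$ that is the external product of one star class at each $w\in W$ (represented by the product, over $w\in W$, of the chains $e_3(h_1-h_2)+e_2(h_3-h_1)+e_1(h_2-h_3)$ representing the chosen star classes). $T_i(\Gamma)\subseteq H_i(B(\Gamma))$ is the $R[E]$-submodule generated by all $W$-tori for all sets $W$ of essential vertices with $|W|=i$, and $T_i(\Gamma)_k=T_i(\Gamma)\cap H_i(B_k(\Gamma))$. For functions $f,g$ of $k\in\mathbb{Z}_{\ge0}$, $f\sim g$ means that both are eventually nonzero and $\lim_{k\to\infty}f(k)/g(k)=1$. *)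

theory Defs
  imports "HOL-Analysis.Analysis" "HOL-Library.Poly_Mapping"
begin

subsection \<open>Graphs as finite 1-dimensional CW complexes\<close>

text \<open>
  A 1-cell \<open>e\<close> is a copy of \<open>[0,1]\<close>; the points of its boundary are \<open>(e, False)\<close> (at \<open>0\<close>) and
  \<open>(e, True)\<close> (at \<open>1\<close>), and \<open>att\<close> is the attaching map. Hence these pairs are exactly the
  half-edges, with \<open>v(h) = att h\<close> and \<open>e(h) = fst h\<close>. Loops and multiple edges are allowed.
\<close>

record ('v, 'e) cw_graph =
  verts :: "'v set"
  edges :: "'e set"
  att :: "'e \<times> bool \<Rightarrow> 'v"

definition finite_graph :: "('v, 'e) cw_graph \<Rightarrow> bool" where
  "finite_graph \<Gamma> \<longleftrightarrow> finite (verts \<Gamma>) \<and> finite (edges \<Gamma>) \<and>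
     (\<forall>h \<in> edges \<Gamma> \<times> UNIV. att \<Gamma> h \<in> verts \<Gamma>)"

definition half_edges_at :: "('v, 'e) cw_graph \<Rightarrow> 'v \<Rightarrow> ('e \<times> bool) set" where
  "half_edges_at \<Gamma> v = {h \<in> edges \<Gamma> \<times> UNIV. att \<Gamma> h = v}"

definition valence :: "('v, 'e) cw_graph \<Rightarrow> 'v \<Rightarrow> nat" where
  "valence \<Gamma> v = card (half_edges_at \<Gamma> v)"

definition essential :: "('v, 'e) cw_graph \<Rightarrow> 'v set" where
  "essential \<Gamma> = {v \<in> verts \<Gamma>. 3 \<le> valence \<Gamma> v}"

text \<open>The underlying space: the vertices together with the open edges \<open>(0,1)\<close>, with the weak topology.\<close>

datatype ('v, 'e) point = Vtx 'v | Pt 'e real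

definition char_map :: "('v, 'e) cw_graph \<Rightarrow> 'e \<Rightarrow> real \<Rightarrow> ('v, 'e) point" where
  "char_map \<Gamma> e t =
     (if t = 0 then Vtx (att \<Gamma> (e, False)) else if t = 1 then Vtx (att \<Gamma> (e, True)) else Pt e t)"

definition points :: "('v, 'e) cw_graph \<Rightarrow> ('v, 'e) point set" where
  "points \<Gamma> = Vtx ` verts \<Gamma> \<union> {Pt e t | e t. e \<in> edges \<Gamma> \<and> 0 < t \<and> t < 1}"

definition space_of :: "('v, 'e) cw_graph \<Rightarrow> ('v, 'e) point topology" where
  "space_of \<Gamma> = topology (\<lambda>U. U \<subseteq> points \<Gamma> \<and>
     (\<forall>e \<in> edges \<Gamma>. openin (top_of_set {0..1}) {t \<in> {0..1}. char_map \<Gamma> e t \<in> U}))"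

lemma openin_space_of:
  "openin (space_of \<Gamma>) U \<longleftrightarrow> U \<subseteq> points \<Gamma> \<and>
     (\<forall>e \<in> edges \<Gamma>. openin (top_of_set {0..1}) {t \<in> {0..1}. char_map \<Gamma> e t \<in> U})"
proof -
  have "istopology (\<lambda>U. U \<subseteq> points \<Gamma> \<and>
     (\<forall>e \<in> edges \<Gamma>. openin (top_of_set {0..1}) {t \<in> {0..1}. char_map \<Gamma> e t \<in> U}))"
    unfolding istopology_def
  proof (intro conjI allI impI ballI)
    fix S T e
    assume S: "S \<subseteq> points \<Gamma> \<and>
        (\<forall>e\<in>edges \<Gamma>. openin (top_of_set {0..1}) {t \<in> {0..1}. char_map \<Gamma> e t \<in> S})"
      and T: "T \<subseteq> points \<Gamma> \<and>
        (\<forall>e\<in>edges \<Gamma>. openin (top_of_set {0..1}) {t \<in> {0..1}. char_map \<Gamma> e t \<in> T})"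
    show "S \<inter> T \<subseteq> points \<Gamma>" using S by blast
    assume e: "e \<in> edges \<Gamma>"
    have "{t \<in> {0..1}. char_map \<Gamma> e t \<in> S \<inter> T} =
        {t \<in> {0..1}. char_map \<Gamma> e t \<in> S} \<inter> {t \<in> {0..1}. char_map \<Gamma> e t \<in> T}"
      by auto
    then show "openin (top_of_set {0..1}) {t \<in> {0..1}. char_map \<Gamma> e t \<in> S \<inter> T}"
      using openin_Int[OF bspec[OF conjunct2[OF S] e] bspec[OF conjunct2[OF T] e]] by (simp only:)
  next
    fix K e
    assume K: "\<forall>S\<in>K. S \<subseteq> points \<Gamma> \<and>
        (\<forall>e\<in>edges \<Gamma>. openin (top_of_set {0..1}) {t \<in> {0..1}. char_map \<Gamma> e t \<in> S})"
    show "\<Union>K \<subseteq> points \<Gamma>" using K by blast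
    assume e: "e \<in> edges \<Gamma>"
    have "openin (top_of_set {0..1}) (\<Union>S\<in>K. {t \<in> {0..1}. char_map \<Gamma> e t \<in> S})"
    proof (rule openin_Union)
      fix A assume "A \<in> (\<lambda>S. {t \<in> {0..1}. char_map \<Gamma> e t \<in> S}) ` K"
      then obtain S where "S \<in> K" and A: "A = {t \<in> {0..1}. char_map \<Gamma> e t \<in> S}"
        by (rule imageE)
      then show "openin (top_of_set {0..1}) A"
        unfolding A using bspec[OF conjunct2[OF bspec[OF K]] e] by blast
    qed
    moreover have "{t \<in> {0..1}. char_map \<Gamma> e t \<in> \<Union>K} = (\<Union>S\<in>K. {t \<in> {0..1}. char_map \<Gamma> e t \<in> S})"
      by auto
    ultimately show "openin (top_of_set {0..1}) {t \<in> {0..1}. char_map \<Gamma> e t \<in> \<Union>K}"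
      by (simp only:)
  qed
  then show ?thesis
    unfolding space_of_def by (simp only: topology_inverse')
qed

definition connected_graph :: "('v, 'e) cw_graph \<Rightarrow> bool" where
  "connected_graph \<Gamma> \<longleftrightarrow> connected_space (space_of \<Gamma>)"

definition Delta_set :: "('v, 'e) cw_graph \<Rightarrow> 'v set \<Rightarrow> nat" where
  "Delta_set \<Gamma> W =
     card (connected_components_of (subtopology (space_of \<Gamma>) (points \<Gamma> - Vtx ` W)))"

definition essential_sets :: "('v, 'e) cw_graph \<Rightarrow> nat \<Rightarrow> 'v set set" where
  "essential_sets \<Gamma> i = {W. W \<subseteq> essential \<Gamma> \<and> card W = i}"

text \<open>The value is \<open>0\<close> if there are fewer than \<open>i\<close> essential vertices.\<close>

definition Delta :: "('v, 'e) cw_graph \<Rightarrow> nat \<Rightarrow> nat" where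
  "Delta \<Gamma> i = Max (insert 0 (Delta_set \<Gamma> ` essential_sets \<Gamma> i))"

subsection \<open>The Swiatkowski complex\<close>

text \<open>
  \<open>R[E]\<close> consists of the polynomials \<open>('e \<Rightarrow>\<^sub>0 nat) \<Rightarrow>\<^sub>0 'f\<close> whose variables lie in \<open>E\<close>. Since
  \<open>\<Otimes>\<^sub>v S(v)\<close> is free on the families of generators \<open>s v \<in> {\<emptyset>, v} \<union> H(v)\<close>, the complex is free
  over \<open>R[E]\<close> on such families; they are extended by \<open>\<emptyset>\<close> outside \<open>V\<close>.
\<close>

type_synonym ('e, 'f) edge_poly = "('e \<Rightarrow>\<^sub>0 nat) \<Rightarrow>\<^sub>0 'f"

datatype 'e gen = Empty | Vert | is_Half: Half (the_half: "'e \<times> bool")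

type_synonym ('v, 'e) state = "'v \<Rightarrow> 'e gen"

type_synonym ('v, 'e, 'f) chain = "('v, 'e) state \<Rightarrow>\<^sub>0 ('e, 'f) edge_poly"

definition edge_polys :: "('v, 'e) cw_graph \<Rightarrow> ('e, 'f::comm_ring_1) edge_poly set" where
  "edge_polys \<Gamma> = {p. \<forall>m \<in> Poly_Mapping.keys p. Poly_Mapping.keys m \<subseteq> edges \<Gamma>}"

definition edge_var :: "'e \<Rightarrow> ('e, 'f::comm_ring_1) edge_poly" where
  "edge_var e = Poly_Mapping.single (Poly_Mapping.single e 1) 1"

definition const_poly :: "'f \<Rightarrow> ('e, 'f::comm_ring_1) edge_poly" where
  "const_poly a = Poly_Mapping.single 0 a"

definition states :: "('v, 'e) cw_graph \<Rightarrow> ('v, 'e) state set" where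
  "states \<Gamma> = {s. (\<forall>v \<in> verts \<Gamma>. s v \<in> {Empty, Vert} \<union> Half ` half_edges_at \<Gamma> v) \<and>
                   (\<forall>v. v \<notin> verts \<Gamma> \<longrightarrow> s v = Empty)}"

definition act :: "('e, 'f::comm_ring_1) edge_poly \<Rightarrow> ('s \<Rightarrow>\<^sub>0 ('e, 'f) edge_poly) \<Rightarrow>
    ('s \<Rightarrow>\<^sub>0 ('e, 'f) edge_poly)" where
  "act p c = Poly_Mapping.map ((*) p) c"

definition chains :: "('v, 'e) cw_graph \<Rightarrow> nat \<Rightarrow> ('v, 'e, 'f::comm_ring_1) chain set" where
  "chains \<Gamma> i = {c. \<forall>s \<in> Poly_Mapping.keys c. s \<in> states \<Gamma> \<and>
     card {v \<in> verts \<Gamma>. is_Half (s v)} = i \<and> Poly_Mapping.lookup c s \<in> edge_polys \<Gamma>}"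

definition has_particles :: "('v, 'e) cw_graph \<Rightarrow> nat \<Rightarrow> ('v, 'e, 'f::comm_ring_1) chain \<Rightarrow> bool" where
  "has_particles \<Gamma> k c \<longleftrightarrow>
     (\<forall>s \<in> Poly_Mapping.keys c. \<forall>m \<in> Poly_Mapping.keys (Poly_Mapping.lookup c s).
        (\<Sum>e \<in> Poly_Mapping.keys m. Poly_Mapping.lookup m e) + card {v \<in> verts \<Gamma>. s v \<noteq> Empty} = k)"

text \<open>
  The linear order on the vertices serves only to order the tensor factors, i.e. to fix the
  signs: \<open>\<partial>\<close> passes the degree-one generators at the vertices preceding \<open>v\<close>.
\<close>

definition boundary_state ::
    "('v::linorder, 'e) cw_graph \<Rightarrow> ('v, 'e) state \<Rightarrow> ('v, 'e, 'f::comm_ring_1) chain" where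
  "boundary_state \<Gamma> s = (\<Sum>v \<in> {v \<in> verts \<Gamma>. is_Half (s v)}.
     act ((- 1) ^ card {u \<in> verts \<Gamma>. u < v \<and> is_Half (s u)})
       (Poly_Mapping.single (s(v := Empty)) (edge_var (fst (the_half (s v))))
        - Poly_Mapping.single (s(v := Vert)) 1))"

definition boundary ::
    "('v::linorder, 'e) cw_graph \<Rightarrow> ('v, 'e, 'f::comm_ring_1) chain \<Rightarrow> ('v, 'e, 'f) chain" where
  "boundary \<Gamma> c =
     (\<Sum>s \<in> Poly_Mapping.keys c. act (Poly_Mapping.lookup c s) (boundary_state \<Gamma> s))"

definition cycles ::
    "('v::linorder, 'e) cw_graph \<Rightarrow> nat \<Rightarrow> ('v, 'e, 'f::comm_ring_1) chain set" where
  "cycles \<Gamma> i = {c \<in> chains \<Gamma> i. boundary \<Gamma> c = 0}"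

definition boundaries ::
    "('v::linorder, 'e) cw_graph \<Rightarrow> nat \<Rightarrow> ('v, 'e, 'f::comm_ring_1) chain set" where
  "boundaries \<Gamma> i = boundary \<Gamma> ` chains \<Gamma> (Suc i)"

subsection \<open>Homology\<close>

text \<open>Homology classes are cosets of the boundaries in the cycles.\<close>

definition hclass :: "('v::linorder, 'e) cw_graph \<Rightarrow> nat \<Rightarrow> ('v, 'e, 'f::comm_ring_1) chain \<Rightarrow>
    ('v, 'e, 'f) chain set" where
  "hclass \<Gamma> i z = {z + b | b. b \<in> boundaries \<Gamma> i}"

definition homology_part ::
    "('v::linorder, 'e) cw_graph \<Rightarrow> nat \<Rightarrow> nat \<Rightarrow> ('v, 'e, 'f::comm_ring_1) chain set set" where
  "homology_part \<Gamma> i k = hclass \<Gamma> i ` {z \<in> cycles \<Gamma> i. has_particles \<Gamma> k z}"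

definition class_add :: "('v, 'e, 'f::comm_ring_1) chain set \<Rightarrow> ('v, 'e, 'f) chain set \<Rightarrow>
    ('v, 'e, 'f) chain set" where
  "class_add X Y = {x + y | x y. x \<in> X \<and> y \<in> Y}"

definition class_act :: "('v::linorder, 'e) cw_graph \<Rightarrow> nat \<Rightarrow> ('e, 'f::comm_ring_1) edge_poly \<Rightarrow>
    ('v, 'e, 'f) chain set \<Rightarrow> ('v, 'e, 'f) chain set" where
  "class_act \<Gamma> i p X = {act p x + b | x b. x \<in> X \<and> b \<in> boundaries \<Gamma> i}"

text \<open>The linear combination \<open>\<Sum>X\<in>S. f X \<cdot> X\<close> of homology classes.\<close>

definition class_lincomb :: "('v::linorder, 'e) cw_graph \<Rightarrow> nat \<Rightarrow>
    (('v, 'e, 'f::comm_ring_1) chain set \<Rightarrow> 'f) \<Rightarrow> ('v, 'e, 'f) chain set set \<Rightarrow>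
    ('v, 'e, 'f) chain set" where
  "class_lincomb \<Gamma> i f S = {(\<Sum>X \<in> S. act (const_poly (f X)) (r X)) + b | r b.
     (\<forall>X \<in> S. r X \<in> X) \<and> b \<in> boundaries \<Gamma> i}"

definition class_basis :: "('v::linorder, 'e) cw_graph \<Rightarrow> nat \<Rightarrow>
    ('v, 'e, 'f::field) chain set set \<Rightarrow> ('v, 'e, 'f) chain set set \<Rightarrow> bool" where
  "class_basis \<Gamma> i T S \<longleftrightarrow> finite S \<and> S \<subseteq> T \<and>
     (\<forall>X \<in> T. \<exists>!f. f \<in> extensional S \<and> X = class_lincomb \<Gamma> i f S)"

text \<open>The dimension of a finite-dimensional space \<open>T\<close> of homology classes.\<close>

definition class_dim :: "('v::linorder, 'e) cw_graph \<Rightarrow> nat \<Rightarrow>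
    ('v, 'e, 'f::field) chain set set \<Rightarrow> nat" where
  "class_dim \<Gamma> i T = card (SOME S. class_basis \<Gamma> i T S)"

subsection \<open>Tori\<close>

definition star_chain :: "('e \<times> bool) \<Rightarrow> ('e \<times> bool) \<Rightarrow> ('e \<times> bool) \<Rightarrow>
    ('e gen \<Rightarrow>\<^sub>0 ('e, 'f::comm_ring_1) edge_poly)" where
  "star_chain h1 h2 h3 =
     (let g = (\<lambda>h. Poly_Mapping.single (Half h) 1) in
        act (edge_var (fst h3)) (g h1 - g h2)
      + act (edge_var (fst h2)) (g h3 - g h1)
      + act (edge_var (fst h1)) (g h2 - g h3))"

text \<open>The tensor product, over \<open>R[E]\<close>, of elements \<open>a v\<close> of \<open>R[E] \<otimes> S(v)\<close> for \<open>v \<in> V\<close>.\<close>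

definition tensor :: "('v, 'e) cw_graph \<Rightarrow> ('v \<Rightarrow> ('e gen \<Rightarrow>\<^sub>0 ('e, 'f::comm_ring_1) edge_poly)) \<Rightarrow>
    ('v, 'e, 'f) chain" where
  "tensor \<Gamma> a = (\<Sum>s \<in> states \<Gamma>.
     Poly_Mapping.single s (\<Prod>v \<in> verts \<Gamma>. Poly_Mapping.lookup (a v) (s v)))"

definition star_choice :: "('v, 'e) cw_graph \<Rightarrow> 'v set \<Rightarrow>
    ('v \<Rightarrow> ('e \<times> bool) \<times> ('e \<times> bool) \<times> ('e \<times> bool)) \<Rightarrow> bool" where
  "star_choice \<Gamma> W t \<longleftrightarrow> (\<forall>w \<in> W. case t w of (h1, h2, h3) \<Rightarrow>
     {h1, h2, h3} \<subseteq> half_edges_at \<Gamma> w \<and> h1 \<noteq> h2 \<and> h1 \<noteq> h3 \<and> h2 \<noteq> h3)"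

definition torus_chain :: "('v, 'e) cw_graph \<Rightarrow> 'v set \<Rightarrow>
    ('v \<Rightarrow> ('e \<times> bool) \<times> ('e \<times> bool) \<times> ('e \<times> bool)) \<Rightarrow> ('v, 'e, 'f::comm_ring_1) chain" where
  "torus_chain \<Gamma> W t = tensor \<Gamma> (\<lambda>v.
     if v \<in> W then (case t v of (h1, h2, h3) \<Rightarrow> star_chain h1 h2 h3)
     else Poly_Mapping.single Empty 1)"

inductive_set torus_module ::
    "('v::linorder, 'e) cw_graph \<Rightarrow> nat \<Rightarrow> ('v, 'e, 'f::comm_ring_1) chain set set"
  for \<Gamma> :: "('v::linorder, 'e) cw_graph" and i :: nat where
  torus: "W \<in> essential_sets \<Gamma> i \<Longrightarrow> star_choice \<Gamma> W t \<Longrightarrow>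
    hclass \<Gamma> i (torus_chain \<Gamma> W t) \<in> torus_module \<Gamma> i"
| zero: "hclass \<Gamma> i 0 \<in> torus_module \<Gamma> i"
| add: "X \<in> torus_module \<Gamma> i \<Longrightarrow> Y \<in> torus_module \<Gamma> i \<Longrightarrow> class_add X Y \<in> torus_module \<Gamma> i"
| act: "p \<in> edge_polys \<Gamma> \<Longrightarrow> X \<in> torus_module \<Gamma> i \<Longrightarrow> class_act \<Gamma> i p X \<in> torus_module \<Gamma> i"

definition torus_part ::
    "('v::linorder, 'e) cw_graph \<Rightarrow> nat \<Rightarrow> nat \<Rightarrow> ('v, 'e, 'f::comm_ring_1) chain set set" where
  "torus_part \<Gamma> i k = torus_module \<Gamma> i \<inter> homology_part \<Gamma> i k"

subsection \<open>Asymptotic equivalence\<close>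

text \<open>Unlike \<^const>\<open>asymp_equiv\<close>, this requires both functions to be eventually nonzero.\<close>

definition asymptotic :: "(nat \<Rightarrow> real) \<Rightarrow> (nat \<Rightarrow> real) \<Rightarrow> bool" where
  "asymptotic f g \<longleftrightarrow> (\<forall>\<^sub>F k in sequentially. f k \<noteq> 0 \<and> g k \<noteq> 0) \<and>
     (\<lambda>k. f k / g k) \<longlonglongrightarrow> 1"

end

theory Submission
  imports Defs
begin

text \<open>
  On a \<open>W\<close>-torus two edges act equally if they share a vertex outside \<open>W\<close>, so \<open>R[E]\<close> acts on the
  span of the \<open>W\<close>-tori through a polynomial ring with one variable \<open>X\<^sub>C\<close> for each component \<open>C\<close> of
  the complement of \<open>W\<close>. Suppose that \<open>W\<close> attains the maximum \<open>\<Delta> > 1\<close>. Then every \<open>w \<in> W\<close> has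
  half-edges \<open>a\<close> and \<open>b\<close> in different components, for otherwise replacing \<open>w\<close> by another essential
  vertex would create more components. The relation
  \<open>(e\<^sub>b - e\<^sub>a) \<alpha>\<^sub>1\<^sub>2\<^sub>3 = (e\<^sub>1 - e\<^sub>3) \<alpha>\<^sub>a\<^sub>b\<^sub>2 + (e\<^sub>2 - e\<^sub>1) \<alpha>\<^sub>a\<^sub>b\<^sub>3 + (e\<^sub>3 - e\<^sub>2) \<alpha>\<^sub>a\<^sub>b\<^sub>1\<close>
  shows that the \<open>\<Prod>\<^sub>w (d(w) - 2)\<close> tori built from star classes \<open>\<alpha>\<^sub>a\<^sub>b\<^sub>k\<close> generate all \<open>W\<close>-tori up to
  terms in which the variable of some \<open>b\<close> is missing; these, and the tori of nonmaximal sets,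
  contribute only \<open>O(k\<^bsup>\<Delta>-2\<^esup>)\<close>. Conversely, the monomial multiples of these tori, for all maximal
  \<open>W\<close> together, are linearly independent: reading off the coefficient of a family of half-edges
  \<open>(h\<^sub>w)\<^sub>w\<close> and identifying every vertex and edge outside \<open>W\<close> with the variable of its component
  kills all boundaries, and maps the torus of the \<open>\<alpha>\<^sub>a\<^sub>b\<^sub>k\<close> with \<open>k = h\<^sub>w\<close> to
  \<open>\<Prod>\<^sub>w (X\<^sub>b - X\<^sub>a) \<noteq> 0\<close> and every other such torus to \<open>0\<close>.
\<close>

subsection \<open>Components of the complement of a vertex set\<close>

text \<open>Topology enters only through functions on edges that are constant across every vertex
  outside \<open>W\<close>. They stand for the locally constant functions on the complement, and the
  component map is the finest of them. Lower bounds on the number of components and the transport of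
  relations along a component both come from testing such functions. The factor
  \<open>e_b - e_a\<close> of the exchange relation cannot be divided out. It is used the other way:
  an edge in the component of \<open>b\<close> is traded for one in the component of
  \<open>a\<close>, at the price of tori that already have the wanted form at that vertex, until no
  edge of the component of \<open>b\<close> is left. This is why generation holds only up to
  monomials that miss a variable. Each star class uses two particles, so the monomials that count
  have degree \<open>k - 2i\<close> in \<Delta> variables, which is the origin of the power of
  \<open>k\<close> and of the factorial; \<open>d(w) - 2\<close> counts the half-edges at
  \<open>w\<close> other than \<open>a\<close> and \<open>b\<close>.\<close>

definition cut_compatible :: "('v, 'e) cw_graph \<Rightarrow> 'v set \<Rightarrow> ('e \<Rightarrow> 'c) \<Rightarrow> bool" where
  "cut_compatible \<Gamma> W f \<longleftrightarrow> (\<forall>h \<in> edges \<Gamma> \<times> UNIV. \<forall>h' \<in> edges \<Gamma> \<times> UNIV.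
     att \<Gamma> h = att \<Gamma> h' \<longrightarrow> att \<Gamma> h \<notin> W \<longrightarrow> f (fst h) = f (fst h'))"

lemma cut_compatibleD:
  "\<lbrakk>cut_compatible \<Gamma> W f; h \<in> edges \<Gamma> \<times> UNIV; h' \<in> edges \<Gamma> \<times> UNIV; att \<Gamma> h = att \<Gamma> h'; att \<Gamma> h \<notin> W\<rbrakk>
    \<Longrightarrow> f (fst h) = f (fst h')"
  unfolding cut_compatible_def by blast

definition cut_space :: "('v, 'e) cw_graph \<Rightarrow> 'v set \<Rightarrow> ('v, 'e) point topology" where
  "cut_space \<Gamma> W = subtopology (space_of \<Gamma>) (points \<Gamma> - Vtx ` W)"

text \<open>The midpoint serves as base point because it lies in the open edge and survives every
  cut.\<close>

definition edge_comp :: "('v, 'e) cw_graph \<Rightarrow> 'v set \<Rightarrow> 'e \<Rightarrow> ('v, 'e) point set" where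
  "edge_comp \<Gamma> W e = connected_component_of_set (cut_space \<Gamma> W) (Pt e (1/2))"

lemma finite_verts: "finite_graph \<Gamma> \<Longrightarrow> finite (verts \<Gamma>)"
  by (simp add: finite_graph_def)

lemma finite_edges: "finite_graph \<Gamma> \<Longrightarrow> finite (edges \<Gamma>)"
  by (simp add: finite_graph_def)

lemma topspace_space_of [simp]:
  assumes "finite_graph \<Gamma>"
  shows "topspace (space_of \<Gamma>) = points \<Gamma>"
proof -
  have "openin (space_of \<Gamma>) (points \<Gamma>)"
    unfolding openin_space_of
  proof (intro conjI ballI)
    fix e assume "e \<in> edges \<Gamma>"
    then have "{t \<in> {0..1}. char_map \<Gamma> e t \<in> points \<Gamma>} = {0..1}"
      using assms by (auto simp: char_map_def points_def finite_graph_def)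
    then show "openin (top_of_set {0..1}) {t \<in> {0..1}. char_map \<Gamma> e t \<in> points \<Gamma>}"
      by (metis openin_subtopology_self)
  qed simp
  then show ?thesis
    unfolding topspace_def by (auto simp: openin_space_of)
qed

lemma topspace_cut_space [simp]:
  "finite_graph \<Gamma> \<Longrightarrow> topspace (cut_space \<Gamma> W) = points \<Gamma> - Vtx ` W"
  by (auto simp: cut_space_def)

lemma openin_minus_ends:
  fixes F T :: bool
  shows "openin (top_of_set {0..1::real}) {t \<in> {0..1}. (t = 0 \<longrightarrow> F) \<and> (t = 1 \<longrightarrow> T)}"
proof -
  have "{t \<in> {0..1}. (t = 0 \<longrightarrow> F) \<and> (t = 1 \<longrightarrow> T)} =
     {0..1::real} \<inter> ((if F then UNIV else - {0}) \<inter> (if T then UNIV else - {1}))"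
    by auto
  moreover have "open ((if F then UNIV else - {0}) \<inter> (if T then UNIV else - {1::real}))"
    by (intro open_Int) (auto simp: open_Compl)
  ultimately show ?thesis
    by (metis openin_open_Int)
qed

text \<open>At a vertex outside \<open>W\<close> compatibility makes all incident edges agree. On
  each closed edge the preimage is therefore empty or the whole interval without those ends that lie
  in \<open>W\<close>. Applied to \<open>P\<close> and to its negation, this separates the
  complement of \<open>W\<close>.\<close>

lemma openin_level_set:
  fixes P :: "'e \<Rightarrow> bool"
  assumes P: "cut_compatible \<Gamma> W P"
  defines "U \<equiv> {Pt e t | e t. e \<in> edges \<Gamma> \<and> 0 < t \<and> t < 1 \<and> P e} \<union>
     {Vtx v | v. v \<in> verts \<Gamma> - W \<and> (\<exists>h \<in> half_edges_at \<Gamma> v. P (fst h))}"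
  assumes fin: "finite_graph \<Gamma>"
  shows "openin (space_of \<Gamma>) U"
  unfolding openin_space_of
proof (intro conjI ballI)
  show "U \<subseteq> points \<Gamma>" unfolding U_def points_def by auto
next
  fix e assume e: "e \<in> edges \<Gamma>"
  have av: "att \<Gamma> (e, b) \<in> verts \<Gamma>" for b
    using fin e unfolding finite_graph_def by auto
  have end_iff: "Vtx (att \<Gamma> (e, b)) \<in> U \<longleftrightarrow> att \<Gamma> (e, b) \<notin> W \<and> P e" for b
  proof
    assume "Vtx (att \<Gamma> (e, b)) \<in> U"
    then obtain h where h: "h \<in> half_edges_at \<Gamma> (att \<Gamma> (e, b))" "P (fst h)" "att \<Gamma> (e, b) \<notin> W"
      unfolding U_def by auto
    then show "att \<Gamma> (e, b) \<notin> W \<and> P e"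
      using cut_compatibleD[OF P, of h "(e, b)"] e unfolding half_edges_at_def by auto
  next
    assume "att \<Gamma> (e, b) \<notin> W \<and> P e"
    then show "Vtx (att \<Gamma> (e, b)) \<in> U"
      using e av[of b] unfolding U_def half_edges_at_def by force
  qed
  have "{t \<in> {0..1}. char_map \<Gamma> e t \<in> U} =
     (if P e then {t \<in> {0..1}. (t = 0 \<longrightarrow> att \<Gamma> (e, False) \<notin> W) \<and> (t = 1 \<longrightarrow> att \<Gamma> (e, True) \<notin> W)} else {})"
  proof (intro set_eqI)
    fix t
    show "t \<in> {t \<in> {0..1}. char_map \<Gamma> e t \<in> U} \<longleftrightarrow> t \<in>
     (if P e then {t \<in> {0..1}. (t = 0 \<longrightarrow> att \<Gamma> (e, False) \<notin> W) \<and> (t = 1 \<longrightarrow> att \<Gamma> (e, True) \<notin> W)} else {})"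
    proof (cases "t = 0 \<or> t = 1")
      case True
      then show ?thesis
        using end_iff by (auto simp: char_map_def)
    next
      case False
      then have "char_map \<Gamma> e t = Pt e t" by (simp add: char_map_def)
      moreover have "Pt e t \<in> U \<longleftrightarrow> 0 < t \<and> t < 1 \<and> P e"
        using e unfolding U_def by auto
      ultimately show ?thesis
        using False by auto
    qed
  qed
  then show "openin (top_of_set {0..1}) {t \<in> {0..1}. char_map \<Gamma> e t \<in> U}"
    using openin_minus_ends by simp
qed

text \<open>An isolated vertex would be an open and closed point different from the essential
  vertex. The consequence of interest is that every component of a complement contains an edge, so
  that components can be counted on edges.\<close>

lemma no_isolated_vertex:
  assumes fin: "finite_graph \<Gamma>" and con: "connected_graph \<Gamma>" and ess: "essential \<Gamma> \<noteq> {}"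
    and v: "v \<in> verts \<Gamma>"
  shows "half_edges_at \<Gamma> v \<noteq> {}"
proof
  assume empty: "half_edges_at \<Gamma> v = {}"
  obtain w where w: "w \<in> verts \<Gamma>" "valence \<Gamma> w \<ge> 3"
    using ess unfolding essential_def by auto
  then have "w \<noteq> v" using empty unfolding valence_def by auto
  have noatt: "att \<Gamma> (e, b) \<noteq> v" if "e \<in> edges \<Gamma>" for e b
    using empty that unfolding half_edges_at_def by auto
  have 1: "openin (space_of \<Gamma>) {Vtx v}"
    unfolding openin_space_of
  proof (intro conjI ballI)
    fix e assume "e \<in> edges \<Gamma>"
    then have "{t \<in> {0..1}. char_map \<Gamma> e t \<in> {Vtx v}} = {}"
      using noatt by (auto simp: char_map_def)
    then show "openin (top_of_set {0..1}) {t \<in> {0..1}. char_map \<Gamma> e t \<in> {Vtx v}}" by (simp only: openin_empty)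
  qed (use v in \<open>auto simp: points_def\<close>)
  have 2: "openin (space_of \<Gamma>) (points \<Gamma> - {Vtx v})"
    unfolding openin_space_of
  proof (intro conjI ballI)
    fix e assume "e \<in> edges \<Gamma>"
    then have "{t \<in> {0..1}. char_map \<Gamma> e t \<in> points \<Gamma> - {Vtx v}} = {0..1}"
      using noatt fin by (auto simp: char_map_def points_def finite_graph_def)
    then show "openin (top_of_set {0..1}) {t \<in> {0..1}. char_map \<Gamma> e t \<in> points \<Gamma> - {Vtx v}}"
      by (metis openin_subtopology_self)
  qed auto
  have "Vtx w \<in> points \<Gamma> - {Vtx v}" "Vtx v \<in> {Vtx v}"
    using w \<open>w \<noteq> v\<close> by (auto simp: points_def)
  moreover have "points \<Gamma> \<subseteq> {Vtx v} \<union> (points \<Gamma> - {Vtx v})" by auto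
  ultimately show False
    using con 1 2 fin unfolding connected_graph_def connected_space_def by (metis Diff_disjoint empty_iff topspace_space_of)
qed

lemma continuous_map_char_map:
  assumes "finite_graph \<Gamma>" "e \<in> edges \<Gamma>"
  shows "continuous_map (top_of_set {0..1}) (space_of \<Gamma>) (char_map \<Gamma> e)"
  unfolding continuous_map_def
proof (intro conjI allI impI)
  show "char_map \<Gamma> e \<in> topspace (top_of_set {0..1}) \<rightarrow> topspace (space_of \<Gamma>)"
    using assms by (auto simp: char_map_def points_def finite_graph_def)
qed (use assms in \<open>auto simp: openin_space_of\<close>)

lemma connected_minus_ends:
  fixes F T :: bool
  shows "connected {t \<in> {0..1::real}. (t = 0 \<longrightarrow> F) \<and> (t = 1 \<longrightarrow> T)}"
proof -
  have "{t \<in> {0..1::real}. (t = 0 \<longrightarrow> F) \<and> (t = 1 \<longrightarrow> T)} =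
     (if F then if T then {0..1} else {0..<1} else if T then {0<..1} else {0<..<1})"
    by (auto simp: less_le)
  then show ?thesis by simp
qed

text \<open>The part of the closed edge that avoids \<open>W\<close> is the image of an interval,
  hence connected, and it contains the midpoint.\<close>

lemma char_map_in_edge_comp:
  assumes fin: "finite_graph \<Gamma>" and e: "e \<in> edges \<Gamma>"
    and t: "0 \<le> t" "t \<le> 1" "t = 0 \<Longrightarrow> att \<Gamma> (e, False) \<notin> W" "t = 1 \<Longrightarrow> att \<Gamma> (e, True) \<notin> W"
  shows "char_map \<Gamma> e t \<in> edge_comp \<Gamma> W e"
proof -
  define J where "J = {t \<in> {0..1::real}. (t = 0 \<longrightarrow> att \<Gamma> (e, False) \<notin> W) \<and> (t = 1 \<longrightarrow> att \<Gamma> (e, True) \<notin> W)}"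
  have "connectedin (top_of_set {0..1}) J"
    unfolding J_def by (subst connectedin_subtopology) (use connected_minus_ends in auto)
  then have "connectedin (space_of \<Gamma>) (char_map \<Gamma> e ` J)"
    using connectedin_continuous_map_image continuous_map_char_map[OF fin e] by blast
  moreover have "char_map \<Gamma> e ` J \<subseteq> points \<Gamma> - Vtx ` W"
    using fin e by (auto simp: J_def char_map_def points_def finite_graph_def)
  ultimately have "connectedin (cut_space \<Gamma> W) (char_map \<Gamma> e ` J)"
    unfolding cut_space_def connectedin_subtopology by blast
  moreover have "Pt e (1/2) \<in> char_map \<Gamma> e ` J"
    by (rule image_eqI[where x = "1/2"]) (auto simp: J_def char_map_def)
  moreover have "char_map \<Gamma> e t \<in> char_map \<Gamma> e ` J"
    using t by (auto simp: J_def)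
  ultimately show ?thesis
    unfolding edge_comp_def connected_component_of_def by blast
qed

lemma edge_comp_nonempty:
  "finite_graph \<Gamma> \<Longrightarrow> e \<in> edges \<Gamma> \<Longrightarrow> Pt e (1/2) \<in> edge_comp \<Gamma> W e"
  using char_map_in_edge_comp[of \<Gamma> e "1/2" W] by (simp add: char_map_def)

lemma edge_comp_eqI:
  assumes "p \<in> edge_comp \<Gamma> W e" "p \<in> edge_comp \<Gamma> W e'"
  shows "edge_comp \<Gamma> W e = edge_comp \<Gamma> W e'"
  using assms unfolding edge_comp_def
  by (metis connected_component_of_equiv mem_Collect_eq)

lemma vertex_in_edge_comp:
  assumes "finite_graph \<Gamma>" "h \<in> edges \<Gamma> \<times> UNIV" "att \<Gamma> h \<notin> W"
  shows "Vtx (att \<Gamma> h) \<in> edge_comp \<Gamma> W (fst h)"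
proof -
  obtain e b where h: "h = (e, b)" by (cases h)
  show ?thesis
    using char_map_in_edge_comp[of \<Gamma> e "of_bool b" W] assms
    unfolding h by (cases b) (auto simp: char_map_def)
qed

lemma cut_compatible_edge_comp: "finite_graph \<Gamma> \<Longrightarrow> cut_compatible \<Gamma> W (edge_comp \<Gamma> W)"
  unfolding cut_compatible_def
  by (metis edge_comp_eqI vertex_in_edge_comp)

text \<open>The sets on which \<open>P\<close> holds and fails are disjoint, open and cover the
  complement of \<open>W\<close>, so a component lies in one of them. Hence every compatible
  function factors through \<open>edge_comp\<close>.\<close>

lemma edge_comp_universal:
  fixes P :: "'e \<Rightarrow> bool"
  assumes fin: "finite_graph \<Gamma>" and iso: "\<And>v. v \<in> verts \<Gamma> \<Longrightarrow> half_edges_at \<Gamma> v \<noteq> {}"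
    and P: "cut_compatible \<Gamma> W P" and e: "e \<in> edges \<Gamma>" "e' \<in> edges \<Gamma>"
    and eq: "edge_comp \<Gamma> W e = edge_comp \<Gamma> W e'"
  shows "P e \<Longrightarrow> P e'"
proof (rule ccontr)
  assume Pe: "P e" and nPe: "\<not> P e'"
  define U where "U Q = {Pt e t | e t. e \<in> edges \<Gamma> \<and> 0 < t \<and> t < 1 \<and> Q e} \<union>
     {Vtx v | v. v \<in> verts \<Gamma> - W \<and> (\<exists>h \<in> half_edges_at \<Gamma> v. Q (fst h))}" for Q
  have nP: "cut_compatible \<Gamma> W (\<lambda>e. \<not> P e)"
    using P unfolding cut_compatible_def by blast
  have o: "openin (space_of \<Gamma>) (U P)" "openin (space_of \<Gamma>) (U (\<lambda>e. \<not> P e))"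
    using openin_level_set[OF P fin] openin_level_set[OF nP fin] unfolding U_def by auto
  have disj: "U P \<inter> U (\<lambda>e. \<not> P e) = {}"
  proof -
    have "\<not> P (fst h')" if "h \<in> half_edges_at \<Gamma> v" "h' \<in> half_edges_at \<Gamma> v" "v \<notin> W" "\<not> P (fst h)" for h h' v
      using cut_compatibleD[OF P, of h h'] that unfolding half_edges_at_def by auto
    then show ?thesis unfolding U_def by blast
  qed
  have sub: "points \<Gamma> - Vtx ` W \<subseteq> U P \<union> U (\<lambda>e. \<not> P e)"
    using iso unfolding U_def points_def by fastforce
  have con: "connectedin (space_of \<Gamma>) (edge_comp \<Gamma> W e)"
    and s: "edge_comp \<Gamma> W e \<subseteq> points \<Gamma> - Vtx ` W"
    using connectedin_connected_component_of[of "cut_space \<Gamma> W" "Pt e (1/2)"]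
    unfolding edge_comp_def[symmetric] unfolding cut_space_def connectedin_subtopology by auto
  have mid: "Pt x (1/2) \<in> U Q" if "x \<in> edges \<Gamma>" "Q x" for x Q
    unfolding U_def using that by (intro UnI1 CollectI exI[of _ x] exI[of _ "1/2"]) auto
  have "U P \<inter> edge_comp \<Gamma> W e \<noteq> {}"
    using mid[of e P] e Pe edge_comp_nonempty[OF fin e(1)] by blast
  moreover have "U (\<lambda>e. \<not> P e) \<inter> edge_comp \<Gamma> W e \<noteq> {}"
    using mid[of e' "\<lambda>e. \<not> P e"] e nPe edge_comp_nonempty[OF fin e(2)] unfolding eq by blast
  moreover have "edge_comp \<Gamma> W e \<subseteq> U P \<union> U (\<lambda>e. \<not> P e)" using s sub by (rule order_trans)
  moreover have "U P \<inter> U (\<lambda>e. \<not> P e) \<inter> edge_comp \<Gamma> W e = {}" using disj by simp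
  ultimately show False
    using con o unfolding connectedin by metis
qed

text \<open>Points of open edges lie in the component of their edge, vertices in that of an incident
  edge, which exists because no vertex is isolated.\<close>

lemma components_cut_space:
  assumes fin: "finite_graph \<Gamma>" and iso: "\<And>v. v \<in> verts \<Gamma> \<Longrightarrow> half_edges_at \<Gamma> v \<noteq> {}"
  shows "connected_components_of (cut_space \<Gamma> W) = edge_comp \<Gamma> W ` edges \<Gamma>"
proof
  have *: "p \<in> connected_component_of_set (cut_space \<Gamma> W) q \<Longrightarrow>
      connected_component_of_set (cut_space \<Gamma> W) p = connected_component_of_set (cut_space \<Gamma> W) q" for p q
    by (metis connected_component_of_equiv mem_Collect_eq)
  show "connected_components_of (cut_space \<Gamma> W) \<subseteq> edge_comp \<Gamma> W ` edges \<Gamma>"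
  proof
    fix C assume "C \<in> connected_components_of (cut_space \<Gamma> W)"
    then obtain p where p: "p \<in> points \<Gamma> - Vtx ` W" and C: "C = connected_component_of_set (cut_space \<Gamma> W) p"
      unfolding connected_components_of_def using fin by auto
    have "\<exists>e\<in>edges \<Gamma>. p \<in> edge_comp \<Gamma> W e"
    proof (cases p)
      case (Vtx v)
      then obtain h where h: "h \<in> half_edges_at \<Gamma> v" "v \<notin> W"
        using p iso by (fastforce simp: points_def)
      then show ?thesis
        using vertex_in_edge_comp[OF fin, of h W] Vtx unfolding half_edges_at_def by auto
    next
      case (Pt e t)
      then have "e \<in> edges \<Gamma>" "0 < t" "t < 1" using p by (auto simp: points_def)
      then show ?thesis
        using char_map_in_edge_comp[OF fin, of e t W] Pt by (auto simp: char_map_def)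
    qed
    then show "C \<in> edge_comp \<Gamma> W ` edges \<Gamma>"
      unfolding C edge_comp_def using * by blast
  qed
  show "edge_comp \<Gamma> W ` edges \<Gamma> \<subseteq> connected_components_of (cut_space \<Gamma> W)"
    unfolding connected_components_of_def edge_comp_def using fin
    by (auto simp: points_def intro!: imageI exI[of _ "1/2"])
qed

text \<open>
  The last conjunct makes \<open>\<nu>\<close> the finest function constant across the vertices outside \<open>W\<close>.
\<close>

definition component_numbering :: "('v, 'e) cw_graph \<Rightarrow> 'v set \<Rightarrow> ('e \<Rightarrow> nat) \<Rightarrow> bool" where
  "component_numbering \<Gamma> W \<nu> \<longleftrightarrow> \<nu> ` edges \<Gamma> = {..<Delta_set \<Gamma> W} \<and> cut_compatible \<Gamma> W \<nu> \<and>
     (\<forall>P :: 'e \<Rightarrow> bool. cut_compatible \<Gamma> W P \<longrightarrow>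
       (\<forall>e \<in> edges \<Gamma>. \<forall>e' \<in> edges \<Gamma>. \<nu> e = \<nu> e' \<longrightarrow> P e = P e'))"

lemma component_numbering_exists:
  assumes fin: "finite_graph \<Gamma>" and iso: "\<And>v. v \<in> verts \<Gamma> \<Longrightarrow> half_edges_at \<Gamma> v \<noteq> {}"
  shows "\<exists>\<nu>. component_numbering \<Gamma> W \<nu>"
proof -
  have "finite (edge_comp \<Gamma> W ` edges \<Gamma>)"
    using fin unfolding finite_graph_def by auto
  moreover have "card (edge_comp \<Gamma> W ` edges \<Gamma>) = Delta_set \<Gamma> W"
    using components_cut_space[OF fin iso] unfolding Delta_set_def cut_space_def by simp
  ultimately obtain \<beta> where \<beta>: "bij_betw \<beta> (edge_comp \<Gamma> W ` edges \<Gamma>) {0..<Delta_set \<Gamma> W}"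
    using ex_bij_betw_finite_nat by metis
  have inj: "\<beta> (edge_comp \<Gamma> W e) = \<beta> (edge_comp \<Gamma> W e') \<longleftrightarrow> edge_comp \<Gamma> W e = edge_comp \<Gamma> W e'"
    if "e \<in> edges \<Gamma>" "e' \<in> edges \<Gamma>" for e e'
    using \<beta> that unfolding bij_betw_def by (metis image_eqI inj_on_eq_iff)
  have "component_numbering \<Gamma> W (\<beta> \<circ> edge_comp \<Gamma> W)"
    unfolding component_numbering_def
  proof (intro conjI allI impI ballI)
    show "(\<beta> \<circ> edge_comp \<Gamma> W) ` edges \<Gamma> = {..<Delta_set \<Gamma> W}"
      using \<beta> unfolding bij_betw_def by (auto simp: image_comp)
    show "cut_compatible \<Gamma> W (\<beta> \<circ> edge_comp \<Gamma> W)"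
      using cut_compatible_edge_comp[OF fin, of W] unfolding cut_compatible_def comp_def by metis
    fix P :: "'b \<Rightarrow> bool" and e e' assume P: "cut_compatible \<Gamma> W P" and e: "e \<in> edges \<Gamma>" "e' \<in> edges \<Gamma>"
      and eq: "(\<beta> \<circ> edge_comp \<Gamma> W) e = (\<beta> \<circ> edge_comp \<Gamma> W) e'"
    have "edge_comp \<Gamma> W e = edge_comp \<Gamma> W e'" using eq inj[OF e] by simp
    then show "P e = P e'"
      using edge_comp_universal[OF fin iso P e] edge_comp_universal[OF fin iso P e(2,1)] by blast
  qed
  then show ?thesis by blast
qed

text \<open>The Boolean property in \<open>component_numbering\<close>, applied to the test
  \<open>f x = f e\<close>, extends to functions with arbitrary values.\<close>

lemma component_numbering_factor:
  assumes \<nu>: "component_numbering \<Gamma> W \<nu>" and f: "cut_compatible \<Gamma> W f"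
    and e: "e \<in> edges \<Gamma>" "e' \<in> edges \<Gamma>" "\<nu> e = \<nu> e'"
  shows "f e = f e'"
proof -
  have P: "cut_compatible \<Gamma> W (\<lambda>x. f x = f e)"
    unfolding cut_compatible_def
  proof (intro ballI impI)
    fix h h' assume "h \<in> edges \<Gamma> \<times> UNIV" "h' \<in> edges \<Gamma> \<times> UNIV"
      "att \<Gamma> h = att \<Gamma> h'" "att \<Gamma> h \<notin> W"
    then have "f (fst h) = f (fst h')" by (rule cut_compatibleD[OF f])
    then show "(f (fst h) = f e) = (f (fst h') = f e)" by simp
  qed
  have "\<forall>P :: 'b \<Rightarrow> bool. cut_compatible \<Gamma> W P \<longrightarrow>
       (\<forall>e \<in> edges \<Gamma>. \<forall>e' \<in> edges \<Gamma>. \<nu> e = \<nu> e' \<longrightarrow> P e = P e')"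
    using \<nu> unfolding component_numbering_def by simp
  from this[rule_format, OF P e] show ?thesis by simp
qed

text \<open>A function that factors through the numbering takes at most as many values as there are
  components. Read backwards, a compatible colouring with many values bounds
  \<open>Delta_set\<close> from below.\<close>

lemma card_colours_le:
  assumes fin: "finite_graph \<Gamma>" and iso: "\<And>v. v \<in> verts \<Gamma> \<Longrightarrow> half_edges_at \<Gamma> v \<noteq> {}"
    and f: "cut_compatible \<Gamma> W f"
  shows "card (f ` edges \<Gamma>) \<le> Delta_set \<Gamma> W"
proof -
  obtain \<nu> where \<nu>: "component_numbering \<Gamma> W \<nu>"
    using component_numbering_exists[OF fin iso] by blast
  have fE: "finite (edges \<Gamma>)" using fin unfolding finite_graph_def by auto
  have "f ` edges \<Gamma> \<subseteq> (\<lambda>j. f (SOME e. e \<in> edges \<Gamma> \<and> \<nu> e = j)) ` (\<nu> ` edges \<Gamma>)"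
  proof
    fix y assume "y \<in> f ` edges \<Gamma>"
    then obtain e where e: "e \<in> edges \<Gamma>" "y = f e" by auto
    define e' where "e' = (SOME x. x \<in> edges \<Gamma> \<and> \<nu> x = \<nu> e)"
    have "e' \<in> edges \<Gamma> \<and> \<nu> e' = \<nu> e"
      unfolding e'_def by (rule someI[of _ e]) (simp add: e)
    then have e': "e' \<in> edges \<Gamma>" "\<nu> e = \<nu> e'" by simp_all
    have "f e' = y" using component_numbering_factor[OF \<nu> f e(1) e'] e(2) by simp
    then show "y \<in> (\<lambda>j. f (SOME e. e \<in> edges \<Gamma> \<and> \<nu> e = j)) ` (\<nu> ` edges \<Gamma>)"
      using e(1) unfolding e'_def by (intro image_eqI[of _ _ "\<nu> e"]) auto
  qed
  then have "card (f ` edges \<Gamma>) \<le> card (\<nu> ` edges \<Gamma>)"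
    by (meson card_image_le card_mono fE finite_imageI le_trans)
  then show ?thesis using \<nu> unfolding component_numbering_def by simp
qed

section \<open>Maximal sets meet two components at each of their vertices\<close>

lemma connected_cut_compatible_const:
  assumes fin: "finite_graph \<Gamma>" and con: "connected_graph \<Gamma>" and iso: "\<And>v. v \<in> verts \<Gamma> \<Longrightarrow> half_edges_at \<Gamma> v \<noteq> {}"
    and P: "cut_compatible \<Gamma> {} P" and e: "e \<in> edges \<Gamma>" "e' \<in> edges \<Gamma>"
  shows "P e = (P e' :: bool)"
proof -
  have "cut_space \<Gamma> {} = space_of \<Gamma>"
    unfolding cut_space_def using subtopology_topspace[of "space_of \<Gamma>"] fin by simp
  then have "edge_comp \<Gamma> {} x = points \<Gamma>" if "x \<in> edges \<Gamma>" for x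
    using edge_comp_nonempty[OF fin that, of "{}"] con fin
    unfolding edge_comp_def connected_graph_def
    by (metis connected_component_of_eq_empty connected_component_of_eq connected_space_imp_connected_component_of
        connected_component_of_subset_topspace mem_Collect_eq subset_antisym subset_iff topspace_space_of)
  then show ?thesis
    using edge_comp_universal[OF fin iso P] e by metis
qed

text \<open>
  The set is an arc through nonessential vertices: adding the other edge at a nonessential end
  keeps the number of free ends at most \<open>2\<close>, so a set of maximal size has only essential ends.
\<close>

lemma thin_edge_set_exists:
  assumes fin: "finite_graph \<Gamma>" and e0: "e0 \<in> edges \<Gamma>"
  shows "\<exists>B. e0 \<in> B \<and> B \<subseteq> edges \<Gamma> \<and>
     card {h \<in> B \<times> UNIV. att \<Gamma> h \<in> essential \<Gamma>} \<le> 2 \<and>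
     cut_compatible \<Gamma> (essential \<Gamma>) (\<lambda>e. e \<in> B)"
proof -
  \<comment> \<open>Free ends are those at essential vertices together with those at which
    \<open>B\<close> could still be continued; a maximal \<open>B\<close> leaves none of the second
    kind at nonessential vertices.\<close>
  define free where "free B = {h \<in> B \<times> UNIV. att \<Gamma> h \<in> essential \<Gamma> \<or>
     (\<exists>h' \<in> edges \<Gamma> \<times> UNIV. att \<Gamma> h' = att \<Gamma> h \<and> fst h' \<notin> B)}" for B
  define Q where "Q B \<longleftrightarrow> e0 \<in> B \<and> B \<subseteq> edges \<Gamma> \<and> card (free B) \<le> 2" for B
  note finE = finite_edges[OF fin]
  have "card (free {e0}) \<le> card ({e0} \<times> (UNIV :: bool set))"
    unfolding free_def by (rule card_mono) auto
  then have Q0: "Q {e0}" unfolding Q_def using e0 by (simp add: card_cartesian_product)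
  have "\<exists>B. Q B \<and> (\<forall>B'. Q B' \<longrightarrow> card B' \<le> card B)"
  proof (rule ex_has_greatest_nat)
    show "Q {e0}" by (rule Q0)
    show "\<forall>B. Q B \<longrightarrow> card B < Suc (card (edges \<Gamma>))"
      using finE unfolding Q_def by (simp add: card_mono less_Suc_eq_le)
  qed
  then obtain B where B: "Q B" and max: "\<And>B'. Q B' \<Longrightarrow> card B' \<le> card B" by blast
  have finB: "finite B" using B finE unfolding Q_def by (meson finite_subset)
  have finfree: "finite (free C)" if "finite C" for C
    unfolding free_def using that by (auto intro: finite_subset[of _ "C \<times> UNIV"])
  have ess: "att \<Gamma> h \<in> essential \<Gamma>" if h: "h \<in> free B" for h
  proof (rule ccontr)
    assume ne: "att \<Gamma> h \<notin> essential \<Gamma>"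
    then obtain h' where h': "h' \<in> edges \<Gamma> \<times> UNIV" "att \<Gamma> h' = att \<Gamma> h" "fst h' \<notin> B"
      using h unfolding free_def by auto
    have hB: "h \<in> B \<times> UNIV" "h \<in> edges \<Gamma> \<times> UNIV" using h B unfolding free_def Q_def by auto
    define v where "v = att \<Gamma> h"
    have vV: "v \<in> verts \<Gamma>" using hB fin unfolding v_def finite_graph_def by auto
    then have "card (half_edges_at \<Gamma> v) \<le> 2"
      using ne unfolding essential_def valence_def v_def by auto
    moreover have "{h, h'} \<subseteq> half_edges_at \<Gamma> v"
      using hB h' unfolding half_edges_at_def v_def by auto
    moreover have "h \<noteq> h'" using hB h' by auto
    moreover have "finite (half_edges_at \<Gamma> v)"
      unfolding half_edges_at_def using finE by auto
    ultimately have Hv: "half_edges_at \<Gamma> v = {h, h'}"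
      by (metis card_2_iff card_seteq)
    define B' where "B' = insert (fst h') B"
    have nf: "g \<notin> free B'" if "g = h \<or> g = h'" for g
    proof
      assume "g \<in> free B'"
      moreover have "att \<Gamma> g = v" using that h' unfolding v_def by auto
      ultimately obtain g' where g': "g' \<in> edges \<Gamma> \<times> UNIV" "att \<Gamma> g' = v" "fst g' \<notin> B'"
        using ne unfolding free_def v_def by auto
      then have "g' \<in> half_edges_at \<Gamma> v" unfolding half_edges_at_def by auto
      then have "g' = h \<or> g' = h'" using Hv by auto
      then show False using g' hB unfolding B'_def by auto
    qed
    \<comment> \<open>Both half-edges at the joining vertex cease to be free, and the only possible
      new free end is the opposite end of the added edge.\<close>
    have "free B' \<subseteq> insert (fst h', \<not> snd h') (free B - {h})"
    proof
      fix g assume g: "g \<in> free B'"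
      then have "g \<noteq> h" "g \<noteq> h'" using nf by blast+
      show "g \<in> insert (fst h', \<not> snd h') (free B - {h})"
      proof (cases "fst g = fst h'")
        case True
        then have "g = (fst h', \<not> snd h')" using \<open>g \<noteq> h'\<close> by (cases g; cases h') auto
        then show ?thesis by simp
      next
        case False
        then have "g \<in> free B" using g unfolding free_def B'_def by auto
        then show ?thesis using \<open>g \<noteq> h\<close> by simp
      qed
    qed
    then have "card (free B') \<le> card (insert (fst h', \<not> snd h') (free B - {h}))"
      using finfree[OF finB] by (intro card_mono) auto
    also have "\<dots> \<le> Suc (card (free B - {h}))" by (simp add: card_insert_if finfree finB)
    also have "\<dots> = card (free B)" using finfree[OF finB] h by (rule card_Suc_Diff1)
    finally have "Q B'" using B h' unfolding Q_def B'_def by auto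
    then have "card B' \<le> card B" by (rule max)
    then show False using h' finB unfolding B'_def by simp
  qed
  have "{h \<in> B \<times> UNIV. att \<Gamma> h \<in> essential \<Gamma>} \<subseteq> free B" unfolding free_def by auto
  then have ends: "card {h \<in> B \<times> UNIV. att \<Gamma> h \<in> essential \<Gamma>} \<le> 2"
    using B card_mono[OF finfree[OF finB]] unfolding Q_def by (meson le_trans)
  have "fst h' \<in> B" if "h \<in> edges \<Gamma> \<times> UNIV" "h' \<in> edges \<Gamma> \<times> UNIV" "att \<Gamma> h = att \<Gamma> h'"
    "att \<Gamma> h \<notin> essential \<Gamma>" "fst h \<in> B" for h h'
  proof (rule ccontr)
    assume "fst h' \<notin> B"
    then have "h \<in> free B" using that unfolding free_def by (cases h) auto
    then show False using ess that by blast
  qed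
  note closed = this
  have "cut_compatible \<Gamma> (essential \<Gamma>) (\<lambda>e. e \<in> B)"
    unfolding cut_compatible_def
  proof (intro ballI impI iffI)
    fix h h' assume h: "h \<in> edges \<Gamma> \<times> UNIV" "h' \<in> edges \<Gamma> \<times> UNIV"
      "att \<Gamma> h = att \<Gamma> h'" "att \<Gamma> h \<notin> essential \<Gamma>"
    show "fst h' \<in> B" if "fst h \<in> B" using closed[OF h that] .
    show "fst h \<in> B" if "fst h' \<in> B" using closed[OF h(2,1) h(3)[symmetric] _ that] h by simp
  qed
  then show ?thesis using B ends unfolding Q_def by blast
qed

lemma finite_essential_sets: "finite_graph \<Gamma> \<Longrightarrow> finite (essential_sets \<Gamma> i)"
  unfolding finite_graph_def essential_sets_def essential_def
  by (rule finite_subset[of _ "Pow (verts \<Gamma>)"]) auto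

lemma Delta_set_le_Delta:
  assumes "finite_graph \<Gamma>" "W \<in> essential_sets \<Gamma> i"
  shows "Delta_set \<Gamma> W \<le> Delta \<Gamma> i"
  unfolding Delta_def using finite_essential_sets[OF assms(1), of i] assms(2) by (intro Max_ge) auto

text \<open>
  Otherwise an arc \<open>B\<close> from \<open>W - {w}\<close> into the only component at \<open>w\<close> ends at an essential vertex
  \<open>x \<notin> W\<close>, and it becomes a component of its own when \<open>w\<close> is replaced by \<open>x\<close>.
\<close>

lemma maximal_set_meets_two_components:
  fixes \<Gamma> :: "('v, 'e) cw_graph"
  assumes fin: "finite_graph \<Gamma>" and con: "connected_graph \<Gamma>"
    and iso: "\<And>v. v \<in> verts \<Gamma> \<Longrightarrow> half_edges_at \<Gamma> v \<noteq> {}"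
    and W: "W \<in> essential_sets \<Gamma> i" and max: "Delta_set \<Gamma> W = Delta \<Gamma> i" and gt: "Delta \<Gamma> i > 1"
    and \<nu>: "component_numbering \<Gamma> W \<nu>" and w: "w \<in> W"
  shows "\<exists>h \<in> half_edges_at \<Gamma> w. \<exists>h' \<in> half_edges_at \<Gamma> w. \<nu> (fst h) \<noteq> \<nu> (fst h')"
proof (rule ccontr)
  assume "\<not> ?thesis"
  then have same: "\<And>h h'. h \<in> half_edges_at \<Gamma> w \<Longrightarrow> h' \<in> half_edges_at \<Gamma> w \<Longrightarrow> \<nu> (fst h) = \<nu> (fst h')"
    by blast
  note finE = finite_edges[OF fin]
  have W_ess: "W \<subseteq> essential \<Gamma>" and cW: "card W = i" using W unfolding essential_sets_def by auto
  note finV = finite_verts[OF fin]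
  then have finW: "finite W" using W_ess unfolding essential_def by (auto intro: finite_subset)
  have w_ess: "w \<in> verts \<Gamma>" "3 \<le> card (half_edges_at \<Gamma> w)"
    using W_ess w unfolding essential_def valence_def by auto
  then obtain hw where hw: "hw \<in> half_edges_at \<Gamma> w" using iso by blast
  define c where "c = \<nu> (fst hw)"
  have col: "\<nu> (fst h) = c" if "h \<in> edges \<Gamma> \<times> UNIV" "att \<Gamma> h = w" for h
    using same[of h hw] that hw unfolding c_def half_edges_at_def by auto
  have \<nu>c: "cut_compatible \<Gamma> W \<nu>" and \<nu>im: "\<nu> ` edges \<Gamma> = {..<Delta \<Gamma> i}"
    using \<nu> max unfolding component_numbering_def by auto
  \<comment> \<open>If the component \<open>c\<close> met \<open>W\<close> only at \<open>w\<close>,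
    its indicator would be compatible even without a cut, and connectedness would leave a single
    component, against \<open>Delta \<Gamma> i > 1\<close>.\<close>
  have "\<exists>h0 \<in> edges \<Gamma> \<times> UNIV. \<nu> (fst h0) = c \<and> att \<Gamma> h0 \<in> W - {w}"
  proof (rule ccontr)
    assume no: "\<not> ?thesis"
    have "cut_compatible \<Gamma> {} (\<lambda>e. \<nu> e = c)"
      unfolding cut_compatible_def
    proof (intro ballI impI)
      fix h h' assume hh: "h \<in> edges \<Gamma> \<times> UNIV" "h' \<in> edges \<Gamma> \<times> UNIV" "att \<Gamma> h = att \<Gamma> h'"
      consider "att \<Gamma> h = w" | "att \<Gamma> h \<in> W - {w}" | "att \<Gamma> h \<notin> W" by auto
      then show "(\<nu> (fst h) = c) = (\<nu> (fst h') = c)"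
      proof cases
        case 1 then show ?thesis using col hh by metis
      next
        case 2 then show ?thesis using no hh by metis
      next
        case 3 then show ?thesis using cut_compatibleD[OF \<nu>c hh] by metis
      qed
    qed
    then have *: "(\<nu> e = c) = (\<nu> e' = c)" if "e \<in> edges \<Gamma>" "e' \<in> edges \<Gamma>" for e e'
      using connected_cut_compatible_const[OF fin con iso] that by blast
    have "fst hw \<in> edges \<Gamma>" using hw unfolding half_edges_at_def by auto
    then have "\<nu> ` edges \<Gamma> \<subseteq> {c}" using * unfolding c_def by blast
    then have "card (\<nu> ` edges \<Gamma>) \<le> card {c}" by (intro card_mono) auto
    then show False using gt \<nu>im by simp
  qed
  then obtain h0 where h0: "h0 \<in> edges \<Gamma> \<times> UNIV" "\<nu> (fst h0) = c" "att \<Gamma> h0 \<in> W" "att \<Gamma> h0 \<noteq> w" by auto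
  obtain B0 where B0: "fst h0 \<in> B0" "B0 \<subseteq> edges \<Gamma>"
    "card {h \<in> B0 \<times> UNIV. att \<Gamma> h \<in> essential \<Gamma>} \<le> 2" "cut_compatible \<Gamma> (essential \<Gamma>) (\<lambda>e. e \<in> B0)"
    using thin_edge_set_exists[OF fin, of "fst h0"] h0 by auto
  define B where "B = {e \<in> B0. \<nu> e = c}"
  define ends where "ends = {h \<in> B \<times> UNIV. att \<Gamma> h \<in> essential \<Gamma>}"
  have finB0: "finite B0" using B0 finE by (meson finite_subset)
  then have finends: "finite ends" unfolding ends_def B_def by auto
  have ends2: "card ends \<le> 2"
  proof -
    have "card ends \<le> card {h \<in> B0 \<times> UNIV. att \<Gamma> h \<in> essential \<Gamma>}"
      unfolding ends_def B_def using finB0 by (intro card_mono) auto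
    then show ?thesis using B0 by simp
  qed
  have h0_ends: "h0 \<in> ends"
    using h0 B0 W_ess unfolding ends_def B_def by (cases h0) auto
  have Bcl: "att \<Gamma> h \<in> essential \<Gamma>"
    if "h \<in> edges \<Gamma> \<times> UNIV" "h' \<in> edges \<Gamma> \<times> UNIV" "att \<Gamma> h = att \<Gamma> h'"
      "\<nu> (fst h) = \<nu> (fst h')" "fst h \<in> B" "fst h' \<notin> B" for h h'
    using cut_compatibleD[OF B0(4) that(1-3)] that unfolding B_def by auto
  \<comment> \<open>If \<open>B\<close> filled the component \<open>c\<close>, its ends would
    include \<open>h0\<close> and the at least three half-edges at \<open>w\<close>, but there are
    at most two ends.\<close>
  have "\<exists>e \<in> edges \<Gamma>. \<nu> e = c \<and> e \<notin> B"
  proof (rule ccontr)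
    assume "\<not> ?thesis"
    then have "insert h0 (half_edges_at \<Gamma> w) \<subseteq> ends"
      using h0_ends W_ess w col unfolding ends_def half_edges_at_def by auto
    then have "card (insert h0 (half_edges_at \<Gamma> w)) \<le> card ends"
      using finends by (rule card_mono[rotated])
    moreover have "h0 \<notin> half_edges_at \<Gamma> w" using h0 unfolding half_edges_at_def by auto
    moreover have "finite (half_edges_at \<Gamma> w)" unfolding half_edges_at_def using finE by auto
    ultimately show False using w_ess ends2 by simp
  qed
  then obtain e1 where e1: "e1 \<in> edges \<Gamma>" "\<nu> e1 = c" "e1 \<notin> B" by blast
  \<comment> \<open>\<open>B\<close> receives a colour outside the range of \<open>\<nu>\<close>.
    The incompatibility of \<open>f\<close> with \<open>W\<close> produces a vertex \<open>x\<close>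
    at which \<open>B\<close> meets the rest of the component, and cutting there instead of at
    \<open>w\<close> makes \<open>f\<close> compatible.\<close>
  define f where "f e = (if e \<in> B then Delta \<Gamma> i else \<nu> e)" for e
  have \<nu>lt: "\<nu> e < Delta \<Gamma> i" if "e \<in> edges \<Gamma>" for e
    using \<nu>im that by auto
  have "\<not> cut_compatible \<Gamma> W f"
  proof
    assume "cut_compatible \<Gamma> W f"
    then have "f (fst h0) = f e1"
      using component_numbering_factor[OF \<nu>, of f "fst h0" e1] h0 e1 by auto
    moreover have "f (fst h0) = Delta \<Gamma> i" using h0_ends unfolding f_def ends_def by auto
    moreover have "f e1 = c" using e1 unfolding f_def by auto
    ultimately show False using \<nu>lt[OF e1(1)] e1(2) by simp
  qed
  then obtain g g' where g: "g \<in> edges \<Gamma> \<times> UNIV" "g' \<in> edges \<Gamma> \<times> UNIV" "att \<Gamma> g = att \<Gamma> g'"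
    "att \<Gamma> g \<notin> W" "f (fst g) \<noteq> f (fst g')"
    unfolding cut_compatible_def by blast
  then have \<nu>g: "\<nu> (fst g) = \<nu> (fst g')" using cut_compatibleD[OF \<nu>c] by blast
  have "\<exists>h h'. h \<in> edges \<Gamma> \<times> UNIV \<and> h' \<in> edges \<Gamma> \<times> UNIV \<and> att \<Gamma> h = att \<Gamma> h' \<and>
    att \<Gamma> h \<notin> W \<and> \<nu> (fst h) = \<nu> (fst h') \<and> fst h \<in> B \<and> fst h' \<notin> B"
  proof (cases "fst g \<in> B")
    case True
    then have "fst g' \<notin> B" using g \<nu>g unfolding f_def by auto
    then show ?thesis using True g \<nu>g by blast
  next
    case False
    then have "fst g' \<in> B" using g \<nu>g unfolding f_def by (auto split: if_splits)
    then show ?thesis using False g \<nu>g by metis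
  qed
  then obtain h h' where h: "h \<in> edges \<Gamma> \<times> UNIV" "h' \<in> edges \<Gamma> \<times> UNIV" "att \<Gamma> h = att \<Gamma> h'"
    "att \<Gamma> h \<notin> W" "\<nu> (fst h) = \<nu> (fst h')" "fst h \<in> B" "fst h' \<notin> B"
    by blast
  define x where "x = att \<Gamma> h"
  have x_ess: "x \<in> essential \<Gamma>" using Bcl h unfolding x_def by blast
  have h_ends: "h \<in> ends" using h x_ess unfolding ends_def x_def by (cases h) auto
  have "h \<noteq> h0" using h h0 by auto
  \<comment> \<open>The ends \<open>h\<close> at \<open>x\<close> and \<open>h0\<close> at
    \<open>W - {w}\<close> exhaust the two that are allowed, so \<open>B\<close> touches no other
    essential vertex at a further half-edge; in particular it does not touch
    \<open>w\<close>.\<close>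
  have ends: "g = h \<or> g = h0" if "g \<in> ends" for g
  proof (rule ccontr)
    assume "\<not> ?thesis"
    then have "card {g, h, h0} = 3" using \<open>h \<noteq> h0\<close> by auto
    moreover have "card {g, h, h0} \<le> card ends"
      using that h_ends h0_ends finends by (intro card_mono) auto
    ultimately show False using ends2 by simp
  qed
  define W' where "W' = insert x (W - {w})"
  have xW: "x \<notin> W" using h unfolding x_def by auto
  have "card W' = i" unfolding W'_def using finW w cW xW
    by (metis DiffD1 card.insert card.remove finite_Diff)
  then have W': "W' \<in> essential_sets \<Gamma> i"
    using W_ess x_ess unfolding W'_def essential_sets_def by auto
  have "cut_compatible \<Gamma> W' f"
    unfolding cut_compatible_def
  proof (intro ballI impI)
    fix g g' assume g: "g \<in> edges \<Gamma> \<times> UNIV" "g' \<in> edges \<Gamma> \<times> UNIV"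
      "att \<Gamma> g = att \<Gamma> g'" "att \<Gamma> g \<notin> W'"
    have nB: "fst k \<notin> B" if "k \<in> edges \<Gamma> \<times> UNIV" "att \<Gamma> k = att \<Gamma> g" "att \<Gamma> g \<in> essential \<Gamma>" for k
    proof
      assume "fst k \<in> B"
      then have "k \<in> ends" using that unfolding ends_def by (cases k) auto
      then have "k = h \<or> k = h0" by (rule ends)
      then show False using that g h0 unfolding W'_def x_def by auto
    qed
    show "f (fst g) = f (fst g')"
    proof (cases "att \<Gamma> g = w")
      case True
      then have "fst g \<notin> B" "fst g' \<notin> B" using nB g W_ess w by auto
      then show ?thesis using col g True unfolding f_def by auto
    next
      case False
      then have "att \<Gamma> g \<notin> W" using g unfolding W'_def by auto
      then have eq: "\<nu> (fst g) = \<nu> (fst g')" using cut_compatibleD[OF \<nu>c] g by blast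
      have "fst g \<in> B \<longleftrightarrow> fst g' \<in> B"
      proof (cases "att \<Gamma> g \<in> essential \<Gamma>")
        case True
        then show ?thesis using nB[OF g(1) refl] nB[OF g(2) g(3)[symmetric]] by simp
      next
        case False
        then show ?thesis
          using Bcl[OF g(1-3) eq] Bcl[OF g(2,1) g(3)[symmetric] eq[symmetric]] g(3) by metis
      qed
      then show ?thesis using eq unfolding f_def by auto
    qed
  qed
  then have "card (f ` edges \<Gamma>) \<le> Delta_set \<Gamma> W'" using card_colours_le[OF fin iso] by blast
  also have "\<dots> \<le> Delta \<Gamma> i" by (rule Delta_set_le_Delta[OF fin W'])
  finally have "card (f ` edges \<Gamma>) \<le> Delta \<Gamma> i" .
  \<comment> \<open>The new colour comes from \<open>B\<close>, colour \<open>c\<close> survives at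
    \<open>e1\<close>, and the other components are untouched, which is one colour too many.\<close>
  moreover have "{..<Suc (Delta \<Gamma> i)} \<subseteq> f ` edges \<Gamma>"
  proof
    fix j assume j: "j \<in> {..<Suc (Delta \<Gamma> i)}"
    consider "j = Delta \<Gamma> i" | "j = c" "j < Delta \<Gamma> i" | "j < Delta \<Gamma> i" "j \<noteq> c" using j by force
    then show "j \<in> f ` edges \<Gamma>"
    proof cases
      case 1 then show ?thesis
        using h by (intro image_eqI[of _ _ "fst h"]) (auto simp: f_def)
    next
      case 2 then show ?thesis
        using e1 by (intro image_eqI[of _ _ e1]) (auto simp: f_def)
    next
      case 3
      then obtain e where "e \<in> edges \<Gamma>" "\<nu> e = j" using \<nu>im by (metis imageE lessThan_iff)
      then show ?thesis using 3 by (intro image_eqI[of _ _ e]) (auto simp: f_def B_def)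
    qed
  qed
  then have "card {..<Suc (Delta \<Gamma> i)} \<le> card (f ` edges \<Gamma>)"
    using finE by (intro card_mono) auto
  ultimately show False by simp
qed

subsection \<open>Dimension of a space of homology classes\<close>

abbreviation "lookup \<equiv> Poly_Mapping.lookup"
abbreviation "keys \<equiv> Poly_Mapping.keys"
abbreviation "single \<equiv> Poly_Mapping.single"

lemma lookup_act [simp]: "lookup (act p c) s = p * lookup c s"
  unfolding act_def by transfer (auto simp: when_def)

lemma act_add: "act p (c + d) = act p c + act p d"
  by (rule poly_mapping_eqI) (simp add: lookup_add algebra_simps)

lemma act_diff: "act p (c - d) = act p c - act p d"
  by (rule poly_mapping_eqI) (simp add: lookup_minus algebra_simps)

lemma act_add_left: "act (p + q) c = act p c + act q c"
  by (rule poly_mapping_eqI) (simp add: lookup_add algebra_simps)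

lemma act_diff_left: "act (p - q) c = act p c - act q c"
  by (rule poly_mapping_eqI) (simp add: lookup_minus algebra_simps)

lemma act_act: "act p (act q c) = act (p * q) c"
  by (rule poly_mapping_eqI) (simp add: algebra_simps)

lemma act_one [simp]: "act 1 c = c"
  by (rule poly_mapping_eqI) simp

lemma act_zero_left [simp]: "act 0 c = 0"
  by (rule poly_mapping_eqI) simp

lemma act_zero [simp]: "act p 0 = 0"
  by (rule poly_mapping_eqI) simp

lemma act_single [simp]: "act p (single s q) = single s (p * q)"
  by (rule poly_mapping_eqI) (simp add: lookup_single when_def)

lemma act_sum_left: "act (sum f A) c = (\<Sum>x\<in>A. act (f x) c)"
  by (induction A rule: infinite_finite_induct) (auto simp: act_add_left)

lemma const_poly_1 [simp]: "const_poly 1 = 1"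
  by (simp add: const_poly_def)

lemma const_poly_mult: "const_poly (a * b) = const_poly a * const_poly b"
  by (simp add: const_poly_def mult_single)

lemma const_poly_add: "const_poly (a + b) = const_poly a + const_poly b"
  by (simp add: const_poly_def single_add)

text \<open>Scalars act as constant polynomials; this makes chains over a field a vector space, to
  which spans, independence and dimension apply.\<close>

definition smul :: "'f::comm_ring_1 \<Rightarrow> ('s \<Rightarrow>\<^sub>0 ('e, 'f) edge_poly) \<Rightarrow> ('s \<Rightarrow>\<^sub>0 ('e, 'f) edge_poly)" where
  "smul a c = act (const_poly a) c"

interpretation chain_vs: vector_space "smul :: 'f::field \<Rightarrow> ('s \<Rightarrow>\<^sub>0 ('e, 'f) edge_poly) \<Rightarrow> _"
  by unfold_locales (simp_all add: smul_def act_add act_add_left act_act const_poly_mult const_poly_add)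

interpretation chain_pair: vector_space_pair
  "smul :: 'f::field \<Rightarrow> ('s \<Rightarrow>\<^sub>0 ('e, 'f) edge_poly) \<Rightarrow> _"
  "smul :: 'f::field \<Rightarrow> ('s \<Rightarrow>\<^sub>0 ('e, 'f) edge_poly) \<Rightarrow> _"
  by unfold_locales

context vector_space
begin

text \<open>The map is the projection along a complement of \<open>B\<close>. Through it classes
  modulo \<open>B\<close> become ordinary vectors, and statements about cosets reduce to spans and
  independence without a quotient space.\<close>

lemma subspace_is_kernel:
  assumes B: "subspace B"
  shows "\<exists>\<pi>. Vector_Spaces.linear scale scale \<pi> \<and> (\<forall>x. \<pi> x = 0 \<longleftrightarrow> x \<in> B)"
proof -
  interpret vp: vector_space_pair scale scale by unfold_locales
  obtain b where b: "b \<subseteq> B" "independent b" "B \<subseteq> span b"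
    using basis_exists[of B] by metis
  define C where "C = extend_basis b"
  have C: "b \<subseteq> C" "independent C" "span C = UNIV"
    unfolding C_def using b extend_basis_superset independent_extend_basis span_extend_basis by auto
  obtain \<pi> where \<pi>: "Vector_Spaces.linear scale scale \<pi>" "\<And>x. x \<in> C \<Longrightarrow> \<pi> x = (if x \<in> b then 0 else x)"
    using vp.linear_independent_extend[OF C(2), of "\<lambda>x. if x \<in> b then 0 else x"] by blast
  have lid: "Vector_Spaces.linear scale scale (\<lambda>x. x)" by (rule linear_ident)
  have lz: "Vector_Spaces.linear scale scale (\<lambda>x. 0)" by (rule vp.linear_zero)
  have zero: "\<pi> x = 0" if "x \<in> span b" for x
    by (rule vp.linear_eq_on[OF \<pi>(1) lz that]) (use \<pi>(2) C in auto)
  have id: "\<pi> x = x" if "x \<in> span (C - b)" for x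
    by (rule vp.linear_eq_on[OF \<pi>(1) lid that]) (use \<pi>(2) in auto)
  have "x \<in> B" if "\<pi> x = 0" for x
  proof -
    have "x \<in> span (b \<union> (C - b))" using C by (simp add: Un_absorb1)
    then obtain u v where uv: "x = u + v" "u \<in> span b" "v \<in> span (C - b)"
      unfolding span_Un by blast
    then have "\<pi> x = v" using zero id vp.linear_add[OF \<pi>(1)] by simp
    then have "x \<in> span b" using uv that by simp
    then show ?thesis using span_minimal[OF b(1) B] by blast
  qed
  moreover have "\<pi> x = 0" if "x \<in> B" for x using zero b that by blast
  ultimately show ?thesis using \<pi>(1) by blast
qed

text \<open>Translates the unique-coordinates form of a basis, with coordinate functions normalised
  to be \<open>extensional\<close>, into independence and spanning. Uniqueness at the vector
  \<open>0\<close> is what yields independence.\<close>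

lemma unique_coordinates_iff:
  assumes fin: "finite S" and inj: "inj_on q S" and Y: "0 \<in> Y"
  shows "(\<forall>y \<in> Y. \<exists>!f. f \<in> extensional S \<and> y = (\<Sum>x\<in>S. scale (f x) (q x))) \<longleftrightarrow>
     independent (q ` S) \<and> Y \<subseteq> span (q ` S)" (is "?L \<longleftrightarrow> ?R")
proof
  assume L: ?L
  have "independent (q ` S)"
  proof (rule independent_if_scalars_zero)
    fix u x assume u: "(\<Sum>x\<in>q ` S. scale (u x) x) = 0" and x: "x \<in> q ` S"
    obtain f0 where f0: "\<forall>f. f \<in> extensional S \<and> 0 = (\<Sum>x\<in>S. scale (f x) (q x)) \<longrightarrow> f = f0"
      using bspec[OF L Y] by (rule ex1E)
    have "(\<Sum>x\<in>S. scale (restrict (u \<circ> q) S x) (q x)) = 0"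
      using u by (simp add: sum.reindex[OF inj])
    then have "restrict (u \<circ> q) S = f0"
      by (intro f0[rule_format]) simp
    moreover have "restrict (\<lambda>x. 0) S = f0"
      by (intro f0[rule_format]) simp
    ultimately have "restrict (u \<circ> q) S = restrict (\<lambda>x. 0) S" by simp
    then show "u x = 0" using x by (metis comp_apply imageE restrict_apply')
  qed (use fin in auto)
  moreover have "Y \<subseteq> span (q ` S)"
  proof
    fix y assume "y \<in> Y"
    from ex1_implies_ex[OF bspec[OF L this]] obtain f where y: "y = (\<Sum>x\<in>S. scale (f x) (q x))"
      by blast
    show "y \<in> span (q ` S)" unfolding y by (intro span_sum span_scale span_base imageI)
  qed
  ultimately show ?R by blast
next
  assume R: ?R
  show ?L
  proof
    fix y assume "y \<in> Y"
    then obtain u where u: "y = (\<Sum>x\<in>q ` S. scale (u x) x)"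
      using R fin by (auto simp: span_finite)
    show "\<exists>!f. f \<in> extensional S \<and> y = (\<Sum>x\<in>S. scale (f x) (q x))"
    proof (rule ex1I[of _ "restrict (u \<circ> q) S"])
      show "restrict (u \<circ> q) S \<in> extensional S \<and> y = (\<Sum>x\<in>S. scale (restrict (u \<circ> q) S x) (q x))"
        using u by (simp add: sum.reindex[OF inj])
      fix f assume f: "f \<in> extensional S \<and> y = (\<Sum>x\<in>S. scale (f x) (q x))"
      show "f = restrict (u \<circ> q) S"
      proof
        fix x
        show "f x = restrict (u \<circ> q) S x"
        proof (cases "x \<in> S")
          case True
          define d where "d z = f (inv_into S q z) - u z" for z
          have "(\<Sum>z\<in>q ` S. scale (d z) z) = (\<Sum>x\<in>S. scale (f x - u (q x)) (q x))"
            unfolding d_def by (simp add: sum.reindex[OF inj] inj)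
          also have "\<dots> = y - y"
            unfolding scale_left_diff_distrib sum_subtractf
            using f u by (simp add: sum.reindex[OF inj])
          finally have "d (q x) = 0"
            using independentD[of "q ` S" "q ` S" d "q x"] R fin True by auto
          then show ?thesis unfolding d_def using True inj by simp
        qed (use f in \<open>auto simp: extensional_def\<close>)
      qed
    qed
  qed
qed

end

text \<open>A linear map \<open>\<pi>\<close> with the boundaries as kernel identifies the classes
  of elements of \<open>V\<close> with the image of \<open>V\<close>, so \<open>class_dim\<close> is
  the dimension of that image. A set spanning \<open>V\<close> modulo boundaries bounds it from
  above, a family independent modulo boundaries from below.\<close>

lemma class_dim_bounds:
  fixes V :: "('v::linorder, 'e, 'f::field) chain set"
  assumes B: "chain_vs.subspace (boundaries \<Gamma> i :: ('v, 'e, 'f) chain set)"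
    and V: "chain_vs.subspace V"
    and A: "finite A" "V \<subseteq> chain_vs.span (A \<union> boundaries \<Gamma> i)"
    and I: "finite I" "g ` I \<subseteq> V"
    and ind: "\<And>c. (\<Sum>x\<in>I. smul (c x) (g x)) \<in> boundaries \<Gamma> i \<Longrightarrow> \<forall>x\<in>I. c x = 0"
  shows "card I \<le> class_dim \<Gamma> i (hclass \<Gamma> i ` V)" "class_dim \<Gamma> i (hclass \<Gamma> i ` V) \<le> card A"
proof -
  define B where "B = (boundaries \<Gamma> i :: ('v, 'e, 'f) chain set)"
  define T where "T = hclass \<Gamma> i ` V"
  note B = B[folded B_def] and ind = ind[folded B_def] and A = A[folded B_def]
  obtain \<pi> :: "('v, 'e, 'f) chain \<Rightarrow> ('v, 'e, 'f) chain"
    where \<pi>: "Vector_Spaces.linear smul smul \<pi>" and ker: "\<And>x. \<pi> x = 0 \<longleftrightarrow> x \<in> B"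
    using chain_vs.subspace_is_kernel[OF B] by blast
  note \<pi>_simps = chain_pair.linear_add[OF \<pi>] chain_pair.linear_diff[OF \<pi>] chain_pair.linear_sum[OF \<pi>]
    chain_pair.linear_scale[OF \<pi>] chain_pair.linear_0[OF \<pi>]
  have hc: "X \<in> hclass \<Gamma> i z \<longleftrightarrow> \<pi> X = \<pi> z" for X z
  proof -
    have "X \<in> hclass \<Gamma> i z \<longleftrightarrow> X - z \<in> B"
      unfolding hclass_def B_def by (auto intro!: exI[of _ "X - z"])
    then show ?thesis using ker[of "X - z"] by (simp add: \<pi>_simps)
  qed
  have hc_eq: "hclass \<Gamma> i z = hclass \<Gamma> i z' \<longleftrightarrow> \<pi> z = \<pi> z'" for z z'
    using hc by (metis set_eqI)
  define rep where "rep X = (SOME z. z \<in> V \<and> hclass \<Gamma> i z = X)" for X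
  have rep: "rep X \<in> V" "hclass \<Gamma> i (rep X) = X" if "X \<in> T" for X
  proof -
    have "\<exists>z. z \<in> V \<and> hclass \<Gamma> i z = X" using that unfolding T_def by auto
    then show "rep X \<in> V" "hclass \<Gamma> i (rep X) = X" unfolding rep_def by (metis (mono_tags, lifting) someI_ex)+
  qed
  define q where "q X = \<pi> (rep X)" for X
  have q: "q (hclass \<Gamma> i z) = \<pi> z" if "z \<in> V" for z
    unfolding q_def using rep[of "hclass \<Gamma> i z"] that hc_eq unfolding T_def by auto
  have inj: "inj_on q T"
    unfolding q_def by (rule inj_onI) (metis rep(2) hc_eq)
  have lincomb: "class_lincomb \<Gamma> i f S = hclass \<Gamma> i (\<Sum>X\<in>S. smul (f X) (rep X))"
    if "finite S" "S \<subseteq> T" for f S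
  proof (intro set_eqI iffI)
    fix z assume "z \<in> class_lincomb \<Gamma> i f S"
    then obtain r b where rb: "z = (\<Sum>X\<in>S. smul (f X) (r X)) + b" "\<forall>X\<in>S. r X \<in> X" "b \<in> B"
      unfolding class_lincomb_def B_def smul_def by blast
    have "\<pi> (r X) = \<pi> (rep X)" if "X \<in> S" for X
      using rb(2) that rep(2)[of X] hc[of "r X" "rep X"] \<open>S \<subseteq> T\<close> by auto
    then show "z \<in> hclass \<Gamma> i (\<Sum>X\<in>S. smul (f X) (rep X))"
      using rb ker[of b] by (simp add: hc \<pi>_simps)
  next
    fix z assume "z \<in> hclass \<Gamma> i (\<Sum>X\<in>S. smul (f X) (rep X))"
    then obtain b where "z = (\<Sum>X\<in>S. smul (f X) (rep X)) + b" "b \<in> B"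
      unfolding hclass_def B_def by auto
    moreover have "\<forall>X\<in>S. rep X \<in> X" using rep(2) hc that by (metis subsetD)
    ultimately show "z \<in> class_lincomb \<Gamma> i f S"
      unfolding class_lincomb_def B_def smul_def by blast
  qed
  have basis_iff: "class_basis \<Gamma> i T S \<longleftrightarrow>
      chain_vs.independent (q ` S) \<and> \<pi> ` V \<subseteq> chain_vs.span (q ` S)"
    if S: "finite S" "S \<subseteq> T" for S
  proof -
    have "(hclass \<Gamma> i z = class_lincomb \<Gamma> i f S) \<longleftrightarrow> \<pi> z = (\<Sum>X\<in>S. smul (f X) (q X))" for z f
      unfolding lincomb[OF S] hc_eq by (simp add: \<pi>_simps q_def)
    then have "class_basis \<Gamma> i T S \<longleftrightarrow>
       (\<forall>y\<in>\<pi> ` V. \<exists>!f. f \<in> extensional S \<and> y = (\<Sum>X\<in>S. smul (f X) (q X)))"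
      unfolding class_basis_def T_def using S by (simp add: T_def)
    also have "\<dots> \<longleftrightarrow> chain_vs.independent (q ` S) \<and> \<pi> ` V \<subseteq> chain_vs.span (q ` S)"
    proof (rule chain_vs.unique_coordinates_iff[OF S(1)])
      show "inj_on q S" using inj S(2) by (rule inj_on_subset)
      show "0 \<in> \<pi> ` V" using chain_vs.subspace_0[OF V] \<pi>_simps(5) by (metis imageI)
    qed
    finally show ?thesis .
  qed
  have span_A: "\<pi> ` V \<subseteq> chain_vs.span (\<pi> ` A)"
  proof -
    have "\<pi> ` V \<subseteq> \<pi> ` chain_vs.span (A \<union> B)" using A(2) by blast
    also have "\<dots> = chain_vs.span (\<pi> ` (A \<union> B))"
      by (rule chain_pair.linear_span_image[OF \<pi>, symmetric])
    also have "\<dots> \<subseteq> chain_vs.span (insert 0 (\<pi> ` A))"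
      by (rule chain_vs.span_mono) (use ker in auto)
    finally show ?thesis by simp
  qed
  obtain b where b: "b \<subseteq> \<pi> ` V" "chain_vs.independent b" "\<pi> ` V \<subseteq> chain_vs.span b"
    "card b = chain_vs.dim (\<pi> ` V)"
    using chain_vs.basis_exists[of "\<pi> ` V"] by metis
  have finb: "finite b"
    using chain_vs.independent_span_bound[OF finite_imageI[OF A(1)] b(2)] b(1) span_A by blast
  \<comment> \<open>\<open>q\<close> maps the classes injectively onto the image of \<open>V\<close>
    under \<open>\<pi>\<close>, so a basis of that image pulls back to a basis of classes. In
    particular the choice made in \<open>class_dim\<close> is among existing bases.\<close>
  have qb: "q ` {X \<in> T. q X \<in> b} = b"
  proof (intro equalityI subsetI)
    fix y assume "y \<in> b"
    then obtain z where z: "z \<in> V" "y = \<pi> z" using b(1) by blast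
    then have "q (hclass \<Gamma> i z) = y" "hclass \<Gamma> i z \<in> T" using q by (auto simp: T_def)
    with \<open>y \<in> b\<close> show "y \<in> q ` {X \<in> T. q X \<in> b}"
      by (intro image_eqI[of _ _ "hclass \<Gamma> i z"]) auto
  qed auto
  have "finite {X \<in> T. q X \<in> b}"
    using finb qb inj by (metis (no_types, lifting) finite_imageD inj_on_subset mem_Collect_eq subsetI)
  then have "class_basis \<Gamma> i T {X \<in> T. q X \<in> b}"
    using basis_iff[of "{X \<in> T. q X \<in> b}"] qb b by auto
  then have some: "class_basis \<Gamma> i T (SOME S. class_basis \<Gamma> i T S)" (is "class_basis \<Gamma> i T ?S")
    by (rule someI)
  then have S: "finite ?S" "?S \<subseteq> T" unfolding class_basis_def by auto
  have "q ` ?S \<subseteq> \<pi> ` V" using S(2) rep unfolding q_def by auto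
  then have "card (q ` ?S) = chain_vs.dim (\<pi> ` V)"
    using some basis_iff[OF S] chain_vs.basis_card_eq_dim by blast
  then have dim: "class_dim \<Gamma> i T = chain_vs.dim (\<pi> ` V)"
    unfolding class_dim_def using card_image[OF inj_on_subset[OF inj S(2)]] by simp
  have "chain_vs.dim (\<pi> ` V) \<le> card (\<pi> ` A)"
    by (rule chain_vs.dim_le_card[OF span_A]) (use A in auto)
  then show "class_dim \<Gamma> i (hclass \<Gamma> i ` V) \<le> card A"
    unfolding T_def[symmetric] dim using card_image_le[OF A(1), of \<pi>] by simp
  have ind\<pi>: "\<forall>x\<in>I. c x = 0" if "(\<Sum>x\<in>I. smul (c x) (\<pi> (g x))) = 0" for c
  proof (rule ind)
    have "\<pi> (\<Sum>x\<in>I. smul (c x) (g x)) = 0" using that by (simp add: \<pi>_simps)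
    then show "(\<Sum>x\<in>I. smul (c x) (g x)) \<in> B" using ker by blast
  qed
  have injI: "inj_on (\<pi> \<circ> g) I"
  proof (rule inj_onI, rule ccontr)
    fix x y assume xy: "x \<in> I" "y \<in> I" "(\<pi> \<circ> g) x = (\<pi> \<circ> g) y" "x \<noteq> y"
    \<comment> \<open>Coefficients 1 and -1 at two indices with equal images would be a nontrivial
      dependence.\<close>
    define c :: "_ \<Rightarrow> 'f" where "c z = (if z = x then 1 else if z = y then - 1 else 0)" for z
    have "(\<Sum>z\<in>I. smul (c z) (\<pi> (g z))) = (\<Sum>z\<in>{x,y}. smul (c z) (\<pi> (g z)))"
      using xy I by (intro sum.mono_neutral_right) (auto simp: c_def)
    also have "\<dots> = 0" using xy by (simp add: c_def)
    finally have "\<forall>x\<in>I. c x = 0" by (rule ind\<pi>)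
    then show False using xy unfolding c_def by auto
  qed
  have "chain_vs.independent ((\<pi> \<circ> g) ` I)"
  proof (rule chain_vs.independent_if_scalars_zero)
    fix u x assume u: "(\<Sum>x\<in>(\<pi> \<circ> g) ` I. smul (u x) x) = 0" and x: "x \<in> (\<pi> \<circ> g) ` I"
    have "(\<Sum>x\<in>I. smul (u (\<pi> (g x))) (\<pi> (g x))) = 0"
      using u unfolding sum.reindex[OF injI] by simp
    then show "u x = 0" using ind\<pi>[of "\<lambda>x. u (\<pi> (g x))"] x by auto
  qed (use I in auto)
  moreover have "(\<pi> \<circ> g) ` I \<subseteq> chain_vs.span b" using I b by auto
  ultimately have "card ((\<pi> \<circ> g) ` I) \<le> card b"
    using chain_vs.independent_span_bound[OF finb] by blast
  then show "card I \<le> class_dim \<Gamma> i (hclass \<Gamma> i ` V)"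
    unfolding T_def[symmetric] dim using card_image[OF injI] b by simp
qed

subsection \<open>Polynomials in the edges\<close>

lemma poly_mapping_sum_single:
  fixes p :: "'a \<Rightarrow>\<^sub>0 'b::comm_monoid_add"
  shows "p = (\<Sum>m\<in>keys p. single m (lookup p m))"
proof (rule poly_mapping_eqI)
  fix k
  have "(\<Sum>m\<in>keys p. lookup p m when m = k) = lookup p k"
    by (auto simp: when_def in_keys_iff)
  then show "lookup p k =
      lookup (\<Sum>m\<in>keys p. single m (lookup p m)) k"
    by (simp add: lookup_sum lookup_single)
qed

lemma poly_mapping_single_induct [case_names single add]:
  fixes p :: "'a \<Rightarrow>\<^sub>0 'b::comm_monoid_add"
  assumes s: "\<And>m a. P (single m a)" and a: "\<And>p q. P p \<Longrightarrow> P q \<Longrightarrow> P (p + q)"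
  shows "P p"
proof -
  have "P (\<Sum>m\<in>A. single m (lookup p m))" if "finite A" for A
    using that
  proof (induction A)
    case empty
    then show ?case using s[of undefined 0] by simp
  qed (use s a in simp)
  then show ?thesis using poly_mapping_sum_single[of p] by (metis finite_keys)
qed

lemma sum_keys_superset:
  assumes "finite A" "keys p \<subseteq> A" "\<And>k. f k 0 = 0"
  shows "(\<Sum>k\<in>keys p. f k (lookup p k)) = (\<Sum>k\<in>A. f k (lookup p k))"
  using assms by (intro sum.mono_neutral_left) (auto simp: in_keys_iff)

text \<open>The support of a sum may be smaller than the union of the supports, so both sides are
  compared on that union. The maps below that are defined by sums over \<open>keys\<close> owe their
  additivity to this.\<close>

lemma sum_keys_add:
  assumes "\<And>k. f k 0 = (0 :: 'c :: comm_monoid_add)" "\<And>k x y. f k (x + y) = f k x + f k y"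
  shows "(\<Sum>k\<in>keys (p + q). f k (lookup (p + q) k)) =
     (\<Sum>k\<in>keys p. f k (lookup p k)) +
     (\<Sum>k\<in>keys q. f k (lookup q k))"
proof -
  define A where "A = keys p \<union> keys q"
  have A: "finite A" "keys p \<subseteq> A" "keys q \<subseteq> A" "keys (p + q) \<subseteq> A"
    unfolding A_def using Poly_Mapping.keys_add[of p q] by auto
  show ?thesis
    unfolding sum_keys_superset[of A _ f, OF A(1,2) assms(1)] sum_keys_superset[of A _ f, OF A(1,3) assms(1)]
      sum_keys_superset[of A _ f, OF A(1,4) assms(1)]
    by (simp add: lookup_add assms(2) sum.distrib)
qed

section \<open>Degrees, and polynomials in the edges of a graph\<close>

definition mdeg :: "('e \<Rightarrow>\<^sub>0 nat) \<Rightarrow> nat" where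
  "mdeg m = (\<Sum>e \<in> keys m. lookup m e)"

lemma mdeg_0 [simp]: "mdeg 0 = 0" by (simp add: mdeg_def)

lemma mdeg_single [simp]: "mdeg (single e n) = n" by (simp add: mdeg_def)

lemma mdeg_add: "mdeg (m + m') = mdeg m + mdeg m'"
  unfolding mdeg_def by (rule sum_keys_add[of "\<lambda>_ x. x"]) auto

lemma edge_polys_0 [simp]: "0 \<in> edge_polys \<Gamma>" by (simp add: edge_polys_def)

lemma edge_polys_single:
  "keys m \<subseteq> edges \<Gamma> \<Longrightarrow> single m a \<in> edge_polys \<Gamma>"
  by (simp add: edge_polys_def)

lemma edge_polys_const [simp]: "const_poly a \<in> edge_polys \<Gamma>"
  by (simp add: edge_polys_single const_poly_def)

lemma edge_polys_1 [simp]: "1 \<in> edge_polys \<Gamma>"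
  using edge_polys_const[of 1 \<Gamma>] by simp

lemma edge_polys_var: "e \<in> edges \<Gamma> \<Longrightarrow> edge_var e \<in> edge_polys \<Gamma>"
  by (simp add: edge_polys_single edge_var_def)

lemma edge_polys_add: "p \<in> edge_polys \<Gamma> \<Longrightarrow> q \<in> edge_polys \<Gamma> \<Longrightarrow> p + q \<in> edge_polys \<Gamma>"
  using Poly_Mapping.keys_add[of p q] unfolding edge_polys_def by blast

lemma edge_polys_uminus: "p \<in> edge_polys \<Gamma> \<Longrightarrow> - p \<in> edge_polys \<Gamma>"
  unfolding edge_polys_def by (simp add: in_keys_iff)

lemma edge_polys_diff: "p \<in> edge_polys \<Gamma> \<Longrightarrow> q \<in> edge_polys \<Gamma> \<Longrightarrow> p - q \<in> edge_polys \<Gamma>"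
  by (metis diff_conv_add_uminus edge_polys_add edge_polys_uminus)

lemma edge_polys_mult: "p \<in> edge_polys \<Gamma> \<Longrightarrow> q \<in> edge_polys \<Gamma> \<Longrightarrow> p * q \<in> edge_polys \<Gamma>"
  unfolding edge_polys_def
proof safe
  fix m e assume pq: "\<forall>m\<in>keys p. keys m \<subseteq> edges \<Gamma>"
    "\<forall>m\<in>keys q. keys m \<subseteq> edges \<Gamma>"
    and m: "m \<in> keys (p * q)" and e: "e \<in> keys m"
  obtain a b where "m = a + b" "a \<in> keys p" "b \<in> keys q"
    using m Poly_Mapping.keys_mult[of p q] by blast
  then show "e \<in> edges \<Gamma>" using pq e Poly_Mapping.keys_add[of a b] by blast
qed

lemma edge_polys_prod: "(\<And>x. x \<in> A \<Longrightarrow> f x \<in> edge_polys \<Gamma>) \<Longrightarrow> prod f A \<in> edge_polys \<Gamma>"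
  by (induction A rule: infinite_finite_induct) (auto intro: edge_polys_mult)

text \<open>A monomial as a list of edges: single factors can be removed or exchanged, and
  inductions run along the list.\<close>

definition edge_monom :: "'e list \<Rightarrow> ('e, 'f::comm_ring_1) edge_poly" where
  "edge_monom es = prod_list (map edge_var es)"

lemma edge_monom_Nil [simp]: "edge_monom [] = 1" by (simp add: edge_monom_def)
lemma edge_monom_Cons [simp]: "edge_monom (e # es) = edge_var e * edge_monom es" by (simp add: edge_monom_def)

lemma edge_monom_remove1: "e \<in> set es \<Longrightarrow> edge_monom es = edge_var e * edge_monom (remove1 e es)"
  by (induction es) (auto simp: mult.left_commute)

lemma edge_monom_edge_polys: "set es \<subseteq> edges \<Gamma> \<Longrightarrow> edge_monom es \<in> edge_polys \<Gamma>"
  by (induction es) (auto intro: edge_polys_mult edge_polys_var)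

lemma single_eq_edge_monom:
  fixes m :: "'e \<Rightarrow>\<^sub>0 nat"
  shows "\<exists>es. set es \<subseteq> keys m \<and> length es = mdeg m \<and>
    single m 1 = (edge_monom es :: ('e, 'f::comm_ring_1) edge_poly)"
proof (induction "mdeg m" arbitrary: m)
  case 0
  have "m = 0"
    by (rule poly_mapping_eqI) (use 0 in \<open>auto simp: mdeg_def in_keys_iff\<close>)
  then show ?case by (intro exI[of _ "[]"]) simp
next
  case (Suc n)
  then have "m \<noteq> 0" by auto
  then obtain e where e: "e \<in> keys m" by (metis keys_eq_empty ex_in_conv)
  define m' where "m' = m - single e 1"
  have m: "m = single e 1 + m'"
    by (rule poly_mapping_eqI) (use e in \<open>auto simp: m'_def lookup_add lookup_minus lookup_single when_def in_keys_iff\<close>)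
  then have "n = mdeg m'" using Suc(2) by (simp add: mdeg_add)
  from Suc(1)[OF this] obtain es where es: "set es \<subseteq> keys m'" "length es = mdeg m'"
    "single m' 1 = (edge_monom es :: ('e, 'f) edge_poly)" by auto
  have "keys m' \<subseteq> keys m"
    by (auto simp: in_keys_iff m'_def lookup_minus)
  moreover have "single m 1 = (edge_monom (e # es) :: ('e, 'f) edge_poly)"
    using es(3) by (simp add: m edge_var_def mult_single flip: es(3))
  ultimately show ?case
    using es e \<open>n = mdeg m'\<close> Suc(2) by (intro exI[of _ "e # es"]) auto
qed

lemma edge_poly_eq_sum_edge_monom:
  fixes p :: "('e, 'f::comm_ring_1) edge_poly"
  assumes "p \<in> edge_polys \<Gamma>"
  shows "\<exists>es. (\<forall>m. m \<in> keys p \<longrightarrow> set (es m) \<subseteq> edges \<Gamma>) \<and>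
    p = (\<Sum>m\<in>keys p. const_poly (lookup p m) * edge_monom (es m))"
proof -
  have "\<exists>es. set es \<subseteq> keys m \<and> single m 1 = (edge_monom es :: ('e, 'f) edge_poly)" for m :: "'e \<Rightarrow>\<^sub>0 nat"
    using single_eq_edge_monom by metis
  then obtain es where es: "\<And>m. set (es m) \<subseteq> keys m"
    "\<And>m. single m 1 = (edge_monom (es m) :: ('e, 'f) edge_poly)" by metis
  have "const_poly a * edge_monom (es m) = single m a" for a :: 'f and m
    by (simp add: const_poly_def mult_single flip: es(2))
  then have "p = (\<Sum>m\<in>keys p. const_poly (lookup p m) * edge_monom (es m))"
    using poly_mapping_sum_single[of p] by simp
  then show ?thesis using assms es(1) unfolding edge_polys_def by blast
qed

section \<open>Homogeneous polynomials and homogeneous parts\<close>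

definition homog :: "nat \<Rightarrow> ('e, 'f::comm_ring_1) edge_poly \<Rightarrow> bool" where
  "homog n p \<longleftrightarrow> (\<forall>m \<in> keys p. mdeg m = n)"

lemma homog_0 [simp]: "homog n 0" by (simp add: homog_def)

lemma homog_1 [simp]: "homog 0 1" by (simp add: homog_def)

lemma homog_var [simp]: "homog (Suc 0) (edge_var e)" by (simp add: homog_def edge_var_def)

lemma homog_add: "homog n p \<Longrightarrow> homog n q \<Longrightarrow> homog n (p + q)"
  using Poly_Mapping.keys_add[of p q] unfolding homog_def by blast

lemma homog_uminus: "homog n p \<Longrightarrow> homog n (- p)"
  unfolding homog_def by (simp add: in_keys_iff)

lemma homog_diff: "homog n p \<Longrightarrow> homog n q \<Longrightarrow> homog n (p - q)"
  by (metis diff_conv_add_uminus homog_add homog_uminus)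

lemma homog_mult: "homog n p \<Longrightarrow> homog k q \<Longrightarrow> homog (n + k) (p * q)"
  using Poly_Mapping.keys_mult[of p q] unfolding homog_def by (fastforce simp: mdeg_add)

lemma homog_prod: "(\<And>x. x \<in> A \<Longrightarrow> homog (n x) (f x)) \<Longrightarrow> homog (sum n A) (prod f A)"
  by (induction A rule: infinite_finite_induct) (auto intro: homog_mult)

lemma homog_edge_monom: "homog (length es) (edge_monom es)"
  using homog_mult[OF homog_var] by (induction es) fastforce+

text \<open>The part of degree \<open>k - a\<close>, which vanishes for \<open>k < a\<close>.\<close>

lift_definition hpart :: "nat \<Rightarrow> nat \<Rightarrow> ('e, 'f::comm_ring_1) edge_poly \<Rightarrow> ('e, 'f) edge_poly" is
  "\<lambda>a k p m. p m when mdeg m + a = k"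
  by (erule finite_subset[rotated]) auto

lemma lookup_hpart:
  "lookup (hpart a k p) m = (lookup p m when mdeg m + a = k)"
  by (simp add: hpart.rep_eq)

lemma hpart_add: "hpart a k (p + q) = hpart a k p + hpart a k q"
  by (rule poly_mapping_eqI) (simp add: lookup_hpart lookup_add when_def)

lemma hpart_0 [simp]: "hpart a k 0 = 0"
  by (rule poly_mapping_eqI) (simp add: lookup_hpart)

lemma hpart_uminus: "hpart a k (- p) = - hpart a k p"
  by (rule poly_mapping_eqI) (simp add: lookup_hpart when_def)

lemma hpart_sum: "hpart a k (sum f A) = (\<Sum>x\<in>A. hpart a k (f x))"
  by (induction A rule: infinite_finite_induct) (auto simp: hpart_add)

lemma hpart_sign: "hpart a k ((- 1) ^ n * p) = (- 1) ^ n * hpart a k p"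
  by (induction n) (auto simp: hpart_uminus)

lemma hpart_single:
  "hpart a k (single m x) = (if mdeg m + a = k then single m x else 0)"
  by (rule poly_mapping_eqI) (auto simp: lookup_hpart lookup_single when_def)

text \<open>The factor \<open>edge_var e\<close> raises the degree by one, and the offset grows from
  \<open>a\<close> to \<open>Suc a\<close> to account for it.\<close>

lemma hpart_mult_var: "hpart a k (p * edge_var e) = hpart (Suc a) k p * edge_var e"
proof (induction p rule: poly_mapping_single_induct)
  case (single m x)
  show ?case by (simp add: edge_var_def mult_single hpart_single mdeg_add)
qed (simp add: algebra_simps hpart_add)

lemma hpart_edge_polys: "p \<in> edge_polys \<Gamma> \<Longrightarrow> hpart a k p \<in> edge_polys \<Gamma>"
  unfolding edge_polys_def by (auto simp: in_keys_iff lookup_hpart)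

section \<open>Substitution of component variables for edges\<close>

definition ren_mono :: "('e \<Rightarrow> nat) \<Rightarrow> ('e \<Rightarrow>\<^sub>0 nat) \<Rightarrow> (nat \<Rightarrow>\<^sub>0 nat)" where
  "ren_mono \<nu> m = (\<Sum>e \<in> keys m. single (\<nu> e) (lookup m e))"

lemma ren_mono_add: "ren_mono \<nu> (m + m') = ren_mono \<nu> m + ren_mono \<nu> m'"
  unfolding ren_mono_def by (rule sum_keys_add) (auto simp: single_add)

text \<open>The ring homomorphism that sends the variable of an edge to the variable of its colour.
  The target variables are indexed by natural numbers and so linearly ordered, a setting in which
  polynomials over a field have no zero divisors.\<close>

definition rename :: "('e \<Rightarrow> nat) \<Rightarrow> ('e, 'f::comm_ring_1) edge_poly \<Rightarrow> (nat, 'f) edge_poly" where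
  "rename \<nu> p = (\<Sum>m \<in> keys p. single (ren_mono \<nu> m) (lookup p m))"

lemma rename_add: "rename \<nu> (p + q) = rename \<nu> p + rename \<nu> q"
  unfolding rename_def by (rule sum_keys_add) (auto simp: single_add)

lemma rename_single: "rename \<nu> (single m a) = single (ren_mono \<nu> m) a"
  by (cases "a = 0") (auto simp: rename_def)

lemma rename_0 [simp]: "rename \<nu> 0 = 0" by (simp add: rename_def)

lemma rename_const: "rename \<nu> (const_poly a) = const_poly a"
  by (simp add: const_poly_def rename_single ren_mono_def)

lemma rename_1 [simp]: "rename \<nu> 1 = 1"
  using rename_const[of \<nu> 1] by simp

lemma rename_var: "rename \<nu> (edge_var e) = edge_var (\<nu> e)"
  by (simp add: edge_var_def rename_single ren_mono_def)

lemma rename_mult: "rename \<nu> (p * q) = rename \<nu> p * rename \<nu> q"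
proof (induction p rule: poly_mapping_single_induct)
  case (single m a)
  show ?case
  proof (induction q rule: poly_mapping_single_induct)
    case (single m' b)
    show ?case by (simp add: mult_single rename_single ren_mono_add)
  qed (simp add: algebra_simps rename_add)
qed (simp add: algebra_simps rename_add)

lemma rename_uminus: "rename \<nu> (- p) = - rename \<nu> p"
  using rename_add[of \<nu> p "- p"] by (simp add: eq_neg_iff_add_eq_0 add.commute)

lemma rename_diff: "rename \<nu> (p - q) = rename \<nu> p - rename \<nu> q"
  using rename_add[of \<nu> p "- q"] by (simp add: rename_uminus)

lemma rename_prod: "rename \<nu> (prod f A) = (\<Prod>x\<in>A. rename \<nu> (f x))"
  by (induction A rule: infinite_finite_induct) (auto simp: rename_mult)

lemma rename_power: "rename \<nu> (p ^ n) = rename \<nu> p ^ n"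
  by (induction n) (auto simp: rename_mult)

subsection \<open>The boundary map and the particle grading\<close>

lemma finite_states: "finite_graph \<Gamma> \<Longrightarrow> finite (states \<Gamma>)"
proof -
  assume fin: "finite_graph \<Gamma>"
  define F where "F = {Empty, Vert} \<union> Half ` (edges \<Gamma> \<times> UNIV)"
  have "finite F" "finite (verts \<Gamma>)"
    using fin unfolding F_def finite_graph_def by auto
  then have "finite {s. \<forall>v. (v \<in> verts \<Gamma> \<longrightarrow> s v \<in> F) \<and> (v \<notin> verts \<Gamma> \<longrightarrow> s v = Empty)}"
    by (intro finite_set_of_finite_funs)
  moreover have "states \<Gamma> \<subseteq> {s. \<forall>v. (v \<in> verts \<Gamma> \<longrightarrow> s v \<in> F) \<and> (v \<notin> verts \<Gamma> \<longrightarrow> s v = Empty)}"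
    unfolding states_def F_def half_edges_at_def by auto
  ultimately show ?thesis by (rule finite_subset[rotated])
qed

lemma finite_half_edges: "finite_graph \<Gamma> \<Longrightarrow> finite (half_edges_at \<Gamma> v)"
  unfolding finite_graph_def half_edges_at_def by auto

lemma boundary_add: "boundary \<Gamma> (c + d) = boundary \<Gamma> c + boundary \<Gamma> d"
  unfolding boundary_def
  by (rule sum_keys_add[of "\<lambda>s p. act p (boundary_state \<Gamma> s)"]) (auto simp: act_add_left)

lemma boundary_0 [simp]: "boundary \<Gamma> 0 = 0"
  by (simp add: boundary_def)

lemma boundary_single: "boundary \<Gamma> (single s p) = act p (boundary_state \<Gamma> s)"
  by (cases "p = 0") (auto simp: boundary_def)

lemma boundary_act: "boundary \<Gamma> (act p c) = act p (boundary \<Gamma> c)"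
  by (induction c rule: poly_mapping_single_induct) (auto simp: boundary_single act_act boundary_add act_add)

section \<open>Coefficients of the boundary map\<close>

definition koszul_sign :: "('v::linorder, 'e) cw_graph \<Rightarrow> ('v, 'e) state \<Rightarrow> 'v \<Rightarrow> ('e, 'f::comm_ring_1) edge_poly" where
  "koszul_sign \<Gamma> s v = (- 1) ^ card {u \<in> verts \<Gamma>. u < v \<and> is_Half (s u)}"

text \<open>The two coefficients of \<open>\<partial> h = e(h) - v(h)\<close>, selected by the
  generator that is left in the slot.\<close>

definition face :: "'e \<times> bool \<Rightarrow> 'e gen \<Rightarrow> ('e, 'f::comm_ring_1) edge_poly" where
  "face h g = (if g = Empty then edge_var (fst h) else - 1)"

lemma koszul_sign_upd [simp]: "koszul_sign \<Gamma> (s(v := g)) v = koszul_sign \<Gamma> s v"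
proof -
  have "{u \<in> verts \<Gamma>. u < v \<and> is_Half ((s(v := g)) u)} = {u \<in> verts \<Gamma>. u < v \<and> is_Half (s u)}"
    by auto
  then show ?thesis unfolding koszul_sign_def by simp
qed

text \<open>\<open>boundary\<close> lists the faces of each source state. Here the sum is
  reorganised by the target \<open>s'\<close>, whose sources arise by placing a half-edge into a
  slot of \<open>s'\<close> that holds none. In this form it can be evaluated on tensor products
  slot by slot.\<close>

lemma lookup_boundary:
  fixes c :: "('v::linorder, 'e, 'f::comm_ring_1) chain"
  assumes fin: "finite_graph \<Gamma>" and c: "keys c \<subseteq> states \<Gamma>"
  shows "lookup (boundary \<Gamma> c) s' =
    (\<Sum>v \<in> {v \<in> verts \<Gamma>. \<not> is_Half (s' v)}. koszul_sign \<Gamma> s' v *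
      (\<Sum>h \<in> half_edges_at \<Gamma> v. lookup c (s'(v := Half h)) * face h (s' v)))"
    (is "_ = (\<Sum>v\<in>?V. ?S v)")
proof -
  define T :: "('v, 'e) state \<Rightarrow> 'v \<Rightarrow> ('e, 'f) edge_poly"
    where "T s v = (if is_Half (s v) then koszul_sign \<Gamma> s v *
      ((edge_var (fst (the_half (s v))) when s(v := Empty) = s') - (1 when s(v := Vert) = s')) else 0)" for s v
  note finV = finite_verts[OF fin]
  have bs: "lookup (boundary_state \<Gamma> s) s' = (\<Sum>v\<in>verts \<Gamma>. T s v)" for s
  proof -
    have "lookup (boundary_state \<Gamma> s) s' = (\<Sum>v \<in> {v \<in> verts \<Gamma>. is_Half (s v)}. T s v)"
      unfolding boundary_state_def lookup_sum
      by (intro sum.cong refl) (simp add: T_def koszul_sign_def lookup_minus lookup_single)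
    also have "\<dots> = (\<Sum>v\<in>verts \<Gamma>. T s v)"
      using finV by (intro sum.mono_neutral_left) (auto simp: T_def)
    finally show ?thesis .
  qed
  have inner: "(\<Sum>s\<in>keys c. lookup c s * T s v) =
      (if is_Half (s' v) then 0 else ?S v)"
    if v: "v \<in> verts \<Gamma>" for v
  proof (cases "is_Half (s' v)")
    case True
    then have "T s v = 0" for s
      unfolding T_def by (auto simp: when_def)
    then show ?thesis using True by simp
  next
    case False
    define I where "I = (\<lambda>h. s'(v := Half h)) ` half_edges_at \<Gamma> v"
    have inj: "inj_on (\<lambda>h. s'(v := Half h)) (half_edges_at \<Gamma> v)"
      by (rule inj_onI) (metis fun_upd_same gen.inject)
    have finI: "finite I" unfolding I_def using finite_half_edges[OF fin] by simp
    \<comment> \<open>A contributing state has \<open>s'\<close> as a face at \<open>v\<close>: it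
      agrees with \<open>s'\<close> away from \<open>v\<close> and holds a half-edge there.\<close>
    have out: "lookup c s * T s v = 0" if "s \<in> keys c - I" for s
    proof (rule ccontr)
      assume "\<not> ?thesis"
      then have "T s v \<noteq> 0" by auto
      then have h: "is_Half (s v)" "s(v := Empty) = s' \<or> s(v := Vert) = s'"
        unfolding T_def by (auto simp: when_def split: if_splits)
      have "s \<in> states \<Gamma>" using that c by auto
      then have "s v \<in> Half ` half_edges_at \<Gamma> v" using v h(1) unfolding states_def by auto
      then obtain h' where "h' \<in> half_edges_at \<Gamma> v" "s v = Half h'" by auto
      moreover from this have "s = s'(v := Half h')" using h(2) by auto
      ultimately have "s \<in> I" unfolding I_def by auto
      then show False using that by auto
    qed
    have "(\<Sum>s\<in>keys c. lookup c s * T s v) =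
        (\<Sum>s\<in>I. lookup c s * T s v)"
    proof -
      have "(\<Sum>s\<in>keys c. lookup c s * T s v) =
        (\<Sum>s\<in>keys c \<union> I. lookup c s * T s v)"
        using finI by (intro sum.mono_neutral_left) (auto simp: in_keys_iff)
      also have "\<dots> = (\<Sum>s\<in>I. lookup c s * T s v)"
        using finI out by (intro sum.mono_neutral_right) auto
      finally show ?thesis .
    qed
    also have "\<dots> = (\<Sum>h\<in>half_edges_at \<Gamma> v. lookup c (s'(v := Half h)) * T (s'(v := Half h)) v)"
      unfolding I_def by (simp add: sum.reindex[OF inj])
    also have "\<dots> = (\<Sum>h\<in>half_edges_at \<Gamma> v. koszul_sign \<Gamma> s' v * (lookup c (s'(v := Half h)) * face h (s' v)))"
    proof (intro sum.cong refl)
      fix h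
      have "T (s'(v := Half h)) v = koszul_sign \<Gamma> s' v * face h (s' v)"
      proof (cases "s' v")
        case Empty
        then have "s'(v := Empty) = s'" "s'(v := Vert) \<noteq> s'" by (auto simp: fun_eq_iff)
        then show ?thesis using Empty by (simp add: T_def face_def)
      next
        case Vert
        then have "s'(v := Vert) = s'" "s'(v := Empty) \<noteq> s'" by (auto simp: fun_eq_iff)
        then show ?thesis using Vert by (simp add: T_def face_def)
      qed (use False in auto)
      then show "lookup c (s'(v := Half h)) * T (s'(v := Half h)) v =
         koszul_sign \<Gamma> s' v * (lookup c (s'(v := Half h)) * face h (s' v))"
        by (simp add: algebra_simps)
    qed
    finally show ?thesis using False by (simp add: sum_distrib_left)
  qed
  have "lookup (boundary \<Gamma> c) s' =
      (\<Sum>s\<in>keys c. \<Sum>v\<in>verts \<Gamma>. lookup c s * T s v)"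
    unfolding boundary_def lookup_sum by (simp add: bs sum_distrib_left)
  also have "\<dots> = (\<Sum>v\<in>verts \<Gamma>. \<Sum>s\<in>keys c. lookup c s * T s v)"
    by (rule sum.swap)
  also have "\<dots> = (\<Sum>v\<in>verts \<Gamma>. if is_Half (s' v) then 0 else ?S v)"
    by (intro sum.cong refl inner)
  also have "\<dots> = (\<Sum>v\<in>?V. ?S v)"
    using finV by (subst sum.inter_filter) (auto intro!: sum.cong)
  finally show ?thesis .
qed

section \<open>Chains and boundaries as modules over the edge polynomials\<close>

lemma chains_keys: "c \<in> chains \<Gamma> i \<Longrightarrow> keys c \<subseteq> states \<Gamma>"
  unfolding chains_def by auto

lemma chains_0 [simp]: "0 \<in> chains \<Gamma> i" by (simp add: chains_def)

lemma chains_iff: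
  "c \<in> chains \<Gamma> i \<longleftrightarrow> (\<forall>s. lookup c s \<in> edge_polys \<Gamma> \<and>
     (lookup c s \<noteq> 0 \<longrightarrow> s \<in> states \<Gamma> \<and> card {v \<in> verts \<Gamma>. is_Half (s v)} = i))"
proof -
  have "lookup c s \<in> edge_polys \<Gamma>" if "lookup c s = 0" for s
    using that by simp
  then show ?thesis unfolding chains_def mem_Collect_eq Ball_def in_keys_iff by blast
qed

lemma chains_add: "c \<in> chains \<Gamma> i \<Longrightarrow> d \<in> chains \<Gamma> i \<Longrightarrow> c + d \<in> chains \<Gamma> i"
  unfolding chains_iff lookup_add
proof (intro allI, goal_cases)
  case (1 s)
  from 1[THEN spec[of _ s]] show ?case
    by (cases "lookup c s = 0") (auto intro: edge_polys_add)
qed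

lemma chains_act: "p \<in> edge_polys \<Gamma> \<Longrightarrow> c \<in> chains \<Gamma> i \<Longrightarrow> act p c \<in> chains \<Gamma> i"
  unfolding chains_iff lookup_act
proof (intro allI, goal_cases)
  case (1 s)
  from 1(1) 1(2)[THEN spec[of _ s]] show ?case
    by (cases "lookup c s = 0") (auto intro: edge_polys_mult)
qed

lemma boundaries_0 [simp]: "0 \<in> boundaries \<Gamma> i"
  unfolding boundaries_def by (rule image_eqI[of _ _ 0]) auto

lemma boundaries_add: "c \<in> boundaries \<Gamma> i \<Longrightarrow> d \<in> boundaries \<Gamma> i \<Longrightarrow> c + d \<in> boundaries \<Gamma> i"
  unfolding boundaries_def by (auto simp flip: boundary_add intro!: imageI chains_add)

lemma boundaries_act: "p \<in> edge_polys \<Gamma> \<Longrightarrow> c \<in> boundaries \<Gamma> i \<Longrightarrow> act p c \<in> boundaries \<Gamma> i"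
  unfolding boundaries_def by (auto simp flip: boundary_act intro!: imageI chains_act)

lemma boundaries_subspace: "chain_vs.subspace (boundaries \<Gamma> i)"
  by (auto simp: chain_vs.subspace_def boundaries_add smul_def boundaries_act)

section \<open>The particle grading\<close>

definition nonempty_count :: "('v, 'e) cw_graph \<Rightarrow> ('v, 'e) state \<Rightarrow> nat" where
  "nonempty_count \<Gamma> s = card {v \<in> verts \<Gamma>. s v \<noteq> Empty}"

text \<open>The projection to \<open>k\<close> particles: the slots of \<open>s\<close> carry
  \<open>nonempty_count \<Gamma> s\<close> of them, and the degree of the coefficient has to supply
  the rest.\<close>

lift_definition particle_part :: "('v, 'e) cw_graph \<Rightarrow> nat \<Rightarrow> ('v, 'e, 'f::comm_ring_1) chain \<Rightarrow> ('v, 'e, 'f) chain" is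
  "\<lambda>\<Gamma> k c s. hpart (nonempty_count \<Gamma> s) k (c s)"
  by (erule finite_subset[rotated]) auto

lemma lookup_particle_part:
  "lookup (particle_part \<Gamma> k c) s = hpart (nonempty_count \<Gamma> s) k (lookup c s)"
  by (simp add: particle_part.rep_eq)

lemma particle_part_add: "particle_part \<Gamma> k (c + d) = particle_part \<Gamma> k c + particle_part \<Gamma> k d"
  by (rule poly_mapping_eqI) (simp add: lookup_particle_part lookup_add hpart_add)

lemma particle_part_0 [simp]: "particle_part \<Gamma> k 0 = 0"
  by (rule poly_mapping_eqI) (simp add: lookup_particle_part)

lemma particle_part_uminus: "particle_part \<Gamma> k (- c) = - particle_part \<Gamma> k c"
  by (rule poly_mapping_eqI) (simp add: lookup_particle_part hpart_uminus)

lemma particle_part_diff: "particle_part \<Gamma> k (c - d) = particle_part \<Gamma> k c - particle_part \<Gamma> k d"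
  using particle_part_add[of \<Gamma> k c "- d"] by (simp add: particle_part_uminus)

lemma has_particles_iff:
  "has_particles \<Gamma> k c \<longleftrightarrow> (\<forall>s. \<forall>m \<in> keys (lookup c s). mdeg m + nonempty_count \<Gamma> s = k)"
proof -
  have "lookup c s \<noteq> 0" if "m \<in> keys (lookup c s)" for s m
    using that by auto
  then show ?thesis
    unfolding has_particles_def mdeg_def nonempty_count_def Ball_def in_keys_iff[of _ c] by blast
qed

lemma has_particlesD:
  "has_particles \<Gamma> k c \<Longrightarrow> mdeg m + nonempty_count \<Gamma> s \<noteq> k \<Longrightarrow>
    lookup (lookup c s) m = 0"
  unfolding has_particles_iff in_keys_iff Ball_def by blast

lemma particle_part_id: "has_particles \<Gamma> k c \<Longrightarrow> particle_part \<Gamma> k c = c"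
  by (intro poly_mapping_eqI) (auto simp: lookup_particle_part lookup_hpart when_def has_particlesD)

lemma particle_part_other: "has_particles \<Gamma> j c \<Longrightarrow> j \<noteq> k \<Longrightarrow> particle_part \<Gamma> k c = 0"
  by (intro poly_mapping_eqI) (auto simp: lookup_particle_part lookup_hpart when_def has_particlesD)

lemma has_particles_particle_part: "has_particles \<Gamma> k (particle_part \<Gamma> k c)"
  unfolding has_particles_iff by (auto simp: lookup_particle_part lookup_hpart in_keys_iff)

lemma keys_particle_part: "keys (particle_part \<Gamma> k c) \<subseteq> keys c"
  by (auto simp: in_keys_iff lookup_particle_part)

lemma particle_part_chains: "c \<in> chains \<Gamma> i \<Longrightarrow> particle_part \<Gamma> k c \<in> chains \<Gamma> i"
  using keys_particle_part[of \<Gamma> k c] unfolding chains_def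
  by (auto simp: lookup_particle_part intro!: hpart_edge_polys)

lemma nonempty_count_upd:
  assumes "finite (verts \<Gamma>)" "v \<in> verts \<Gamma>"
  shows "nonempty_count \<Gamma> (s(v := Half h)) = (if s v = Empty then Suc (nonempty_count \<Gamma> s) else nonempty_count \<Gamma> s)"
proof (cases "s v = Empty")
  case True
  then have "{u \<in> verts \<Gamma>. (s(v := Half h)) u \<noteq> Empty} = insert v {u \<in> verts \<Gamma>. s u \<noteq> Empty}"
    using assms by auto
  then show ?thesis using True assms by (simp add: nonempty_count_def)
next
  case False
  then have "{u \<in> verts \<Gamma>. (s(v := Half h)) u \<noteq> Empty} = {u \<in> verts \<Gamma>. s u \<noteq> Empty}"
    by auto
  then show ?thesis using False unfolding nonempty_count_def by simp
qed

text \<open>Replacing a half-edge by \<open>Empty\<close> loses a particle in the slots and gains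
  one in the edge variable; replacing it by \<open>Vert\<close> changes neither count. Hence
  \<open>\<partial>\<close> preserves the number of particles.\<close>

lemma boundary_particle_part:
  assumes fin: "finite_graph \<Gamma>" and c: "keys c \<subseteq> states \<Gamma>"
  shows "boundary \<Gamma> (particle_part \<Gamma> k c) = particle_part \<Gamma> k (boundary \<Gamma> c)"
proof (rule poly_mapping_eqI)
  fix s
  note finV = finite_verts[OF fin]
  have c': "keys (particle_part \<Gamma> k c) \<subseteq> states \<Gamma>"
    using keys_particle_part c by (rule order_trans)
  have face: "hpart (nonempty_count \<Gamma> s) k (p * face h (s v)) =
      hpart (nonempty_count \<Gamma> (s(v := Half h))) k p * face h (s v)" if "v \<in> verts \<Gamma>" for p v h
    unfolding face_def nonempty_count_upd[OF finV that] by (simp add: hpart_mult_var hpart_uminus)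
  show "lookup (boundary \<Gamma> (particle_part \<Gamma> k c)) s =
      lookup (particle_part \<Gamma> k (boundary \<Gamma> c)) s"
    unfolding lookup_particle_part lookup_boundary[OF fin c] lookup_boundary[OF fin c'] hpart_sum
      koszul_sign_def hpart_sign
    by (intro sum.cong refl arg_cong2[of _ _ _ _ "(*)"]) (simp add: face lookup_particle_part hpart_sum)
qed

lemma particle_part_boundaries:
  assumes "finite_graph \<Gamma>" "b \<in> boundaries \<Gamma> i"
  shows "particle_part \<Gamma> k b \<in> boundaries \<Gamma> i"
proof -
  obtain c where c: "c \<in> chains \<Gamma> (Suc i)" "b = boundary \<Gamma> c"
    using assms unfolding boundaries_def by auto
  then show ?thesis
    using boundary_particle_part[OF assms(1) chains_keys[OF c(1)], of k] particle_part_chains[OF c(1), of k]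
    unfolding boundaries_def by (metis imageI)
qed

subsection \<open>Tori\<close>

definition slot_admissible :: "('v, 'e) cw_graph \<Rightarrow> 'v \<Rightarrow> 'e gen \<Rightarrow> bool" where
  "slot_admissible \<Gamma> v g \<longleftrightarrow> g \<in> {Empty, Vert} \<union> Half ` half_edges_at \<Gamma> v"

lemma states_upd:
  assumes "v \<in> verts \<Gamma>" "slot_admissible \<Gamma> v g"
  shows "s(v := g) \<in> states \<Gamma> \<longleftrightarrow> s(v := Empty) \<in> states \<Gamma>"
  using assms unfolding states_def slot_admissible_def by auto

lemma lookup_tensor:
  assumes "finite_graph \<Gamma>"
  shows "lookup (tensor \<Gamma> a) s =
    (if s \<in> states \<Gamma> then \<Prod>v\<in>verts \<Gamma>. lookup (a v) (s v) else 0)"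
  unfolding tensor_def lookup_sum lookup_single when_def
  using finite_states[OF assms] by simp

text \<open>The coefficient of the tensor product with the factor at \<open>v\<close> struck out.
  Membership is tested on \<open>s(v := Empty)\<close>, which does not depend on \<open>s v\<close>,
  so that one cofactor serves all fillings of the slot.\<close>

definition cofactor :: "('v, 'e) cw_graph \<Rightarrow> ('v \<Rightarrow> ('e gen \<Rightarrow>\<^sub>0 ('e, 'f::comm_ring_1) edge_poly)) \<Rightarrow>
    ('v, 'e) state \<Rightarrow> 'v \<Rightarrow> ('e, 'f) edge_poly" where
  "cofactor \<Gamma> a s v = (if s(v := Empty) \<in> states \<Gamma>
     then \<Prod>u\<in>verts \<Gamma> - {v}. lookup (a u) (s u) else 0)"

lemma lookup_tensor_upd:
  assumes fin: "finite_graph \<Gamma>" and v: "v \<in> verts \<Gamma>" "slot_admissible \<Gamma> v g"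
  shows "lookup (tensor \<Gamma> a) (s(v := g)) = lookup (a v) g * cofactor \<Gamma> a s v"
proof -
  note finV = finite_verts[OF fin]
  have "(\<Prod>u\<in>verts \<Gamma>. lookup (a u) ((s(v := g)) u)) =
     lookup (a v) g * (\<Prod>u\<in>verts \<Gamma> - {v}. lookup (a u) ((s(v := g)) u))"
    using finV v by (simp add: prod.remove)
  also have "(\<Prod>u\<in>verts \<Gamma> - {v}. lookup (a u) ((s(v := g)) u)) =
     (\<Prod>u\<in>verts \<Gamma> - {v}. lookup (a u) (s u))"
    by (intro prod.cong) auto
  finally show ?thesis
    unfolding lookup_tensor[OF fin] states_upd[OF v] cofactor_def by auto
qed

lemma lookup_tensor_slot:
  assumes "finite_graph \<Gamma>" "v \<in> verts \<Gamma>" "slot_admissible \<Gamma> v (s v)"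
  shows "lookup (tensor \<Gamma> a) s = lookup (a v) (s v) * cofactor \<Gamma> a s v"
  using lookup_tensor_upd[OF assms, of a s] by simp

lemma states_admissible: "s \<in> states \<Gamma> \<Longrightarrow> v \<in> verts \<Gamma> \<Longrightarrow> slot_admissible \<Gamma> v (s v)"
  unfolding states_def slot_admissible_def by auto

lemma cofactor_cong:
  "(\<And>u. u \<noteq> v \<Longrightarrow> a u = a' u) \<Longrightarrow> cofactor \<Gamma> a s v = cofactor \<Gamma> a' s v"
  unfolding cofactor_def by (auto intro!: prod.cong)

lemma prod_factor_nonzero:
  fixes f :: "'a \<Rightarrow> 'b::comm_semiring_1"
  assumes "prod f A \<noteq> 0" "finite A" "x \<in> A"
  shows "f x \<noteq> 0"
  using assms prod_zero[of A f] by blast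

lemma tensor_keys: "finite_graph \<Gamma> \<Longrightarrow> keys (tensor \<Gamma> a) \<subseteq> states \<Gamma>"
  by (auto simp: in_keys_iff lookup_tensor split: if_splits)

text \<open>The Leibniz rule: one slot is differentiated at a time and the cofactor is carried
  along. A tensor product whose factors are all cycles is therefore a cycle.\<close>

lemma lookup_boundary_tensor:
  assumes fin: "finite_graph \<Gamma>"
  shows "lookup (boundary \<Gamma> (tensor \<Gamma> a)) s =
    (\<Sum>v \<in> {v \<in> verts \<Gamma>. \<not> is_Half (s v)}. koszul_sign \<Gamma> s v *
      ((\<Sum>h \<in> half_edges_at \<Gamma> v. lookup (a v) (Half h) * face h (s v)) * cofactor \<Gamma> a s v))"
  unfolding lookup_boundary[OF fin tensor_keys[OF fin]]
proof (intro sum.cong refl arg_cong2[of _ _ _ _ "(*)"])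
  fix v assume v: "v \<in> {v \<in> verts \<Gamma>. \<not> is_Half (s v)}"
  show "(\<Sum>h \<in> half_edges_at \<Gamma> v. lookup (tensor \<Gamma> a) (s(v := Half h)) * face h (s v)) =
     (\<Sum>h \<in> half_edges_at \<Gamma> v. lookup (a v) (Half h) * face h (s v)) * cofactor \<Gamma> a s v"
    unfolding sum_distrib_right
    using v by (intro sum.cong refl) (simp add: lookup_tensor_upd[OF fin] slot_admissible_def algebra_simps)
qed

section \<open>Star chains\<close>

lemma lookup_star_chain:
  "lookup (star_chain h1 h2 h3) g =
     edge_var (fst h3) * ((1 when g = Half h1) - (1 when g = Half h2))
   + edge_var (fst h2) * ((1 when g = Half h3) - (1 when g = Half h1))
   + edge_var (fst h1) * ((1 when g = Half h2) - (1 when g = Half h3))"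
  unfolding star_chain_def Let_def by (simp add: lookup_add lookup_minus lookup_single when_def eq_commute)

lemma lookup_star_chain_not_half: "\<not> is_Half g \<Longrightarrow> lookup (star_chain h1 h2 h3) g = 0"
  by (cases g) (auto simp: lookup_star_chain)

text \<open>The edge terms add up to
  \<open>e_3(e_1 - e_2) + e_2(e_3 - e_1) + e_1(e_2 - e_3) = 0\<close>, and the vertex terms cancel
  within each difference of half-edges.\<close>

lemma star_chain_cycle:
  assumes "finite H" "{h1, h2, h3} \<subseteq> H"
  shows "(\<Sum>h\<in>H. lookup (star_chain h1 h2 h3) (Half h) * face h g) = 0"
proof -
  have d: "(\<Sum>h\<in>H. (1 when Half h = Half k) * face h g) = face k g" if "k \<in> H" for k
  proof -
    have "(\<Sum>h\<in>H. (1 when Half h = Half k) * face h g) = (\<Sum>h\<in>H. if h = k then face h g else 0)"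
      by (intro sum.cong refl) (simp add: when_def)
    then show ?thesis using assms(1) that by simp
  qed
  have "(\<Sum>h\<in>H. lookup (star_chain h1 h2 h3) (Half h) * face h g) =
     (\<Sum>h\<in>H. edge_var (fst h3) * ((1 when Half h = Half h1) * face h g) - edge_var (fst h3) * ((1 when Half h = Half h2) * face h g)
        + (edge_var (fst h2) * ((1 when Half h = Half h3) * face h g) - edge_var (fst h2) * ((1 when Half h = Half h1) * face h g))
        + (edge_var (fst h1) * ((1 when Half h = Half h2) * face h g) - edge_var (fst h1) * ((1 when Half h = Half h3) * face h g)))"
    unfolding lookup_star_chain by (intro sum.cong refl) (simp only: algebra_simps)
  also have "\<dots> = edge_var (fst h3) * face h1 g - edge_var (fst h3) * face h2 g
        + (edge_var (fst h2) * face h3 g - edge_var (fst h2) * face h1 g)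
        + (edge_var (fst h1) * face h2 g - edge_var (fst h1) * face h3 g)"
    unfolding sum.distrib sum_subtractf sum_distrib_left[symmetric] using assms(2) by (simp add: d del: gen.inject)
  also have "\<dots> = 0" by (simp add: face_def algebra_simps)
  finally show ?thesis .
qed

text \<open>A star chain is the 3 by 3 determinant with columns \<open>(1, e(h), h)\<close>. The
  combination of the columns of \<open>h1\<close>, \<open>h2\<close>, \<open>h3\<close> with
  coefficients \<open>e(h3) - e(h2)\<close>, \<open>e(h1) - e(h3)\<close>,
  \<open>e(h2) - e(h1)\<close> is 0 in the first two entries and has the star chain of the three as
  last entry. The determinant with columns \<open>a\<close>, \<open>b\<close> and this combination
  gives the relation. It holds on chains, without a boundary correction, hence inside any slot of a
  tensor product.\<close>

lemma star_chain_exchange: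
  "act (edge_var (fst b) - edge_var (fst a)) (star_chain h1 h2 h3) =
     act (edge_var (fst h1) - edge_var (fst h3)) (star_chain a b h2)
   + act (edge_var (fst h2) - edge_var (fst h1)) (star_chain a b h3)
   + act (edge_var (fst h3) - edge_var (fst h2)) (star_chain a b h1)"
  by (rule poly_mapping_eqI) (simp add: lookup_add lookup_star_chain algebra_simps)

lemma star_chain_degenerate: "star_chain a b a = 0" "star_chain a b b = 0"
  by (rule poly_mapping_eqI, simp add: lookup_star_chain algebra_simps)+

text \<open>Among the star chains that begin with \<open>a\<close> and \<open>b\<close>, the
  half-edge \<open>k\<close> occurs only in the one that ends with it. This makes the detecting
  functionals diagonal on the chosen generators.\<close>

lemma lookup_star_chain_third:
  assumes "k \<noteq> a" "k \<noteq> b"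
  shows "lookup (star_chain a b c) (Half k) =
     (if k = c then edge_var (fst b) - edge_var (fst a) else 0)"
  using assms by (auto simp: lookup_star_chain)

section \<open>Torus chains and their relations\<close>

definition torus_factor :: "'v set \<Rightarrow> ('v \<Rightarrow> ('e \<times> bool) \<times> ('e \<times> bool) \<times> ('e \<times> bool)) \<Rightarrow>
    'v \<Rightarrow> ('e gen \<Rightarrow>\<^sub>0 ('e, 'f::comm_ring_1) edge_poly)" where
  "torus_factor W t v = (if v \<in> W then (case t v of (h1, h2, h3) \<Rightarrow> star_chain h1 h2 h3)
     else single Empty 1)"

lemma torus_chain_tensor: "torus_chain \<Gamma> W t = tensor \<Gamma> (torus_factor W t)"
  unfolding torus_chain_def torus_factor_def ..

lemma torus_factor_support:
  "lookup (torus_factor W t v) g \<noteq> 0 \<Longrightarrow> if v \<in> W then is_Half g else g = Empty"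
  unfolding torus_factor_def
  by (cases "t v") (auto simp: lookup_single when_def split: if_splits intro: ccontr[OF notE[OF _ lookup_star_chain_not_half]])

lemma star_choiceD:
  "star_choice \<Gamma> W t \<Longrightarrow> v \<in> W \<Longrightarrow> t v = (h1, h2, h3) \<Longrightarrow>
    {h1, h2, h3} \<subseteq> half_edges_at \<Gamma> v \<and> h1 \<noteq> h2 \<and> h1 \<noteq> h3 \<and> h2 \<noteq> h3"
  unfolding star_choice_def by fastforce

lemma torus_factor_edge_polys:
  assumes "star_choice \<Gamma> W t"
  shows "lookup (torus_factor W t v) g \<in> edge_polys \<Gamma>"
proof (cases "v \<in> W")
  case True
  obtain h1 h2 h3 where t: "t v = (h1, h2, h3)" by (cases "t v")
  have "fst h1 \<in> edges \<Gamma>" "fst h2 \<in> edges \<Gamma>" "fst h3 \<in> edges \<Gamma>"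
    using star_choiceD[OF assms True t] unfolding half_edges_at_def by auto
  then show ?thesis using True
    by (simp add: torus_factor_def t lookup_star_chain when_def edge_polys_add edge_polys_diff edge_polys_mult edge_polys_var)
next
  case False
  then show ?thesis by (simp add: torus_factor_def lookup_single when_def)
qed

lemma torus_factor_homog:
  "homog (if v \<in> W then 1 else 0) (lookup (torus_factor W t v) g)"
proof (cases "v \<in> W")
  case True
  obtain h1 h2 h3 where t: "t v = (h1, h2, h3)" by (cases "t v")
  have *: "homog (Suc 0) (edge_var e * ((1 when P) - (1 when Q)))" for e P Q
    by (simp add: when_def homog_diff homog_uminus)
  show ?thesis using True
    by (simp add: torus_factor_def t lookup_star_chain homog_add *)
next
  case False
  then show ?thesis by (simp add: torus_factor_def lookup_single when_def)
qed

lemma torus_slot_cycle: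
  assumes "finite_graph \<Gamma>" "star_choice \<Gamma> W t"
  shows "(\<Sum>h \<in> half_edges_at \<Gamma> v. lookup (torus_factor W t v) (Half h) * face h g) = 0"
proof (cases "v \<in> W")
  case True
  obtain h1 h2 h3 where t: "t v = (h1, h2, h3)" by (cases "t v")
  then have "{h1, h2, h3} \<subseteq> half_edges_at \<Gamma> v" using star_choiceD[OF assms(2) True] by blast
  then show ?thesis
    using True star_chain_cycle[OF finite_half_edges[OF assms(1)]] by (simp add: torus_factor_def t)
qed (simp add: torus_factor_def lookup_single)

lemma boundary_torus:
  assumes "finite_graph \<Gamma>" "star_choice \<Gamma> W t"
  shows "boundary \<Gamma> (torus_chain \<Gamma> W t) = 0"
  by (rule poly_mapping_eqI)
    (simp add: torus_chain_tensor lookup_boundary_tensor[OF assms(1)] torus_slot_cycle[OF assms])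

lemma tensor_chains:
  assumes fin: "finite_graph \<Gamma>" and D: "D \<subseteq> verts \<Gamma>"
    and poly: "\<And>v g. lookup (a v) g \<in> edge_polys \<Gamma>"
    and supp: "\<And>v g. lookup (a v) g \<noteq> 0 \<Longrightarrow> is_Half g \<longleftrightarrow> v \<in> D"
  shows "tensor \<Gamma> a \<in> chains \<Gamma> (card D)"
  unfolding chains_iff
proof (intro allI conjI impI)
  fix s
  note finV = finite_verts[OF fin]
  show "lookup (tensor \<Gamma> a) s \<in> edge_polys \<Gamma>"
    unfolding lookup_tensor[OF fin] by (auto intro: edge_polys_prod poly)
  assume nz: "lookup (tensor \<Gamma> a) s \<noteq> 0"
  then show "s \<in> states \<Gamma>" unfolding lookup_tensor[OF fin] by (auto split: if_splits)
  have "lookup (a v) (s v) \<noteq> 0" if "v \<in> verts \<Gamma>" for v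
    using nz prod_factor_nonzero[OF _ finV that, of "\<lambda>v. lookup (a v) (s v)"]
    unfolding lookup_tensor[OF fin] by (auto split: if_splits)
  then have "{v \<in> verts \<Gamma>. is_Half (s v)} = D" using supp D by blast
  then show "card {v \<in> verts \<Gamma>. is_Half (s v)} = card D" by simp
qed

lemma torus_chains:
  assumes "finite_graph \<Gamma>" "W \<subseteq> verts \<Gamma>" "star_choice \<Gamma> W t"
  shows "torus_chain \<Gamma> W t \<in> chains \<Gamma> (card W)"
  unfolding torus_chain_tensor
proof (rule tensor_chains[OF assms(1,2)])
  show "is_Half g \<longleftrightarrow> v \<in> W" if "lookup (torus_factor W t v) g \<noteq> 0" for v g
    using torus_factor_support[OF that] by (auto split: if_splits)
qed (rule torus_factor_edge_polys[OF assms(3)])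

text \<open>Each vertex of \<open>W\<close> contributes a half-edge in its slot and one edge
  variable in the coefficient, hence two particles.\<close>

lemma torus_has_particles:
  fixes \<Gamma> :: "('v, 'e) cw_graph" and p :: "('e, 'f::comm_ring_1) edge_poly"
  assumes fin: "finite_graph \<Gamma>" and W: "W \<subseteq> verts \<Gamma>"
    and p: "homog n p"
  shows "has_particles \<Gamma> (n + 2 * card W) (act p (torus_chain \<Gamma> W t))"
  unfolding has_particles_iff
proof (intro allI ballI)
  fix s m assume m: "m \<in> keys (lookup (act p (torus_chain \<Gamma> W t)) s)"
  note finV = finite_verts[OF fin]
  have st: "s \<in> states \<Gamma>" using m by (auto simp: torus_chain_tensor lookup_tensor[OF fin] split: if_splits)
  then have m: "m \<in> keys (p * (\<Prod>v\<in>verts \<Gamma>. lookup (torus_factor W t v) (s v)))"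
    using m by (simp add: torus_chain_tensor lookup_tensor[OF fin])
  then have nz: "(\<Prod>v\<in>verts \<Gamma>. lookup (torus_factor W t v :: 'e gen \<Rightarrow>\<^sub>0 ('e, 'f) edge_poly) (s v)) \<noteq> 0" by auto
  have "lookup (torus_factor W t v :: 'e gen \<Rightarrow>\<^sub>0 ('e, 'f) edge_poly) (s v) \<noteq> 0" if "v \<in> verts \<Gamma>" for v
    by (rule prod_factor_nonzero[OF nz finV that])
  then have "if v \<in> W then is_Half (s v) else s v = Empty" if "v \<in> verts \<Gamma>" for v
    using torus_factor_support that by metis
  then have "s v \<noteq> Empty \<longleftrightarrow> v \<in> W" if "v \<in> verts \<Gamma>" for v
    using that by (metis gen.disc(1))
  then have "{v \<in> verts \<Gamma>. s v \<noteq> Empty} = W" using W by blast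
  then have 1: "nonempty_count \<Gamma> s = card W" unfolding nonempty_count_def by simp
  have "homog (n + (\<Sum>v\<in>verts \<Gamma>. if v \<in> W then 1 else 0)) (p * (\<Prod>v\<in>verts \<Gamma>. lookup (torus_factor W t v) (s v)))"
    by (intro homog_mult p homog_prod torus_factor_homog)
  moreover have "(\<Sum>v\<in>verts \<Gamma>. if v \<in> W then 1 else 0 :: nat) = card W"
    using finV W by (simp add: sum.If_cases Int_absorb1)
  ultimately have "mdeg m = n + card W" using m unfolding homog_def by auto
  then show "mdeg m + nonempty_count \<Gamma> s = n + 2 * card W" using 1 by simp
qed

text \<open>The cofactor does not see the triple at \<open>w\<close>, so the torus chain is linear
  in its star chain at \<open>w\<close>, and relations between star chains pass to tori.\<close>

lemma torus_slot:
  assumes "finite_graph \<Gamma>" "w \<in> verts \<Gamma>" "w \<in> W" "s \<in> states \<Gamma>"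
  shows "lookup (torus_chain \<Gamma> W (t(w := (h1, h2, h3)))) s =
    lookup (star_chain h1 h2 h3) (s w) * cofactor \<Gamma> (torus_factor W t) s w"
proof -
  have "lookup (torus_chain \<Gamma> W (t(w := (h1, h2, h3)))) s =
    lookup (star_chain h1 h2 h3) (s w) * cofactor \<Gamma> (torus_factor W (t(w := (h1, h2, h3)))) s w"
    unfolding torus_chain_tensor
    using assms(3)
    by (simp add: lookup_tensor_slot[where v = w and s = s, OF assms(1,2) states_admissible[OF assms(4,2)]]
        torus_factor_def[where v = w])
  also have "cofactor \<Gamma> (torus_factor W (t(w := (h1, h2, h3)))) s w = cofactor \<Gamma> (torus_factor W t) s w"
    by (rule cofactor_cong) (simp add: torus_factor_def)
  finally show ?thesis .
qed

lemma torus_keys: "finite_graph \<Gamma> \<Longrightarrow> keys (torus_chain \<Gamma> W t) \<subseteq> states \<Gamma>"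
  unfolding torus_chain_tensor by (rule tensor_keys)

lemma torus_exchange:
  fixes \<Gamma> :: "('v, 'e) cw_graph"
  assumes fin: "finite_graph \<Gamma>" and w: "w \<in> verts \<Gamma>" "w \<in> W" and t: "t w = (h1, h2, h3)"
  shows "act (edge_var (fst b) - edge_var (fst a)) (torus_chain \<Gamma> W t :: ('v, 'e, 'f::comm_ring_1) chain) =
     act (edge_var (fst h1) - edge_var (fst h3)) (torus_chain \<Gamma> W (t(w := (a, b, h2))))
   + act (edge_var (fst h2) - edge_var (fst h1)) (torus_chain \<Gamma> W (t(w := (a, b, h3))))
   + act (edge_var (fst h3) - edge_var (fst h2)) (torus_chain \<Gamma> W (t(w := (a, b, h1))))"
    (is "?l = ?r")
proof (rule poly_mapping_eqI)
  fix s
  have t': "t = t(w := (h1, h2, h3))" using t by auto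
  show "lookup ?l s = lookup ?r s"
  proof (cases "s \<in> states \<Gamma>")
    case True
    note ts = torus_slot[OF fin w True, of t]
    have "lookup ?l s = lookup (act (edge_var (fst b) - edge_var (fst a)) (star_chain h1 h2 h3)) (s w)
        * cofactor \<Gamma> (torus_factor W t) s w"
      by (subst t') (simp only: lookup_act ts mult.assoc)
    then show ?thesis
      by (subst (asm) star_chain_exchange) (simp only: lookup_add lookup_act ts distrib_right mult.assoc)
  next
    case False
    then have "lookup (torus_chain \<Gamma> W t' :: ('v, 'e, 'f) chain) s = 0" for t'
      using torus_keys[OF fin, of W t'] by (auto simp: in_keys_iff)
    then show ?thesis by (simp add: lookup_add)
  qed
qed

text \<open>The exchange relation can produce triples that repeat \<open>a\<close> or
  \<open>b\<close>. They are no star choices, but a determinant with two equal columns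
  vanishes.\<close>

lemma torus_degenerate:
  fixes \<Gamma> :: "('v, 'e) cw_graph"
  assumes "finite_graph \<Gamma>" "w \<in> verts \<Gamma>" "w \<in> W" "t w = (a, b, c)" "c = a \<or> c = b"
  shows "torus_chain \<Gamma> W t = (0 :: ('v, 'e, 'f::comm_ring_1) chain)"
proof (rule poly_mapping_eqI)
  fix s
  have t': "t = t(w := (a, b, c))" using assms(4) by auto
  have "star_chain a b c = (0 :: 'e gen \<Rightarrow>\<^sub>0 ('e, 'f) edge_poly)" using assms(5) star_chain_degenerate by metis
  then show "lookup (torus_chain \<Gamma> W t :: ('v, 'e, 'f) chain) s = lookup 0 s"
  proof (cases "s \<in> states \<Gamma>")
    case True
    then show ?thesis
      by (subst t') (simp add: torus_slot[OF assms(1-3) True] \<open>star_chain a b c = 0\<close>)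
  next
    case False
    then show ?thesis using torus_keys[OF assms(1), of W t] by (auto simp: in_keys_iff)
  qed
qed

text \<open>The empty slot at \<open>v\<close> is filled with \<open>h - h'\<close>. All other slots
  are cycles, so the boundary is concentrated at \<open>v\<close>, where the two vertex terms cancel
  and \<open>e(h) - e(h')\<close> remains up to sign.\<close>

lemma half_edge_difference_boundary:
  fixes t :: "'v::linorder \<Rightarrow> ('e \<times> bool) \<times> ('e \<times> bool) \<times> ('e \<times> bool)"
  assumes fin: "finite_graph \<Gamma>" and W: "W \<subseteq> verts \<Gamma>" and t: "star_choice \<Gamma> W t"
    and v: "v \<in> verts \<Gamma>" "v \<notin> W" and h: "h \<in> half_edges_at \<Gamma> v" "h' \<in> half_edges_at \<Gamma> v"
  shows "act (edge_var (fst h) - edge_var (fst h')) (torus_chain \<Gamma> W t)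
     \<in> (boundaries \<Gamma> (card W) :: ('v, 'e, 'f::comm_ring_1) chain set)"
proof -
  define F where "F = (torus_factor W t :: 'v \<Rightarrow> ('e gen \<Rightarrow>\<^sub>0 ('e, 'f) edge_poly))"
  define a where "a = F(v := single (Half h) 1 - single (Half h') 1)"
  \<comment> \<open>On the support of the torus the half-edges sit exactly at the vertices of
    \<open>W\<close>, so the Koszul sign at \<open>v\<close> is the same for all its states.\<close>
  define sg :: "('e, 'f) edge_poly" where "sg = (- 1) ^ card {u \<in> verts \<Gamma>. u < v \<and> u \<in> W}"
  note finV = finite_verts[OF fin]
  note finW = finite_subset[OF W finV]
  have F_supp: "if u \<in> W then is_Half g else g = Empty" if "lookup (F u) g \<noteq> 0" for u g
    using that torus_factor_support unfolding F_def by metis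
  have "tensor \<Gamma> a \<in> chains \<Gamma> (card (insert v W))"
  proof (rule tensor_chains[OF fin])
    show "insert v W \<subseteq> verts \<Gamma>" using W v by auto
    fix u g
    show "lookup (a u) g \<in> edge_polys \<Gamma>"
      unfolding a_def F_def using torus_factor_edge_polys[OF t]
      by (auto simp: lookup_minus lookup_single when_def edge_polys_diff edge_polys_uminus)
    assume nz: "lookup (a u) g \<noteq> 0"
    show "is_Half g \<longleftrightarrow> u \<in> insert v W"
    proof (cases "u = v")
      case True
      then show ?thesis using nz unfolding a_def by (auto simp: lookup_minus lookup_single when_def split: if_splits)
    next
      case False
      then show ?thesis using nz F_supp[of u g] unfolding a_def by (auto split: if_splits)
    qed
  qed
  then have "boundary \<Gamma> (tensor \<Gamma> a) \<in> boundaries \<Gamma> (card W)"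
    using v(2) finW unfolding boundaries_def by simp
  moreover have "boundary \<Gamma> (tensor \<Gamma> a) = act (sg * (edge_var (fst h) - edge_var (fst h'))) (torus_chain \<Gamma> W t)"
  proof (rule poly_mapping_eqI)
    fix s
    have cof: "cofactor \<Gamma> a s v = cofactor \<Gamma> F s v"
      by (rule cofactor_cong) (simp add: a_def)
    have slot: "(\<Sum>k \<in> half_edges_at \<Gamma> u. lookup (a u) (Half k) * face k (s u)) = 0" if "u \<noteq> v" for u
      using that torus_slot_cycle[OF fin t, of u] unfolding a_def F_def by simp
    have "(\<Sum>k \<in> half_edges_at \<Gamma> v. lookup (a v) (Half k) * face k (s v)) =
        (\<Sum>k \<in> half_edges_at \<Gamma> v. (if k = h then face k (s v) else 0) - (if k = h' then face k (s v) else 0))"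
      by (intro sum.cong refl) (auto simp: a_def lookup_minus lookup_single when_def algebra_simps)
    also have "\<dots> = face h (s v) - face h' (s v)"
      unfolding sum_subtractf using h finite_half_edges[OF fin, of v] by simp
    finally have slotv: "(\<Sum>k \<in> half_edges_at \<Gamma> v. lookup (a v) (Half k) * face k (s v)) =
      face h (s v) - face h' (s v)" .
    have bd: "lookup (boundary \<Gamma> (tensor \<Gamma> a)) s =
      (if is_Half (s v) then 0 else koszul_sign \<Gamma> s v * ((face h (s v) - face h' (s v)) * cofactor \<Gamma> F s v))"
    proof -
      have "lookup (boundary \<Gamma> (tensor \<Gamma> a)) s =
       (\<Sum>u \<in> {u \<in> verts \<Gamma>. \<not> is_Half (s u)}. if u = v then koszul_sign \<Gamma> s v * ((face h (s v) - face h' (s v)) * cofactor \<Gamma> F s v) else 0)"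
        unfolding lookup_boundary_tensor[OF fin]
        by (intro sum.cong refl) (auto simp: slot slotv cof)
      then show ?thesis using v finV by simp
    qed
    show "lookup (boundary \<Gamma> (tensor \<Gamma> a)) s =
      lookup (act (sg * (edge_var (fst h) - edge_var (fst h'))) (torus_chain \<Gamma> W t)) s"
    proof (cases "s v = Empty")
      case True
      have sign: "koszul_sign \<Gamma> s v * cofactor \<Gamma> F s v = sg * cofactor \<Gamma> F s v"
      proof (cases "cofactor \<Gamma> F s v = 0")
        case False
        then have "(\<Prod>u\<in>verts \<Gamma> - {v}. lookup (F u) (s u)) \<noteq> 0"
          unfolding cofactor_def by (auto split: if_splits)
        from prod_factor_nonzero[OF this]
        have "lookup (F u) (s u) \<noteq> 0" if "u \<in> verts \<Gamma> - {v}" for u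
          using that finV by blast
        then have "if u \<in> W then is_Half (s u) else s u = Empty" if "u \<in> verts \<Gamma> - {v}" for u
          using F_supp that by blast
        then have "is_Half (s u) \<longleftrightarrow> u \<in> W" if "u \<in> verts \<Gamma>" "u < v" for u
          using that by (metis DiffI gen.disc(1) less_irrefl singletonD)
        then have "{u \<in> verts \<Gamma>. u < v \<and> is_Half (s u)} = {u \<in> verts \<Gamma>. u < v \<and> u \<in> W}"
          by blast
        then show ?thesis unfolding koszul_sign_def sg_def by simp
      qed simp
      have "slot_admissible \<Gamma> v (s v)" unfolding slot_admissible_def using True by simp
      then have "lookup (torus_chain \<Gamma> W t) s = cofactor \<Gamma> F s v"
        unfolding torus_chain_tensor F_def[symmetric] using lookup_tensor_slot[OF fin v(1), of s F] True v(2)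
        by (simp add: F_def torus_factor_def[of W t v])
      then have "lookup (act (sg * (edge_var (fst h) - edge_var (fst h'))) (torus_chain \<Gamma> W t)) s
         = (edge_var (fst h) - edge_var (fst h')) * (sg * cofactor \<Gamma> F s v)"
        unfolding lookup_act by (simp only: mult.assoc mult.left_commute)
      moreover have "koszul_sign \<Gamma> s v * ((face h (s v) - face h' (s v)) * cofactor \<Gamma> F s v) =
         (face h (s v) - face h' (s v)) * (koszul_sign \<Gamma> s v * cofactor \<Gamma> F s v)"
        by (rule mult.left_commute)
      ultimately show ?thesis unfolding bd sign using True by (simp add: face_def)
    next
      case False
      have "lookup (F v) (s v) = 0"
        using F_supp[of v "s v"] v(2) False by auto
      then have "lookup (torus_chain \<Gamma> W t :: ('v, 'e, 'f) chain) s = 0"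
        unfolding torus_chain_tensor F_def[symmetric] lookup_tensor[OF fin]
        using prod_factor_nonzero[OF _ finV v(1), of "\<lambda>v. lookup (F v) (s v)"] by auto
      moreover have "lookup (boundary \<Gamma> (tensor \<Gamma> a)) s = 0"
        unfolding bd using False by (cases "s v") (auto simp: face_def)
      ultimately show ?thesis by simp
    qed
  qed
  ultimately have bd: "act (sg * (edge_var (fst h) - edge_var (fst h'))) (torus_chain \<Gamma> W t) \<in> boundaries \<Gamma> (card W)"
    by simp
  \<comment> \<open>The sign is its own inverse, so multiplying the boundary by it once more removes
    it.\<close>
  have sgp: "sg \<in> edge_polys \<Gamma>" "sg * sg = 1"
    unfolding sg_def by (cases "even (card {u \<in> verts \<Gamma>. u < v \<and> u \<in> W})"; simp add: edge_polys_uminus)+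
  from boundaries_act[OF sgp(1) bd] show ?thesis using sgp(2) by (simp add: act_act flip: mult.assoc)
qed

subsection \<open>A functional detecting tori\<close>

text \<open>The colour of a vertex outside \<open>W\<close> is read from an arbitrary incident
  half-edge; compatibility of \<open>\<nu>\<close> makes the choice immaterial. A half-edge in a
  slot outside \<open>W\<close> is weighted like \<open>Empty\<close>, so states of every
  homological degree have a weight.\<close>

definition detect_weight :: "('v, 'e) cw_graph \<Rightarrow> 'v set \<Rightarrow> ('v \<Rightarrow> 'e \<times> bool) \<Rightarrow> ('e \<Rightarrow> nat) \<Rightarrow>
    ('v, 'e) state \<Rightarrow> (nat, 'f::comm_ring_1) edge_poly" where
  "detect_weight \<Gamma> W \<kappa> \<nu> s = (if \<forall>w\<in>W. s w = Half (\<kappa> w)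
     then \<Prod>u\<in>verts \<Gamma> - W. if s u = Vert then edge_var (\<nu> (fst (SOME h. h \<in> half_edges_at \<Gamma> u))) else 1
     else 0)"

definition detect :: "('v, 'e) cw_graph \<Rightarrow> 'v set \<Rightarrow> ('v \<Rightarrow> 'e \<times> bool) \<Rightarrow> ('e \<Rightarrow> nat) \<Rightarrow>
    ('v, 'e, 'f::comm_ring_1) chain \<Rightarrow> (nat, 'f) edge_poly" where
  "detect \<Gamma> W \<kappa> \<nu> c = (\<Sum>s\<in>keys c.
     rename \<nu> (lookup c s) * detect_weight \<Gamma> W \<kappa> \<nu> s)"

lemma detect_superset:
  assumes "finite A" "keys c \<subseteq> A"
  shows "detect \<Gamma> W \<kappa> \<nu> c = (\<Sum>s\<in>A. rename \<nu> (lookup c s) * detect_weight \<Gamma> W \<kappa> \<nu> s)"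
  unfolding detect_def
  by (rule sum_keys_superset[OF assms, of "\<lambda>s p. rename \<nu> p * detect_weight \<Gamma> W \<kappa> \<nu> s"]) simp

lemma detect_add: "detect \<Gamma> W \<kappa> \<nu> (c + d) = detect \<Gamma> W \<kappa> \<nu> c + detect \<Gamma> W \<kappa> \<nu> d"
  unfolding detect_def
  by (rule sum_keys_add[of "\<lambda>s p. rename \<nu> p * detect_weight \<Gamma> W \<kappa> \<nu> s"])
    (auto simp: rename_add algebra_simps)

lemma detect_0 [simp]: "detect \<Gamma> W \<kappa> \<nu> 0 = 0" by (simp add: detect_def)

lemma detect_uminus: "detect \<Gamma> W \<kappa> \<nu> (- c) = - detect \<Gamma> W \<kappa> \<nu> c"
  using detect_add[of \<Gamma> W \<kappa> \<nu> c "- c"] by (simp add: eq_neg_iff_add_eq_0 add.commute)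

lemma detect_diff: "detect \<Gamma> W \<kappa> \<nu> (c - d) = detect \<Gamma> W \<kappa> \<nu> c - detect \<Gamma> W \<kappa> \<nu> d"
  using detect_add[of \<Gamma> W \<kappa> \<nu> c "- d"] by (simp add: detect_uminus)

lemma detect_sum: "detect \<Gamma> W \<kappa> \<nu> (sum f A) = (\<Sum>x\<in>A. detect \<Gamma> W \<kappa> \<nu> (f x))"
  by (induction A rule: infinite_finite_induct) (auto simp: detect_add)

lemma detect_single:
  "detect \<Gamma> W \<kappa> \<nu> (single s p) = rename \<nu> p * detect_weight \<Gamma> W \<kappa> \<nu> s"
  by (cases "p = 0") (auto simp: detect_def)

lemma detect_act: "detect \<Gamma> W \<kappa> \<nu> (act p c) = rename \<nu> p * detect \<Gamma> W \<kappa> \<nu> c"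
  by (induction c rule: poly_mapping_single_induct)
    (auto simp: detect_single rename_mult detect_add act_add algebra_simps)

text \<open>This is the vanishing on \<open>e(h) - v(h)\<close>. For \<open>v\<close> in
  \<open>W\<close> both states lack the prescribed half-edge and have weight 0; otherwise the vertex
  contributes the variable of its colour, which is that of \<open>h\<close>.\<close>

lemma detect_weight_move:
  assumes fin: "finite_graph \<Gamma>" and \<nu>: "cut_compatible \<Gamma> W \<nu>" and v: "v \<in> verts \<Gamma>" and h: "h \<in> half_edges_at \<Gamma> v"
  shows "edge_var (\<nu> (fst h)) * detect_weight \<Gamma> W \<kappa> \<nu> (s(v := Empty)) =
    (detect_weight \<Gamma> W \<kappa> \<nu> (s(v := Vert)) :: (nat, 'f::comm_ring_1) edge_poly)"
proof (cases "v \<in> W")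
  case True
  then show ?thesis unfolding detect_weight_def by auto
next
  case False
  have finV: "finite (verts \<Gamma> - W)" using fin unfolding finite_graph_def by auto
  have vm: "v \<in> verts \<Gamma> - W" using v False by auto
  define k where "k = (SOME h. h \<in> half_edges_at \<Gamma> v)"
  have "k \<in> half_edges_at \<Gamma> v" unfolding k_def using h by (rule someI)
  then have col: "\<nu> (fst k) = \<nu> (fst h)"
    using cut_compatibleD[OF \<nu>, of k h] h False unfolding half_edges_at_def by auto
  have same: "(\<forall>w\<in>W. (s(v := g)) w = Half (\<kappa> w)) \<longleftrightarrow> (\<forall>w\<in>W. s w = Half (\<kappa> w))" for g
    using False by auto
  define G :: "_ \<Rightarrow> _ \<Rightarrow> (nat, 'f) edge_poly" where "G g u = (if (s(v := g)) u = Vert then edge_var (\<nu> (fst (SOME h. h \<in> half_edges_at \<Gamma> u))) else 1)" for g u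
  have "(\<Prod>u\<in>verts \<Gamma> - W. G g u) = G g v * (\<Prod>u\<in>verts \<Gamma> - W - {v}. G g u)" for g
    by (rule prod.remove[OF finV vm])
  moreover have "(\<Prod>u\<in>verts \<Gamma> - W - {v}. G Empty u) = (\<Prod>u\<in>verts \<Gamma> - W - {v}. G Vert u)"
    by (intro prod.cong) (auto simp: G_def)
  moreover have "G Empty v = 1" "G Vert v = edge_var (\<nu> (fst h))"
    unfolding G_def k_def[symmetric] by (simp_all add: col)
  ultimately have "edge_var (\<nu> (fst h)) * (\<Prod>u\<in>verts \<Gamma> - W. G Empty u) = (\<Prod>u\<in>verts \<Gamma> - W. G Vert u)"
    by simp
  then show ?thesis unfolding detect_weight_def same G_def by simp
qed

text \<open>The two faces of every half-edge cancel by \<open>detect_weight_move\<close>.\<close>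

lemma detect_boundary:
  fixes c :: "('v::linorder, 'e, 'f::comm_ring_1) chain"
  assumes fin: "finite_graph \<Gamma>" and \<nu>: "cut_compatible \<Gamma> W \<nu>" and c: "keys c \<subseteq> states \<Gamma>"
  shows "detect \<Gamma> W \<kappa> \<nu> (boundary \<Gamma> c) = 0"
proof -
  have "detect \<Gamma> W \<kappa> \<nu> (boundary_state \<Gamma> s :: ('v, 'e, 'f) chain) = 0" if s: "s \<in> states \<Gamma>" for s
    unfolding boundary_state_def detect_sum
  proof (intro sum.neutral ballI)
    fix v assume v: "v \<in> {v \<in> verts \<Gamma>. is_Half (s v)}"
    then have "s v \<in> Half ` half_edges_at \<Gamma> v" using s unfolding states_def by auto
    then have h: "the_half (s v) \<in> half_edges_at \<Gamma> v" by auto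
    show "detect \<Gamma> W \<kappa> \<nu> (act ((- 1) ^ card {u \<in> verts \<Gamma>. u < v \<and> is_Half (s u)})
         (single (s(v := Empty)) (edge_var (fst (the_half (s v)))) - single (s(v := Vert)) 1)) = 0"
      using v by (simp add: detect_act detect_diff detect_single rename_var detect_weight_move[OF fin \<nu> _ h])
  qed
  then show ?thesis
    unfolding boundary_def detect_sum detect_act using c by (intro sum.neutral) auto
qed

text \<open>At a vertex of \<open>W\<close> outside \<open>W'\<close> the torus has an empty slot,
  while the functional demands a half-edge.\<close>

lemma detect_torus_other:
  fixes \<Gamma> :: "('v, 'e) cw_graph"
  assumes fin: "finite_graph \<Gamma>" and W: "W \<subseteq> verts \<Gamma>" "\<not> W \<subseteq> W'"
  shows "detect \<Gamma> W \<kappa> \<nu> (torus_chain \<Gamma> W' t :: ('v, 'e, 'f::comm_ring_1) chain) = 0"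
proof -
  obtain w where w: "w \<in> W" "w \<notin> W'" "w \<in> verts \<Gamma>" using W by auto
  note finV = finite_verts[OF fin]
  have "rename \<nu> (lookup (torus_chain \<Gamma> W' t :: ('v, 'e, 'f) chain) s) * detect_weight \<Gamma> W \<kappa> \<nu> s = 0" for s
  proof (cases "s w = Half (\<kappa> w)")
    case True
    then have "lookup (torus_factor W' t w :: 'e gen \<Rightarrow>\<^sub>0 ('e, 'f) edge_poly) (s w) = 0"
      using w(2) by (simp add: torus_factor_def lookup_single)
    then have "lookup (torus_chain \<Gamma> W' t :: ('v, 'e, 'f) chain) s = 0"
      unfolding torus_chain_tensor lookup_tensor[OF fin]
      using prod_factor_nonzero[OF _ finV w(3), of "\<lambda>v. lookup (torus_factor W' t v) (s v)"] by auto
    then show ?thesis by simp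
  next
    case False
    then have "detect_weight \<Gamma> W \<kappa> \<nu> s = (0 :: (nat, 'f) edge_poly)" unfolding detect_weight_def using w by auto
    then show ?thesis by simp
  qed
  then show ?thesis unfolding detect_def by simp
qed

text \<open>A single state survives: the functional prescribes the half-edges on \<open>W\<close>,
  and the torus forces \<open>Empty\<close> elsewhere.\<close>

lemma detect_torus:
  fixes \<Gamma> :: "('v, 'e) cw_graph"
  assumes fin: "finite_graph \<Gamma>" and W: "W \<subseteq> verts \<Gamma>" and \<kappa>: "\<And>w. w \<in> W \<Longrightarrow> \<kappa> w \<in> half_edges_at \<Gamma> w"
  shows "detect \<Gamma> W \<kappa> \<nu> (torus_chain \<Gamma> W t :: ('v, 'e, 'f::comm_ring_1) chain) =
     (\<Prod>w\<in>W. rename \<nu> (lookup (torus_factor W t w) (Half (\<kappa> w))))"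
proof -
  define s0 where "s0 v = (if v \<in> W then Half (\<kappa> v) else Empty)" for v
  note finV = finite_verts[OF fin]
  have s0: "s0 \<in> states \<Gamma>" unfolding states_def s0_def using \<kappa> W by auto
  have other: "rename \<nu> (lookup (torus_chain \<Gamma> W t :: ('v, 'e, 'f) chain) s) * detect_weight \<Gamma> W \<kappa> \<nu> s = 0"
    if s: "s \<in> states \<Gamma>" "s \<noteq> s0" for s
  proof (rule ccontr)
    assume nz: "\<not> ?thesis"
    then have "detect_weight \<Gamma> W \<kappa> \<nu> s \<noteq> (0 :: (nat, 'f) edge_poly)" by auto
    then have onW: "\<forall>w\<in>W. s w = Half (\<kappa> w)" unfolding detect_weight_def by (auto split: if_splits)
    have "lookup (torus_chain \<Gamma> W t :: ('v, 'e, 'f) chain) s \<noteq> 0" using nz by auto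
    then have p: "(\<Prod>v\<in>verts \<Gamma>. lookup (torus_factor W t v :: 'e gen \<Rightarrow>\<^sub>0 ('e, 'f) edge_poly) (s v)) \<noteq> 0"
      unfolding torus_chain_tensor lookup_tensor[OF fin] by (auto split: if_splits)
    have "s v = s0 v" for v
    proof (cases "v \<in> W")
      case True
      then show ?thesis using onW by (simp add: s0_def)
    next
      case False
      show ?thesis
      proof (cases "v \<in> verts \<Gamma>")
        case True
        from torus_factor_support[OF prod_factor_nonzero[OF p finV True]]
        show ?thesis using False by (simp add: s0_def)
      next
        case out: False
        then show ?thesis using s(1) False unfolding states_def by (simp add: s0_def)
      qed
    qed
    then show False using s(2) by auto
  qed
  have "detect \<Gamma> W \<kappa> \<nu> (torus_chain \<Gamma> W t :: ('v, 'e, 'f) chain) =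
     (\<Sum>s\<in>states \<Gamma>. rename \<nu> (lookup (torus_chain \<Gamma> W t :: ('v, 'e, 'f) chain) s) * detect_weight \<Gamma> W \<kappa> \<nu> s)"
    by (rule detect_superset[OF finite_states[OF fin] torus_keys[OF fin]])
  also have "\<dots> = (\<Sum>s\<in>{s0}. rename \<nu> (lookup (torus_chain \<Gamma> W t :: ('v, 'e, 'f) chain) s) * detect_weight \<Gamma> W \<kappa> \<nu> s)"
    using s0 other finite_states[OF fin] by (intro sum.mono_neutral_right) auto
  also have "\<dots> = rename \<nu> (\<Prod>v\<in>verts \<Gamma>. lookup (torus_factor W t v) (s0 v)) * detect_weight \<Gamma> W \<kappa> \<nu> s0"
    unfolding torus_chain_tensor lookup_tensor[OF fin] using s0 by simp
  also have "detect_weight \<Gamma> W \<kappa> \<nu> s0 = (1 :: (nat, 'f) edge_poly)"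
    unfolding detect_weight_def by (auto simp: s0_def intro!: prod.neutral)
  also have "(\<Prod>v\<in>verts \<Gamma>. lookup (torus_factor W t v) (s0 v)) =
     (\<Prod>w\<in>W. lookup (torus_factor W t w :: 'e gen \<Rightarrow>\<^sub>0 ('e, 'f) edge_poly) (Half (\<kappa> w)))"
    using W finV by (intro prod.mono_neutral_cong_right) (auto simp: s0_def torus_factor_def)
  finally show ?thesis by (simp add: rename_prod)
qed

subsection \<open>The module of tori\<close>

lemma hclass_eq_iff: "hclass \<Gamma> i z = hclass \<Gamma> i z' \<longleftrightarrow> z - z' \<in> boundaries \<Gamma> i"
proof
  assume "hclass \<Gamma> i z = hclass \<Gamma> i z'"
  moreover have "z \<in> hclass \<Gamma> i z"
    unfolding hclass_def by (auto intro!: exI[of _ 0])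
  ultimately show "z - z' \<in> boundaries \<Gamma> i" unfolding hclass_def by auto
next
  assume d: "z - z' \<in> boundaries \<Gamma> i"
  have neg: "- b \<in> boundaries \<Gamma> i" if "b \<in> boundaries \<Gamma> i" for b :: "('a, 'b, 'c) chain"
  proof -
    have "act (- 1) b \<in> boundaries \<Gamma> i"
      by (rule boundaries_act[OF edge_polys_uminus[OF edge_polys_1] that])
    moreover have "act (- 1) b = - b" by (rule poly_mapping_eqI) simp
    ultimately show ?thesis by simp
  qed
  show "hclass \<Gamma> i z = hclass \<Gamma> i z'"
  proof (intro set_eqI iffI)
    fix x assume "x \<in> hclass \<Gamma> i z"
    then obtain b where b: "b \<in> boundaries \<Gamma> i" "x = z + b" unfolding hclass_def by auto
    then have "x = z' + ((z - z') + b)" by simp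
    then show "x \<in> hclass \<Gamma> i z'" unfolding hclass_def using boundaries_add[OF d b(1)] by blast
  next
    fix x assume "x \<in> hclass \<Gamma> i z'"
    then obtain b where b: "b \<in> boundaries \<Gamma> i" "x = z' + b" unfolding hclass_def by auto
    then have "x = z + (- (z - z') + b)" by simp
    then show "x \<in> hclass \<Gamma> i z" unfolding hclass_def using boundaries_add[OF neg[OF d] b(1)] by blast
  qed
qed

lemma class_add_hclass: "class_add (hclass \<Gamma> i z) (hclass \<Gamma> i z') = hclass \<Gamma> i (z + z')"
proof (intro set_eqI iffI)
  fix x assume "x \<in> class_add (hclass \<Gamma> i z) (hclass \<Gamma> i z')"
  then obtain b b' where b: "b \<in> boundaries \<Gamma> i" "b' \<in> boundaries \<Gamma> i" "x = (z + b) + (z' + b')"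
    unfolding class_add_def hclass_def by blast
  then have "x = (z + z') + (b + b')" by (simp add: algebra_simps)
  then show "x \<in> hclass \<Gamma> i (z + z')" unfolding hclass_def using boundaries_add b by blast
next
  fix x assume "x \<in> hclass \<Gamma> i (z + z')"
  then obtain b where "b \<in> boundaries \<Gamma> i" "x = (z + b) + (z' + 0)" unfolding hclass_def by (auto simp: algebra_simps)
  then show "x \<in> class_add (hclass \<Gamma> i z) (hclass \<Gamma> i z')"
    unfolding class_add_def hclass_def using boundaries_0 by blast
qed

lemma class_act_hclass:
  assumes "p \<in> edge_polys \<Gamma>"
  shows "class_act \<Gamma> i p (hclass \<Gamma> i z) = hclass \<Gamma> i (act p z)"
proof (intro set_eqI iffI)
  fix x assume "x \<in> class_act \<Gamma> i p (hclass \<Gamma> i z)"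
  then obtain b b' where b: "b \<in> boundaries \<Gamma> i" "b' \<in> boundaries \<Gamma> i" "x = act p (z + b) + b'"
    unfolding class_act_def hclass_def by blast
  then have "x = act p z + (act p b + b')" by (simp add: act_add algebra_simps)
  then show "x \<in> hclass \<Gamma> i (act p z)"
    unfolding hclass_def using boundaries_add[OF boundaries_act[OF assms b(1)] b(2)] by blast
next
  fix x assume "x \<in> hclass \<Gamma> i (act p z)"
  then obtain b where "b \<in> boundaries \<Gamma> i" "x = act p (z + 0) + b" unfolding hclass_def by auto
  then show "x \<in> class_act \<Gamma> i p (hclass \<Gamma> i z)"
    unfolding class_act_def hclass_def using boundaries_0 by blast
qed

text \<open>A spanning set over the field instead of over the ring: the ring action is absorbed into
  monomials, and the condition on the length fixes the number of particles.\<close>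

definition torus_gens :: "('v::linorder, 'e) cw_graph \<Rightarrow> nat \<Rightarrow> nat \<Rightarrow> ('v, 'e, 'f::comm_ring_1) chain set" where
  "torus_gens \<Gamma> i k = {act (edge_monom es) (torus_chain \<Gamma> W t) | es W t.
     set es \<subseteq> edges \<Gamma> \<and> W \<in> essential_sets \<Gamma> i \<and> star_choice \<Gamma> W t \<and> length es + 2 * i = k}"

lemma essential_setsD: "W \<in> essential_sets \<Gamma> i \<Longrightarrow> W \<subseteq> verts \<Gamma> \<and> card W = i"
  unfolding essential_sets_def essential_def by auto

lemma edge_monom_append: "edge_monom (es @ fs) = edge_monom es * edge_monom fs"
  by (simp add: edge_monom_def)

lemma smul_act: "act p (smul a c) = smul a (act p c)"
  by (simp add: smul_def act_act mult.commute)

text \<open>A polynomial is a linear combination of monomials, and a monomial times a generator is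
  again a generator.\<close>

lemma act_torus_span:
  fixes \<Gamma> :: "('v::linorder, 'e) cw_graph"
  assumes p: "p \<in> edge_polys \<Gamma>" and z: "z \<in> chain_vs.span (\<Union>k. torus_gens \<Gamma> i k)"
  shows "act p z \<in> (chain_vs.span (\<Union>k. torus_gens \<Gamma> i k) :: ('v, 'e, 'f::field) chain set)" (is "_ \<in> ?S")
proof -
  have mono: "act (edge_monom fs) x \<in> ?S" if fs: "set fs \<subseteq> edges \<Gamma>" and x: "x \<in> (\<Union>k. torus_gens \<Gamma> i k)" for fs and x :: "('v, 'e, 'f) chain"
  proof -
    obtain es W t where "x = act (edge_monom es) (torus_chain \<Gamma> W t)" "set es \<subseteq> edges \<Gamma>"
      "W \<in> essential_sets \<Gamma> i" "star_choice \<Gamma> W t"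
      using x unfolding torus_gens_def by auto
    then have "act (edge_monom fs) x \<in> torus_gens \<Gamma> i (length (fs @ es) + 2 * i)"
      unfolding torus_gens_def using fs
      by (intro CollectI exI[of _ "fs @ es"] exI[of _ W] exI[of _ t]) (simp add: act_act edge_monom_append)
    then show ?thesis by (intro chain_vs.span_base) blast
  qed
  have "chain_vs.subspace {z. act p z \<in> ?S}"
    by (auto simp: chain_vs.subspace_def act_add smul_act chain_vs.span_zero chain_vs.span_add chain_vs.span_scale)
  moreover have "(\<Union>k. torus_gens \<Gamma> i k) \<subseteq> {z. act p z \<in> ?S}"
  proof
    fix x :: "('v, 'e, 'f) chain" assume x: "x \<in> (\<Union>k. torus_gens \<Gamma> i k)"
    obtain es where es: "\<forall>m. m \<in> keys p \<longrightarrow> set (es m) \<subseteq> edges \<Gamma>"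
      "p = (\<Sum>m\<in>keys p. const_poly (lookup p m) * edge_monom (es m))"
      using edge_poly_eq_sum_edge_monom[OF p] by blast
    have "act p x = (\<Sum>m\<in>keys p. smul (lookup p m) (act (edge_monom (es m)) x))"
      by (subst es(2)) (simp add: act_sum_left smul_def act_act)
    also have "\<dots> \<in> ?S"
      using es(1) x by (intro chain_vs.span_sum chain_vs.span_scale mono) auto
    finally show "x \<in> {z. act p z \<in> ?S}" by simp
  qed
  ultimately show ?thesis using z chain_vs.span_minimal by blast
qed

lemma torus_module_span:
  fixes \<Gamma> :: "('v::linorder, 'e) cw_graph" and X :: "('v, 'e, 'f::field) chain set"
  assumes "X \<in> torus_module \<Gamma> i"
  shows "\<exists>z \<in> chain_vs.span (\<Union>k. torus_gens \<Gamma> i k). X = hclass \<Gamma> i z"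
  using assms
proof induction
  case (torus W t)
  have "act (edge_monom []) (torus_chain \<Gamma> W t) \<in> (torus_gens \<Gamma> i (length [] + 2 * i) :: ('v, 'e, 'f) chain set)"
    unfolding torus_gens_def using torus by (intro CollectI exI[of _ "[]"] exI[of _ W] exI[of _ t]) simp
  then have "torus_chain \<Gamma> W t \<in> (\<Union>k. torus_gens \<Gamma> i k :: ('v, 'e, 'f) chain set)" by auto
  then show ?case by (intro bexI[of _ "torus_chain \<Gamma> W t"] chain_vs.span_base refl)
next
  case zero
  show ?case by (intro bexI[of _ 0] chain_vs.span_zero refl)
next
  case (add X Y)
  then obtain z z' where "z \<in> chain_vs.span (\<Union>k. torus_gens \<Gamma> i k)" "z' \<in> chain_vs.span (\<Union>k. torus_gens \<Gamma> i k)"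
    "X = hclass \<Gamma> i z" "Y = hclass \<Gamma> i z'" by blast
  then show ?case by (intro bexI[of _ "z + z'"]) (simp_all add: class_add_hclass chain_vs.span_add)
next
  case (act p X)
  then obtain z where "z \<in> chain_vs.span (\<Union>k. torus_gens \<Gamma> i k)" "X = hclass \<Gamma> i z" by blast
  then show ?case using act by (intro bexI[of _ "act p z"]) (simp_all add: class_act_hclass act_torus_span)
qed

lemma hpart_const: "hpart a k (const_poly x * p) = const_poly x * hpart a k p"
proof (induction p rule: poly_mapping_single_induct)
  case (single m y)
  show ?case by (simp add: const_poly_def mult_single hpart_single)
qed (simp add: algebra_simps hpart_add)

lemma particle_part_smul: "particle_part \<Gamma> k (smul a c) = smul a (particle_part \<Gamma> k c)"
  by (rule poly_mapping_eqI) (simp add: lookup_particle_part smul_def hpart_const)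

lemma torus_gens_has_particles:
  assumes "finite_graph \<Gamma>" "x \<in> torus_gens \<Gamma> i k"
  shows "has_particles \<Gamma> k x"
proof -
  obtain es W t where x: "x = act (edge_monom es) (torus_chain \<Gamma> W t)" "W \<in> essential_sets \<Gamma> i"
    "length es + 2 * i = k"
    using assms(2) unfolding torus_gens_def by blast
  show ?thesis
    unfolding x(1) x(3)[symmetric]
    using torus_has_particles[OF assms(1) _ homog_edge_monom, of W es t] essential_setsD[OF x(2)] by simp
qed

text \<open>Every generator is homogeneous, so the projection keeps those with \<open>k\<close>
  particles and kills the others.\<close>

lemma particle_part_torus_span:
  fixes \<Gamma> :: "('v::linorder, 'e) cw_graph"
  assumes fin: "finite_graph \<Gamma>" and z: "z \<in> chain_vs.span (\<Union>k. torus_gens \<Gamma> i k)"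
  shows "particle_part \<Gamma> k z \<in> (chain_vs.span (torus_gens \<Gamma> i k) :: ('v, 'e, 'f::field) chain set)" (is "_ \<in> ?S")
proof -
  have "chain_vs.subspace {z. particle_part \<Gamma> k z \<in> ?S}"
    by (auto simp: chain_vs.subspace_def particle_part_add particle_part_smul chain_vs.span_zero chain_vs.span_add chain_vs.span_scale)
  moreover have "(\<Union>k. torus_gens \<Gamma> i k) \<subseteq> {z. particle_part \<Gamma> k z \<in> ?S}"
  proof
    fix x :: "('v, 'e, 'f) chain" assume "x \<in> (\<Union>k. torus_gens \<Gamma> i k)"
    then obtain j where j: "x \<in> torus_gens \<Gamma> i j" by blast
    note hp = torus_gens_has_particles[OF fin j]
    show "x \<in> {z. particle_part \<Gamma> k z \<in> ?S}"
    proof (cases "j = k")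
      case True
      then show ?thesis using particle_part_id[OF hp] j by (simp add: chain_vs.span_base)
    next
      case False
      then show ?thesis using particle_part_other[OF hp] by (simp add: chain_vs.span_zero)
    qed
  qed
  ultimately show ?thesis using z chain_vs.span_minimal by blast
qed

text \<open>A class of the module that has a \<open>k\<close>-particle representative need not be
  given by a homogeneous combination of tori. Projecting the combination with
  \<open>particle_part\<close> repairs this: the representative is unchanged and boundaries go to
  boundaries.\<close>

lemma torus_part_eq:
  fixes \<Gamma> :: "('v::linorder, 'e) cw_graph"
  assumes fin: "finite_graph \<Gamma>"
  shows "torus_part \<Gamma> i k = hclass \<Gamma> i ` (chain_vs.span (torus_gens \<Gamma> i k) :: ('v, 'e, 'f::field) chain set)"
    (is "_ = hclass \<Gamma> i ` ?S")
proof (intro equalityI subsetI)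
  fix X :: "('v, 'e, 'f) chain set" assume "X \<in> torus_part \<Gamma> i k"
  then have X: "X \<in> torus_module \<Gamma> i" "X \<in> homology_part \<Gamma> i k" unfolding torus_part_def by auto
  obtain z where z: "z \<in> chain_vs.span (\<Union>k. torus_gens \<Gamma> i k)" "X = hclass \<Gamma> i z"
    using torus_module_span[OF X(1)] by blast
  obtain z' where z': "has_particles \<Gamma> k z'" "X = hclass \<Gamma> i z'"
    using X(2) unfolding homology_part_def by auto
  have "z - z' \<in> boundaries \<Gamma> i" using z z' hclass_eq_iff by metis
  then have "particle_part \<Gamma> k z - z' \<in> boundaries \<Gamma> i"
    using particle_part_boundaries[OF fin, of "z - z'" i k] particle_part_id[OF z'(1)] by (simp add: particle_part_diff)
  then have "X = hclass \<Gamma> i (particle_part \<Gamma> k z)" using z'(2) hclass_eq_iff by metis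
  then show "X \<in> hclass \<Gamma> i ` ?S" using particle_part_torus_span[OF fin z(1)] by blast
next
  fix X :: "('v, 'e, 'f) chain set" assume "X \<in> hclass \<Gamma> i ` ?S"
  then obtain z where z: "z \<in> ?S" "X = hclass \<Gamma> i z" by auto
  \<comment> \<open>All that \<open>torus_part\<close> demands is collected in one subspace, so that
    it has to be checked on generators only.\<close>
  define U where "U = {z :: ('v, 'e, 'f) chain. hclass \<Gamma> i z \<in> torus_module \<Gamma> i \<and> z \<in> chains \<Gamma> i \<and>
    boundary \<Gamma> z = 0 \<and> particle_part \<Gamma> k z = z}"
  have sub: "chain_vs.subspace U"
    unfolding U_def chain_vs.subspace_def
  proof (safe, goal_cases)
    case 1 then show ?case by (rule torus_module.zero)
  next
    case (5 x y) then show ?case using torus_module.add by (metis class_add_hclass)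
  next
    case (9 c x)
    then show ?case unfolding smul_def using torus_module.act[OF edge_polys_const]
      by (metis class_act_hclass edge_polys_const)
  qed (simp_all add: chains_add boundary_add particle_part_add smul_def[symmetric] particle_part_smul,
      simp_all add: smul_def chains_act boundary_act)
  have "torus_gens \<Gamma> i k \<subseteq> U"
  proof
    fix x :: "('v, 'e, 'f) chain" assume x: "x \<in> torus_gens \<Gamma> i k"
    then obtain es W t where e: "x = act (edge_monom es) (torus_chain \<Gamma> W t)" "set es \<subseteq> edges \<Gamma>"
      "W \<in> essential_sets \<Gamma> i" "star_choice \<Gamma> W t"
      unfolding torus_gens_def by blast
    note W = essential_setsD[OF e(3)]
    have "hclass \<Gamma> i x \<in> torus_module \<Gamma> i"
      unfolding e(1) class_act_hclass[OF edge_monom_edge_polys[OF e(2)], symmetric]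
      by (intro torus_module.act torus_module.torus edge_monom_edge_polys e)
    moreover have "x \<in> chains \<Gamma> i"
      unfolding e(1) using torus_chains[OF fin _ e(4)] W
      by (intro chains_act edge_monom_edge_polys e) auto
    moreover have "boundary \<Gamma> x = 0"
      unfolding e(1) by (simp add: boundary_act boundary_torus[OF fin e(4)])
    ultimately show "x \<in> U"
      unfolding U_def using particle_part_id[OF torus_gens_has_particles[OF fin x]] by simp
  qed
  then have "z \<in> U" using chain_vs.span_minimal[OF _ sub] z(1) by blast
  then have "z \<in> cycles \<Gamma> i" "has_particles \<Gamma> k z" "X \<in> torus_module \<Gamma> i"
    unfolding U_def cycles_def using z(2) has_particles_particle_part[of \<Gamma> k z] by auto
  then show "X \<in> torus_part \<Gamma> i k"
    unfolding torus_part_def homology_part_def using z(2) by blast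
qed

subsection \<open>Reduction to normal forms\<close>

text \<open>The edges whose difference with \<open>e'\<close> kills the torus class form a set that
  is constant across vertices outside \<open>W\<close>, by
  \<open>half_edge_difference_boundary\<close> and transitivity. The universal property of the
  numbering spreads this over the whole component.\<close>

lemma same_component_boundary:
  fixes \<Gamma> :: "('v::linorder, 'e) cw_graph"
  assumes fin: "finite_graph \<Gamma>" and W: "W \<in> essential_sets \<Gamma> i" and t: "star_choice \<Gamma> W t"
    and \<nu>: "component_numbering \<Gamma> W \<nu>" and e: "e \<in> edges \<Gamma>" "e' \<in> edges \<Gamma>" "\<nu> e = \<nu> e'"
  shows "act (edge_var e - edge_var e') (torus_chain \<Gamma> W t) \<in> (boundaries \<Gamma> i :: ('v, 'e, 'f::comm_ring_1) chain set)"
proof -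
  let ?B = "boundaries \<Gamma> i :: ('v, 'e, 'f) chain set"
  let ?d = "\<lambda>x y. act (edge_var x - edge_var y) (torus_chain \<Gamma> W t) :: ('v, 'e, 'f) chain"
  note WV = essential_setsD[OF W]
  have step: "?d (fst h) (fst h') \<in> ?B"
    if "h \<in> edges \<Gamma> \<times> UNIV" "h' \<in> edges \<Gamma> \<times> UNIV" "att \<Gamma> h = att \<Gamma> h'" "att \<Gamma> h \<notin> W" for h h'
  proof -
    have "att \<Gamma> h \<in> verts \<Gamma>" using fin that(1) unfolding finite_graph_def by blast
    from half_edge_difference_boundary[OF fin _ t this that(4), of h h']
    show ?thesis using WV that unfolding half_edges_at_def by auto
  qed
  have trans: "?d x z \<in> ?B" if "?d x y \<in> ?B" "?d y z \<in> ?B" for x y z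
  proof -
    have "?d x z = ?d x y + ?d y z" by (simp add: act_diff_left)
    then show ?thesis using boundaries_add[OF that] by simp
  qed
  have "cut_compatible \<Gamma> W (\<lambda>x. ?d x e' \<in> ?B)"
    unfolding cut_compatible_def
  proof (intro ballI impI iffI)
    fix h h' assume h: "h \<in> edges \<Gamma> \<times> UNIV" "h' \<in> edges \<Gamma> \<times> UNIV"
      "att \<Gamma> h = att \<Gamma> h'" "att \<Gamma> h \<notin> W"
    show "?d (fst h') e' \<in> ?B" if "?d (fst h) e' \<in> ?B"
      using trans[OF step[OF h(2,1)] that] h by simp
    show "?d (fst h) e' \<in> ?B" if "?d (fst h') e' \<in> ?B"
      by (rule trans[OF step[OF h] that])
  qed
  then have "(?d e e' \<in> ?B) = (?d e' e' \<in> ?B)"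
    by (rule component_numbering_factor[OF \<nu> _ e])
  then show ?thesis by simp
qed

text \<open>A monomial in the component variables with exponents \<open>f\<close>, lifted to edges
  through a representative \<open>r j\<close> of the component \<open>j\<close>.\<close>

definition rep_monom :: "nat \<Rightarrow> (nat \<Rightarrow> 'e) \<Rightarrow> (nat \<Rightarrow> nat) \<Rightarrow> ('e, 'f::comm_ring_1) edge_poly" where
  "rep_monom n r f = (\<Prod>j<n. edge_var (r j) ^ f j)"

definition colour_count :: "('e \<Rightarrow> nat) \<Rightarrow> 'e list \<Rightarrow> nat \<Rightarrow> nat" where
  "colour_count \<nu> es j = length (filter (\<lambda>e. \<nu> e = j) es)"

lemma colour_count_simps [simp]:
  "colour_count \<nu> [] j = 0"
  "colour_count \<nu> (e # es) j = (if \<nu> e = j then Suc (colour_count \<nu> es j) else colour_count \<nu> es j)"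
  by (simp_all add: colour_count_def)

lemma colour_count_remove1:
  "e \<in> set es \<Longrightarrow> colour_count \<nu> es j = (if \<nu> e = j then Suc (colour_count \<nu> (remove1 e es) j) else colour_count \<nu> (remove1 e es) j)"
  by (induction es) auto

lemma sum_colour_count: "(\<And>e. e \<in> set es \<Longrightarrow> \<nu> e < n) \<Longrightarrow> (\<Sum>j<n. colour_count \<nu> es j) = length es"
proof (induction es)
  case (Cons e es)
  have "(\<Sum>j<n. colour_count \<nu> (e # es) j) = (\<Sum>j<n. colour_count \<nu> es j + (if \<nu> e = j then 1 else 0))"
    by (intro sum.cong) auto
  then show ?case using Cons by (simp add: sum.distrib)
qed simp

lemma rep_monom_edge_polys: "(\<And>j. j < n \<Longrightarrow> r j \<in> edges \<Gamma>) \<Longrightarrow> rep_monom n r f \<in> edge_polys \<Gamma>"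
proof -
  assume r: "\<And>j. j < n \<Longrightarrow> r j \<in> edges \<Gamma>"
  have "edge_var (r j) ^ k \<in> edge_polys \<Gamma>" if "j < n" for j k
    by (induction k) (use r[OF that] in \<open>auto intro: edge_polys_mult edge_polys_var\<close>)
  then show ?thesis unfolding rep_monom_def by (intro edge_polys_prod) auto
qed

lemma rep_monom_Cons:
  assumes "\<nu> e < n"
  shows "rep_monom n r (colour_count \<nu> (e # es)) = edge_var (r (\<nu> e)) * rep_monom n r (colour_count \<nu> es)"
proof -
  have "rep_monom n r (colour_count \<nu> (e # es)) =
     (\<Prod>j<n. edge_var (r j) ^ colour_count \<nu> es j * (if j = \<nu> e then edge_var (r j) else 1))"
    unfolding rep_monom_def by (intro prod.cong) auto
  then show ?thesis using assms unfolding rep_monom_def by (simp add: prod.distrib mult.commute)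
qed

text \<open>Edges are replaced by representatives one at a time; each replacement changes the chain
  by a multiple of a boundary.\<close>

lemma edge_monom_to_rep_monom:
  fixes \<Gamma> :: "('v::linorder, 'e) cw_graph"
  assumes fin: "finite_graph \<Gamma>" and W: "W \<in> essential_sets \<Gamma> i" and t: "star_choice \<Gamma> W t"
    and \<nu>: "component_numbering \<Gamma> W \<nu>" and n: "\<And>e. e \<in> edges \<Gamma> \<Longrightarrow> \<nu> e < n"
    and r: "\<And>j. j < n \<Longrightarrow> r j \<in> edges \<Gamma> \<and> \<nu> (r j) = j"
    and es: "set es \<subseteq> edges \<Gamma>"
  shows "act (edge_monom es) (torus_chain \<Gamma> W t) - act (rep_monom n r (colour_count \<nu> es)) (torus_chain \<Gamma> W t)
    \<in> (boundaries \<Gamma> i :: ('v, 'e, 'f::comm_ring_1) chain set)"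
  using es
proof (induction es)
  case Nil
  then show ?case by (simp add: rep_monom_def)
next
  case (Cons e es)
  let ?\<tau> = "torus_chain \<Gamma> W t :: ('v, 'e, 'f) chain"
  let ?R = "rep_monom n r (colour_count \<nu> es) :: ('e, 'f) edge_poly"
  have e: "e \<in> edges \<Gamma>" "\<nu> e < n" using Cons n by auto
  have 1: "act (edge_var e) (act (edge_monom es) ?\<tau> - act ?R ?\<tau>) \<in> boundaries \<Gamma> i"
    using Cons by (intro boundaries_act edge_polys_var) auto
  have e2: "act (edge_var e - edge_var (r (\<nu> e))) ?\<tau> \<in> boundaries \<Gamma> i"
    by (rule same_component_boundary[OF fin W t \<nu>]) (use e r in auto)
  have 2: "act ?R (act (edge_var e - edge_var (r (\<nu> e))) ?\<tau>) \<in> boundaries \<Gamma> i"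
    by (rule boundaries_act[OF rep_monom_edge_polys e2]) (use r in auto)
  have "act (edge_monom (e # es)) ?\<tau> - act (rep_monom n r (colour_count \<nu> (e # es))) ?\<tau> =
     act (edge_var e) (act (edge_monom es) ?\<tau> - act ?R ?\<tau>) + act ?R (act (edge_var e - edge_var (r (\<nu> e))) ?\<tau>)"
    unfolding rep_monom_Cons[where \<nu> = \<nu> and e = e and n = n, OF e(2)] edge_monom_Cons
    by (rule poly_mapping_eqI) (simp add: lookup_minus lookup_add algebra_simps)
  then show ?case using boundaries_add[OF 1 2] by (simp only:)
qed

text \<open>The outer induction is on the number of vertices of \<open>W\<close> whose triple does
  not begin with \<open>a w\<close>, \<open>b w\<close>; the inner one, at such a \<open>w\<close>,
  on the number of edges of the monomial in the component of \<open>b w\<close>. One of these edges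
  is traded for that of \<open>a w\<close> by the exchange relation, whose right-hand side is
  normalised at \<open>w\<close> and falls under the outer hypothesis. The process stops at the
  monomials covered by \<open>miss\<close>. An arbitrary subspace \<open>Q\<close> leaves open how
  the terminal cases are spanned.\<close>

lemma torus_reduction:
  fixes \<Gamma> :: "('v::linorder, 'e) cw_graph" and Q :: "('v, 'e, 'f::field) chain set"
  assumes fin: "finite_graph \<Gamma>" and W: "W \<in> essential_sets \<Gamma> i"
    and \<nu>: "component_numbering \<Gamma> W \<nu>"
    and ab: "\<And>w. w \<in> W \<Longrightarrow> a w \<in> half_edges_at \<Gamma> w \<and> b w \<in> half_edges_at \<Gamma> w \<and> \<nu> (fst (a w)) \<noteq> \<nu> (fst (b w))"
    and Q: "chain_vs.subspace Q" "boundaries \<Gamma> i \<subseteq> Q"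
    and good: "\<And>es t. star_choice \<Gamma> W t \<Longrightarrow> set es \<subseteq> edges \<Gamma> \<Longrightarrow> length es = d \<Longrightarrow>
      (\<And>w. w \<in> W \<Longrightarrow> \<exists>c. t w = (a w, b w, c)) \<Longrightarrow> act (edge_monom es) (torus_chain \<Gamma> W t) \<in> Q"
    and miss: "\<And>es t w. star_choice \<Gamma> W t \<Longrightarrow> set es \<subseteq> edges \<Gamma> \<Longrightarrow> length es = d \<Longrightarrow>
      w \<in> W \<Longrightarrow> colour_count \<nu> es (\<nu> (fst (b w))) = 0 \<Longrightarrow> act (edge_monom es) (torus_chain \<Gamma> W t) \<in> Q"
  shows "star_choice \<Gamma> W t \<Longrightarrow> set es \<subseteq> edges \<Gamma> \<Longrightarrow> length es = d \<Longrightarrow> act (edge_monom es) (torus_chain \<Gamma> W t) \<in> Q"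
proof (induction "card {w \<in> W. \<not> (\<exists>c. t w = (a w, b w, c))}" arbitrary: t es rule: less_induct)
  case less
  note finV = finite_verts[OF fin]
  note WV = essential_setsD[OF W]
  then have finW: "finite W" using finV by (auto intro: finite_subset)
  show ?case
  proof (cases "\<forall>w\<in>W. \<exists>c. t w = (a w, b w, c)")
    case True
    then show ?thesis using good less by blast
  next
    case False
    then obtain w where w: "w \<in> W" "\<not> (\<exists>c. t w = (a w, b w, c))" by blast
    have wV: "w \<in> verts \<Gamma>" using w WV by auto
    obtain h1 h2 h3 where tw: "t w = (h1, h2, h3)" by (cases "t w")
    note hs = star_choiceD[OF less(2) w(1) tw]
    have abE: "fst (a w) \<in> edges \<Gamma>" "fst (b w) \<in> edges \<Gamma>"
      using ab[OF w(1)] unfolding half_edges_at_def by auto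
    \<comment> \<open>Once the triple at \<open>w\<close> is replaced, degenerate tori vanish and
      the others have one exceptional vertex less.\<close>
    have new: "act (edge_monom fs) (torus_chain \<Gamma> W (t(w := (a w, b w, c)))) \<in> Q"
      if fs: "set fs \<subseteq> edges \<Gamma>" "length fs = d" and c: "c \<in> half_edges_at \<Gamma> w" for fs c
    proof (cases "c = a w \<or> c = b w")
      case True
      then have "torus_chain \<Gamma> W (t(w := (a w, b w, c))) = (0 :: ('v, 'e, 'f) chain)"
        by (intro torus_degenerate[OF fin wV w(1)]) auto
      then show ?thesis using chain_vs.subspace_0[OF Q(1)] by simp
    next
      case False
      have sc: "star_choice \<Gamma> W (t(w := (a w, b w, c)))"
        using less(2) False ab[OF w(1)] c unfolding star_choice_def by auto
      have "{u \<in> W. \<not> (\<exists>x. (t(w := (a w, b w, c))) u = (a u, b u, x))} \<subset> {u \<in> W. \<not> (\<exists>x. t u = (a u, b u, x))}"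
        (is "?L \<subset> ?R")
      proof -
        have "(t(w := (a w, b w, c))) w = (a w, b w, c)" by simp
        then have "w \<notin> ?L" by blast
        moreover have "w \<in> ?R" using w by blast
        moreover have "?L \<subseteq> ?R"
        proof
          fix u assume u: "u \<in> ?L"
          then have "u \<noteq> w" using \<open>w \<notin> ?L\<close> by blast
          then have eq: "(t(w := (a w, b w, c))) u = t u" by simp
          have "u \<in> W" "\<not> (\<exists>x. (t(w := (a w, b w, c))) u = (a u, b u, x))" using u by blast+
          then show "u \<in> ?R" unfolding eq by blast
        qed
        ultimately show ?thesis by blast
      qed
      then have "card ?L < card ?R"
        using finW by (intro psubset_card_mono) auto
      from less(1)[OF this sc fs] show ?thesis .
    qed
    have "act (edge_monom es) (torus_chain \<Gamma> W t) \<in> Q" if "set es \<subseteq> edges \<Gamma>" "length es = d" for es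
      using that
    proof (induction "colour_count \<nu> es (\<nu> (fst (b w)))" arbitrary: es)
      case 0
      then show ?case using miss[OF less(2) _ _ w(1)] by auto
    next
      case (Suc m)
      let ?\<tau> = "torus_chain \<Gamma> W t :: ('v, 'e, 'f) chain"
      have "\<exists>e\<in>set es. \<nu> e = \<nu> (fst (b w))"
      proof (rule ccontr)
        assume "\<not> ?thesis"
        then have "colour_count \<nu> es (\<nu> (fst (b w))) = 0" unfolding colour_count_def by (simp add: filter_False)
        then show False using Suc(2) by simp
      qed
      then obtain e where e: "e \<in> set es" "\<nu> e = \<nu> (fst (b w))" by blast
      define fs where "fs = remove1 e es"
      define M where "M = (edge_monom fs :: ('e, 'f) edge_poly)"
      have es: "edge_monom es = edge_var e * M" unfolding fs_def M_def using e by (simp add: edge_monom_remove1)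
      have fs: "set fs \<subseteq> edges \<Gamma>" "Suc (length fs) = d" "e \<in> edges \<Gamma>"
        using Suc.prems e(1) set_remove1_subset[of e es] length_pos_if_in_set[OF e(1)] unfolding fs_def by (auto simp: length_remove1)
      have "act M (act (edge_var e - edge_var (fst (b w))) ?\<tau>) \<in> boundaries \<Gamma> i"
        unfolding M_def
        by (intro boundaries_act edge_monom_edge_polys fs same_component_boundary[OF fin W less(2) \<nu> fs(3) abE(2) e(2)])
      then have 1: "act M (act (edge_var e - edge_var (fst (b w))) ?\<tau>) \<in> Q" using Q(2) by blast
      \<comment> \<open>The count drops because \<open>a w\<close> and \<open>b w\<close> lie in
        different components.\<close>
      have "m = colour_count \<nu> (fst (a w) # fs) (\<nu> (fst (b w)))"
        using Suc(2) colour_count_remove1[OF e(1), of \<nu> "\<nu> (fst (b w))"] e(2) ab[OF w(1)] unfolding fs_def by simp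
      from Suc(1)[OF this] have 2: "act (edge_monom (fst (a w) # fs)) ?\<tau> \<in> Q" using fs abE by simp
      have 3: "act M (act (edge_var (fst x) - edge_var (fst y)) (torus_chain \<Gamma> W (t(w := (a w, b w, c))))) \<in> Q"
        if "x \<in> half_edges_at \<Gamma> w" "y \<in> half_edges_at \<Gamma> w" "c \<in> half_edges_at \<Gamma> w" for x y c
      proof -
        have "fst x \<in> edges \<Gamma>" "fst y \<in> edges \<Gamma>" using that unfolding half_edges_at_def by auto
        then have "act (edge_monom (fst x # fs)) (torus_chain \<Gamma> W (t(w := (a w, b w, c)))) \<in> Q"
          "act (edge_monom (fst y # fs)) (torus_chain \<Gamma> W (t(w := (a w, b w, c)))) \<in> Q"
          using fs that by (intro new; simp)+
        from chain_vs.subspace_diff[OF Q(1) this]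
        show ?thesis by (simp add: M_def act_act act_diff act_diff_left mult.commute)
      qed
      \<comment> \<open>The splitting \<open>e = (e - e_b) + e_a + (e_b - e_a)\<close> yields a
        boundary, a case of the inner hypothesis, and the left side of the exchange
        relation.\<close>
      have "act (edge_monom es) ?\<tau> = act M (act (edge_var e - edge_var (fst (b w))) ?\<tau>) +
         act (edge_monom (fst (a w) # fs)) ?\<tau> + act M (act (edge_var (fst (b w)) - edge_var (fst (a w))) ?\<tau>)"
        unfolding es M_def[symmetric] edge_monom_Cons
        by (rule poly_mapping_eqI) (simp add: lookup_add algebra_simps M_def)
      also have "\<dots> \<in> Q"
        unfolding torus_exchange[where t = t and w = w and a = "a w" and b = "b w", OF fin wV w(1) tw] act_add[of M]
        using hs by (intro chain_vs.subspace_add[OF Q(1)] 1 2 3) auto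
      finally show ?case .
    qed
    then show ?thesis using less by blast
  qed
qed

subsection \<open>Counting and independence\<close>

definition exps :: "nat \<Rightarrow> nat \<Rightarrow> nat list set" where
  "exps n d = {\<mu>. length \<mu> = n \<and> sum_list \<mu> = d}"

lemma finite_exps [simp]: "finite (exps n d)"
proof (rule finite_subset)
  show "exps n d \<subseteq> {\<mu>. set \<mu> \<subseteq> {..d} \<and> length \<mu> = n}"
    unfolding exps_def using member_le_sum_list by fastforce
qed (simp add: finite_lists_length_eq)

text \<open>Stars and bars, with the lower index turned from \<open>d\<close> into
  \<open>q\<close>.\<close>

lemma card_exps_Suc: "card (exps (Suc q) d) = (d + q) choose q"
  unfolding exps_def card_length_sum_list using binomial_symmetric[of d "d + q"] by simp

text \<open>Deleting the entry \<open>j\<close> is injective on the vectors that vanish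
  there.\<close>

lemma card_exps_nth_zero:
  assumes "j < n"
  shows "card {\<mu> \<in> exps n d. \<mu> ! j = 0} \<le> card (exps (n - 1) d)"
proof (rule card_inj_on_le)
  let ?f = "\<lambda>\<mu>. take j \<mu> @ drop (Suc j) \<mu>"
  have split: "\<mu> = take j \<mu> @ 0 # drop (Suc j) \<mu>" if "\<mu> \<in> {\<mu> \<in> exps n d. \<mu> ! j = 0}" for \<mu>
    using id_take_nth_drop[of j \<mu>] that assms unfolding exps_def by simp
  show "inj_on ?f {\<mu> \<in> exps n d. \<mu> ! j = 0}"
  proof (rule inj_onI)
    fix \<mu> \<mu>' assume m: "\<mu> \<in> {\<mu> \<in> exps n d. \<mu> ! j = 0}" "\<mu>' \<in> {\<mu> \<in> exps n d. \<mu> ! j = 0}" "?f \<mu> = ?f \<mu>'"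
    then have "take j \<mu> = take j \<mu>' \<and> drop (Suc j) \<mu> = drop (Suc j) \<mu>'"
      unfolding exps_def by (simp add: append_eq_append_conv)
    then show "\<mu> = \<mu>'" using split m by metis
  qed
  show "?f ` {\<mu> \<in> exps n d. \<mu> ! j = 0} \<subseteq> exps (n - 1) d"
  proof
    fix x assume "x \<in> ?f ` {\<mu> \<in> exps n d. \<mu> ! j = 0}"
    then obtain \<mu> where m: "\<mu> \<in> {\<mu> \<in> exps n d. \<mu> ! j = 0}" "x = ?f \<mu>" by auto
    have "sum_list \<mu> = sum_list (take j \<mu> @ 0 # drop (Suc j) \<mu>)" using split[OF m(1)] by simp
    then have "sum_list (?f \<mu>) = d" using m(1) unfolding exps_def by simp
    then show "x \<in> exps (n - 1) d" using m assms unfolding exps_def by auto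
  qed
qed simp

text \<open>Induction on \<open>q\<close> by absorption: \<open>q + 1\<close> times the binomial
  coefficient of \<open>m + q + 1\<close> over \<open>q + 1\<close> is \<open>m + q + 1\<close>
  times that of \<open>m + q\<close> over \<open>q\<close>. Only large \<open>k\<close> matter, so
  the truncation of \<open>k - c\<close> is harmless.\<close>

lemma card_exps_limit: "(\<lambda>k. real (card (exps (Suc q) (k - c))) / real k ^ q) \<longlonglongrightarrow> 1 / fact q"
  unfolding card_exps_Suc
proof (induction q)
  case 0
  then show ?case by simp
next
  case (Suc q)
  have 1: "(\<lambda>k. real (k - c + Suc q) / real k) \<longlonglongrightarrow> 1"
  proof (rule Lim_transform_eventually)
    show "(\<lambda>k. 1 + (real (Suc q) - real c) / real k) \<longlonglongrightarrow> 1"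
      using tendsto_add[OF tendsto_const lim_const_over_n, of "1 :: real" "real (Suc q) - real c"] by simp
    show "\<forall>\<^sub>F k in sequentially. 1 + (real (Suc q) - real c) / real k = real (k - c + Suc q) / real k"
      using eventually_ge_at_top[of "Suc c"]
      by eventually_elim (simp add: of_nat_diff field_simps)
  qed
  have step: "real (k - c + Suc q choose Suc q) / real k ^ Suc q =
     real (k - c + q choose q) / real k ^ q * (real (k - c + Suc q) / real k) * (1 / real (Suc q))" for k
  proof -
    have "real (Suc (k - c + q)) * real (k - c + q choose q) = real (k - c + Suc q choose Suc q) * real (Suc q)"
      using Suc_times_binomial_eq[of "k - c + q" q] by (metis add_Suc_right of_nat_mult)
    then have "real (k - c + Suc q choose Suc q) = real (k - c + Suc q) * real (k - c + q choose q) / real (Suc q)"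
      by (simp add: field_simps)
    moreover have "x * y / z / (u * v) = y / v * (x / u) * (1 / z)" for x y z u v :: real
      by (simp add: divide_inverse ac_simps)
    ultimately show ?thesis by (simp only: power_Suc)
  qed
  have "(\<lambda>k. real (k - c + q choose q) / real k ^ q * (real (k - c + Suc q) / real k) * (1 / real (Suc q)))
     \<longlonglongrightarrow> 1 / fact q * 1 * (1 / real (Suc q))"
    by (intro tendsto_mult Suc.IH 1 tendsto_const)
  then show ?case unfolding step by (simp add: field_simps)
qed

text \<open>Compared with \<open>card_exps_limit\<close> there remain \<open>q - (n - 1)\<close>
  factors \<open>1 / k\<close>, at least one.\<close>

lemma card_exps_limit_zero:
  assumes "1 \<le> n" "n \<le> q"
  shows "(\<lambda>k. real (card (exps n (k - c))) / real k ^ q) \<longlonglongrightarrow> 0"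
proof -
  obtain p where p: "n = Suc p" using assms(1) by (cases n) auto
  have "(\<lambda>k. real (card (exps n (k - c))) / real k ^ p * (1 / real k) ^ (q - p)) \<longlonglongrightarrow> 1 / fact p * 0 ^ (q - p)"
    unfolding p by (intro tendsto_mult card_exps_limit tendsto_power lim_const_over_n)
  moreover have "real (card (exps n (k - c))) / real k ^ p * (1 / real k) ^ (q - p) = real (card (exps n (k - c))) / real k ^ q" for k
    using assms(2) by (simp add: p power_one_over flip: power_add)
  ultimately show ?thesis using assms(2) p by (simp add: zero_power)
qed

section \<open>Linear independence\<close>

lemma prod_edge_var_power:
  "(\<Prod>j<n. edge_var j ^ f j) = (single (\<Sum>j<n. single j (f j)) 1 :: (nat, 'f::comm_ring_1) edge_poly)"
proof (induction n)
  case (Suc n)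
  have "edge_var (n :: nat) ^ m = (single (single n m) 1 :: (nat, 'f) edge_poly)" for m
    by (induction m) (simp_all add: edge_var_def mult_single flip: single_add)
  then show ?case using Suc by (simp add: mult_single)
qed simp

lemma lookup_exponent:
  fixes j :: nat
  shows "j < n \<Longrightarrow> lookup (\<Sum>j<n. single j (f j)) j = (f j :: nat)"
  by (simp add: lookup_sum lookup_single when_def)

lemma edge_var_diff_nonzero: "p \<noteq> q \<Longrightarrow> edge_var p - edge_var q \<noteq> (0 :: ('e, 'f::comm_ring_1) edge_poly)"
proof
  assume pq: "p \<noteq> q" and "edge_var p - edge_var q = (0 :: ('e, 'f) edge_poly)"
  then have "lookup (edge_var p - edge_var q :: ('e, 'f) edge_poly) (single p 1) = 0" by simp
  moreover have "single q 1 \<noteq> (single p 1 :: 'e \<Rightarrow>\<^sub>0 nat)"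
    using pq by (metis lookup_single_eq lookup_single_not_eq zero_neq_one)
  ultimately show False by (simp add: edge_var_def lookup_minus lookup_single when_def)
qed

text \<open>For each pair \<open>(W, \<kappa>)\<close> the functional \<open>detect\<close> kills
  boundaries and the tori of all other pairs, and sends the multiples of its own torus to their
  monomials times a fixed nonzero \<open>\<delta>\<close>. Cancelling \<open>\<delta>\<close> in a
  domain leaves a vanishing combination of distinct monomials.\<close>

lemma torus_independent:
  fixes \<Gamma> :: "('v::linorder, 'e) cw_graph" and c :: "'v set \<times> ('v \<Rightarrow> 'e \<times> bool) \<times> nat list \<Rightarrow> 'f::field"
  assumes fin: "finite_graph \<Gamma>" and M: "M \<subseteq> essential_sets \<Gamma> i"
    and \<nu>: "\<And>W. W \<in> M \<Longrightarrow> cut_compatible \<Gamma> W (\<nu> W)"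
    and r: "\<And>W j. W \<in> M \<Longrightarrow> j < n \<Longrightarrow> \<nu> W (r W j) = j"
    and ab: "\<And>W w. W \<in> M \<Longrightarrow> w \<in> W \<Longrightarrow> \<nu> W (fst (a W w)) \<noteq> \<nu> W (fst (b W w))"
    and I: "I = (SIGMA W:M. PiE W (\<lambda>w. half_edges_at \<Gamma> w - {a W w, b W w}) \<times> exps n d)" "finite I"
    and g: "g = (\<lambda>(W, \<kappa>, \<mu>). act (rep_monom n (r W) (nth \<mu>)) (torus_chain \<Gamma> W (\<lambda>w. (a W w, b W w, \<kappa> w))))"
    and zero: "(\<Sum>x\<in>I. smul (c x) (g x)) \<in> (boundaries \<Gamma> i :: ('v, 'e, 'f) chain set)"
  shows "\<forall>x\<in>I. c x = 0"
proof
  fix x assume x: "x \<in> I"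
  obtain W \<kappa> \<mu> where xe: "x = (W, \<kappa>, \<mu>)" by (cases x)
  have WM: "W \<in> M" and \<kappa>: "\<kappa> \<in> PiE W (\<lambda>w. half_edges_at \<Gamma> w - {a W w, b W w})" and \<mu>: "\<mu> \<in> exps n d"
    using x unfolding xe I(1) by auto
  have WV: "W' \<subseteq> verts \<Gamma>" "card W' = i" if "W' \<in> M" for W'
    using essential_setsD M that by blast+
  have finW: "finite W'" if "W' \<in> M" for W'
    using WV(1)[OF that] fin unfolding finite_graph_def by (auto intro: finite_subset)
  define D where "D = (detect \<Gamma> W \<kappa> (\<nu> W) :: ('v, 'e, 'f) chain \<Rightarrow> (nat, 'f) edge_poly)"
  define X where "X \<mu> = (single (\<Sum>j<n. single j (\<mu> ! j)) 1 :: (nat, 'f) edge_poly)" for \<mu> :: "nat list"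
  define \<delta> where "\<delta> = (\<Prod>w\<in>W. edge_var (\<nu> W (fst (b W w))) - edge_var (\<nu> W (fst (a W w))) :: (nat, 'f) edge_poly)"
  have \<delta>: "\<delta> \<noteq> 0"
  proof -
    have "edge_var (\<nu> W (fst (b W w))) - edge_var (\<nu> W (fst (a W w))) \<noteq> (0 :: (nat, 'f) edge_poly)" if "w \<in> W" for w
      using edge_var_diff_nonzero ab[OF WM that] by metis
    then show ?thesis unfolding \<delta>_def using finW[OF WM] by (simp add: prod_zero_iff)
  qed
  have ren: "rename (\<nu> W) (rep_monom n (r W) (nth \<mu>')) = X \<mu>'" for \<mu>'
    unfolding rep_monom_def rename_prod rename_power rename_var X_def prod_edge_var_power[symmetric]
    using r[OF WM] by (intro prod.cong) auto
  have tor: "D (torus_chain \<Gamma> W' (\<lambda>w. (a W' w, b W' w, \<kappa>' w))) = (if W' = W \<and> \<kappa>' = \<kappa> then \<delta> else 0)"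
    if "W' \<in> M" and \<kappa>': "\<kappa>' \<in> PiE W' (\<lambda>w. half_edges_at \<Gamma> w - {a W' w, b W' w})" for W' \<kappa>'
  proof (cases "W' = W")
    case False
    \<comment> \<open>Sets of equal size contain one another only if they are equal; this separates
      the different sets in \<open>M\<close>.\<close>
    then have "\<not> W \<subseteq> W'"
      using WV(2)[OF WM] WV(2)[OF that(1)] finW[OF that(1)] by (metis card_subset_eq)
    then show ?thesis
      unfolding D_def using False detect_torus_other[OF fin WV(1)[OF WM]] by simp
  next
    case True
    have eval: "lookup (torus_factor W (\<lambda>w. (a W w, b W w, \<kappa>' w)) w :: 'e gen \<Rightarrow>\<^sub>0 ('e, 'f) edge_poly) (Half (\<kappa> w)) =
        (if \<kappa> w = \<kappa>' w then edge_var (fst (b W w)) - edge_var (fst (a W w)) else 0)" if w: "w \<in> W" for w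
    proof -
      have "\<kappa> w \<noteq> a W w" "\<kappa> w \<noteq> b W w" using \<kappa> w by auto
      then show ?thesis using w by (simp add: torus_factor_def lookup_star_chain_third)
    qed
    have "D (torus_chain \<Gamma> W (\<lambda>w. (a W w, b W w, \<kappa>' w))) =
        (\<Prod>w\<in>W. rename (\<nu> W) (lookup (torus_factor W (\<lambda>w. (a W w, b W w, \<kappa>' w)) w) (Half (\<kappa> w))))"
      unfolding D_def using \<kappa> by (intro detect_torus[OF fin WV(1)[OF WM]]) auto
    also have "\<dots> = (\<Prod>w\<in>W. if \<kappa> w = \<kappa>' w then edge_var (\<nu> W (fst (b W w))) - edge_var (\<nu> W (fst (a W w))) else 0)"
      by (intro prod.cong refl) (simp add: eval rename_diff rename_var)
    also have "\<dots> = (if \<kappa>' = \<kappa> then \<delta> else 0)"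
    proof (cases "\<kappa>' = \<kappa>")
      case False
      have "\<exists>w\<in>W. \<kappa> w \<noteq> \<kappa>' w"
        using PiE_ext[OF \<kappa> \<kappa>'[unfolded True]] False by blast
      then obtain w where "w \<in> W" "\<kappa> w \<noteq> \<kappa>' w" by blast
      then show ?thesis using finW[OF WM] False by (auto intro!: prod_zero)
    qed (simp add: \<delta>_def)
    finally show ?thesis using True by simp
  qed
  let ?F = "\<lambda>y. if fst y = W \<and> fst (snd y) = \<kappa> then const_poly (c y) * X (snd (snd y)) * \<delta> else 0"
  have Dg: "D (smul (c y) (g y)) = ?F y"
    if "y \<in> I" for y
  proof -
    obtain W' \<kappa>' \<mu>' where y: "y = (W', \<kappa>', \<mu>')" by (cases y)
    have "W' \<in> M" "\<kappa>' \<in> PiE W' (\<lambda>w. half_edges_at \<Gamma> w - {a W' w, b W' w})"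
      using that unfolding y I(1) by auto
    note t = tor[OF this]
    have "D (smul (c y) (g y)) = const_poly (c y) * (rename (\<nu> W) (rep_monom n (r W') (nth \<mu>')) *
       D (torus_chain \<Gamma> W' (\<lambda>w. (a W' w, b W' w, \<kappa>' w))))"
      unfolding D_def g y smul_def by (simp add: detect_act rename_const)
    then show ?thesis unfolding t by (auto simp: y ren)
  qed
  have "D (\<Sum>x\<in>I. smul (c x) (g x)) = 0"
  proof -
    obtain z where z: "z \<in> chains \<Gamma> (Suc i)" "(\<Sum>x\<in>I. smul (c x) (g x)) = boundary \<Gamma> z"
      using zero unfolding boundaries_def by blast
    show ?thesis unfolding z(2) D_def by (rule detect_boundary[OF fin \<nu>[OF WM] chains_keys[OF z(1)]])
  qed
  then have "0 = (\<Sum>y\<in>I. D (smul (c y) (g y)))" unfolding D_def detect_sum by simp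
  also have "\<dots> = (\<Sum>y\<in>I. ?F y)"
    by (intro sum.cong refl Dg)
  also have "\<dots> = (\<Sum>y\<in>(\<lambda>\<mu>. (W, \<kappa>, \<mu>)) ` exps n d. ?F y)"
    using I WM \<kappa> by (intro sum.mono_neutral_right) auto
  also have "\<dots> = (\<Sum>\<mu>'\<in>exps n d. const_poly (c (W, \<kappa>, \<mu>')) * X \<mu>' * \<delta>)"
    by (subst sum.reindex) (auto simp: inj_on_def)
  also have "\<dots> = (\<Sum>\<mu>'\<in>exps n d. const_poly (c (W, \<kappa>, \<mu>')) * X \<mu>') * \<delta>"
    by (simp add: sum_distrib_right)
  finally have "(\<Sum>\<mu>'\<in>exps n d. const_poly (c (W, \<kappa>, \<mu>')) * X \<mu>') = 0" using \<delta> by simp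
  then have "0 = lookup (\<Sum>\<mu>'\<in>exps n d. const_poly (c (W, \<kappa>, \<mu>')) * X \<mu>') (\<Sum>j<n. single j (\<mu> ! j))"
    by simp
  also have "\<dots> = (\<Sum>\<mu>'\<in>exps n d. if \<mu>' = \<mu> then c (W, \<kappa>, \<mu>) else 0)"
    unfolding lookup_sum
  proof (intro sum.cong refl)
    fix \<mu>' assume \<mu>': "\<mu>' \<in> exps n d"
    \<comment> \<open>The exponents can be read off the monomial, so distinct vectors give distinct
      monomials.\<close>
    have "(\<Sum>j<n. single j (\<mu>' ! j)) = (\<Sum>j<n. single j (\<mu> ! j)) \<longleftrightarrow> \<mu>' = \<mu>"
    proof
      assume eq: "(\<Sum>j<n. single j (\<mu>' ! j)) = (\<Sum>j<n. single j (\<mu> ! j))"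
      have "\<mu>' ! j = \<mu> ! j" if "j < n" for j
        using lookup_exponent[OF that, of "nth \<mu>"] lookup_exponent[OF that, of "nth \<mu>'"] eq by simp
      then show "\<mu>' = \<mu>" using \<mu> \<mu>' unfolding exps_def by (auto intro: nth_equalityI)
    qed simp
    then show "lookup (const_poly (c (W, \<kappa>, \<mu>')) * X \<mu>') (\<Sum>j<n. single j (\<mu> ! j)) =
       (if \<mu>' = \<mu> then c (W, \<kappa>, \<mu>) else 0)"
      by (simp add: X_def const_poly_def mult_single lookup_single when_def)
  qed
  also have "\<dots> = c (W, \<kappa>, \<mu>)" using \<mu> by simp
  finally show "c x = 0" unfolding xe by simp
qed

section \<open>Bounds for the dimension\<close>

lemma torus_chain_cong:
  "(\<And>w. w \<in> W \<Longrightarrow> t w = t' w) \<Longrightarrow> torus_chain \<Gamma> W t = torus_chain \<Gamma> W t'"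
  unfolding torus_chain_def by (intro arg_cong[where f = "tensor \<Gamma>"] ext) auto

text \<open>Only the values of a star choice on \<open>W\<close> matter; restricting to extensional
  functions leaves finitely many to count.\<close>

definition star_choices :: "('v, 'e) cw_graph \<Rightarrow> 'v set \<Rightarrow> ('v \<Rightarrow> ('e \<times> bool) \<times> ('e \<times> bool) \<times> ('e \<times> bool)) set" where
  "star_choices \<Gamma> W = {t \<in> PiE W (\<lambda>w. half_edges_at \<Gamma> w \<times> half_edges_at \<Gamma> w \<times> half_edges_at \<Gamma> w). star_choice \<Gamma> W t}"

lemma finite_star_choices: "finite_graph \<Gamma> \<Longrightarrow> finite W \<Longrightarrow> finite (star_choices \<Gamma> W)"
  unfolding star_choices_def by (intro finite_subset[OF Collect_subset] finite_PiE) (auto simp: finite_half_edges)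

lemma restrict_star_choices:
  assumes "star_choice \<Gamma> W t"
  shows "restrict t W \<in> star_choices \<Gamma> W"
  unfolding star_choices_def
proof (intro CollectI conjI)
  show "star_choice \<Gamma> W (restrict t W)" using assms unfolding star_choice_def by simp
  show "restrict t W \<in> PiE W (\<lambda>w. half_edges_at \<Gamma> w \<times> half_edges_at \<Gamma> w \<times> half_edges_at \<Gamma> w)"
  proof (intro restrict_PiE_iff[THEN iffD2] ballI)
    fix w assume "w \<in> W"
    then show "t w \<in> half_edges_at \<Gamma> w \<times> half_edges_at \<Gamma> w \<times> half_edges_at \<Gamma> w"
      using star_choiceD[OF assms, of w] by (cases "t w") auto
  qed
qed

text \<open>Turns normalised monomials back into lists of edges, so that the independent family
  consists of members of \<open>torus_gens\<close>.\<close>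

lemma rep_monom_eq_edge_monom:
  "\<exists>es. set es \<subseteq> r ` {..<n} \<and> length es = (\<Sum>j<n. f j) \<and>
    rep_monom n r f = (edge_monom es :: ('e, 'f::comm_ring_1) edge_poly)"
proof (induction n)
  case 0
  show ?case by (intro exI[of _ "[]"]) (simp add: rep_monom_def)
next
  case (Suc n)
  then obtain es where es: "set es \<subseteq> r ` {..<n}" "length es = (\<Sum>j<n. f j)"
    "rep_monom n r f = (edge_monom es :: ('e, 'f) edge_poly)" by blast
  have "edge_monom (replicate m e) = (edge_var e ^ m :: ('e, 'f) edge_poly)" for m e
    by (induction m) simp_all
  then have "rep_monom (Suc n) r f = (edge_monom (es @ replicate (f n) (r n)) :: ('e, 'f) edge_poly)"
    using es(3) by (simp add: rep_monom_def edge_monom_append)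
  then show ?case
    using es(1,2) by (intro exI[of _ "es @ replicate (f n) (r n)"]) (auto simp: less_Suc_eq)
qed

definition maximal_sets :: "('v, 'e) cw_graph \<Rightarrow> nat \<Rightarrow> 'v set set" where
  "maximal_sets \<Gamma> i = {W \<in> essential_sets \<Gamma> i. Delta_set \<Gamma> W = Delta \<Gamma> i}"

text \<open>The spanning set has three parts: the independent family, which accounts for
  \<open>L\<close>; the normalised multiples of tori of nonmaximal sets; and those of maximal sets
  whose monomial misses the component of some \<open>b\<close>. The last two are counted crudely,
  with all star choices, because only their order of growth matters. The assumption
  \<open>2 * i \<le> k\<close> keeps the subtraction exact.\<close>

lemma torus_dim_bounds:
  fixes \<Gamma> :: "('v::linorder, 'e) cw_graph"
  assumes fin: "finite_graph \<Gamma>" and con: "connected_graph \<Gamma>" and ess: "essential \<Gamma> \<noteq> {}"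
    and gt: "Delta \<Gamma> i > 1" and k: "2 * i \<le> k"
  defines "D \<equiv> class_dim \<Gamma> i (torus_part \<Gamma> i k :: ('v, 'e, 'f::field) chain set set)"
    and "L \<equiv> \<Sum>W\<in>maximal_sets \<Gamma> i. (\<Prod>w\<in>W. valence \<Gamma> w - 2) * card (exps (Delta \<Gamma> i) (k - 2 * i))"
  shows "L \<le> D"
    and "D \<le> L + (\<Sum>W\<in>essential_sets \<Gamma> i - maximal_sets \<Gamma> i.
           card (star_choices \<Gamma> W) * card (exps (Delta_set \<Gamma> W) (k - 2 * i)))
       + (\<Sum>W\<in>maximal_sets \<Gamma> i. \<Sum>w\<in>W. card (star_choices \<Gamma> W) * card (exps (Delta \<Gamma> i - 1) (k - 2 * i)))"
proof -
  define M where "M = maximal_sets \<Gamma> i"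
  define E where "E = essential_sets \<Gamma> i"
  define n where "n = Delta \<Gamma> i"
  define d where "d = k - 2 * i"
  have iso: "\<And>v. v \<in> verts \<Gamma> \<Longrightarrow> half_edges_at \<Gamma> v \<noteq> {}"
    by (rule no_isolated_vertex[OF fin con ess])
  have finE: "finite E" unfolding E_def by (rule finite_essential_sets[OF fin])
  have ME: "M \<subseteq> E" and Mn: "\<And>W. W \<in> M \<Longrightarrow> Delta_set \<Gamma> W = n"
    unfolding M_def E_def n_def maximal_sets_def by auto
  have finM: "finite M" using ME finE by (rule finite_subset)
  have WV: "W \<subseteq> verts \<Gamma>" "card W = i" if "W \<in> E" for W
    using essential_setsD that unfolding E_def by blast+
  have finW: "finite W" if "W \<in> E" for W
    using WV(1)[OF that] fin unfolding finite_graph_def by (auto intro: finite_subset)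
  obtain \<nu> where \<nu>: "\<And>W. component_numbering \<Gamma> W (\<nu> W)"
    using component_numbering_exists[OF fin iso] by metis
  have \<nu>_im: "\<nu> W ` edges \<Gamma> = {..<Delta_set \<Gamma> W}" and \<nu>_cut: "cut_compatible \<Gamma> W (\<nu> W)" for W
    using \<nu>[of W] unfolding component_numbering_def by auto
  define r where "r W j = (SOME e. e \<in> edges \<Gamma> \<and> \<nu> W e = j)" for W j
  have r: "r W j \<in> edges \<Gamma> \<and> \<nu> W (r W j) = j" if "j < Delta_set \<Gamma> W" for W j
  proof -
    have "\<exists>e. e \<in> edges \<Gamma> \<and> \<nu> W e = j" using \<nu>_im[of W] that by (metis imageE lessThan_iff)
    then show ?thesis unfolding r_def by (rule someI_ex)
  qed
  \<comment> \<open>Here the maximality of \<open>W\<close> and \<open>Delta \<Gamma> i > 1\<close>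
    enter.\<close>
  have "\<forall>W w. \<exists>h h'. W \<in> M \<longrightarrow> w \<in> W \<longrightarrow> h \<in> half_edges_at \<Gamma> w \<and> h' \<in> half_edges_at \<Gamma> w \<and> \<nu> W (fst h) \<noteq> \<nu> W (fst h')"
    using maximal_set_meets_two_components[OF fin con iso _ _ gt \<nu>] unfolding M_def maximal_sets_def by blast
  then obtain a b where ab: "\<And>W w. W \<in> M \<Longrightarrow> w \<in> W \<Longrightarrow>
      a W w \<in> half_edges_at \<Gamma> w \<and> b W w \<in> half_edges_at \<Gamma> w \<and> \<nu> W (fst (a W w)) \<noteq> \<nu> W (fst (b W w))"
    by metis
  define \<tau> where "\<tau> W t \<mu> = (act (rep_monom (Delta_set \<Gamma> W) (r W) (nth \<mu>)) (torus_chain \<Gamma> W t) :: ('v, 'e, 'f) chain)" for W t \<mu>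
  define K where "K W = PiE W (\<lambda>w. half_edges_at \<Gamma> w - {a W w, b W w})" for W
  define I where "I = (SIGMA W:M. K W \<times> exps n d)"
  define g where "g = (\<lambda>(W, \<kappa>, \<mu>). act (rep_monom n (r W) (nth \<mu>)) (torus_chain \<Gamma> W (\<lambda>w. (a W w, b W w, \<kappa> w))) :: ('v, 'e, 'f) chain)"
  define A2 where "A2 = (\<Union>W\<in>E - M. (\<lambda>(t, \<mu>). \<tau> W t \<mu>) ` (star_choices \<Gamma> W \<times> exps (Delta_set \<Gamma> W) d))"
  define A3 where "A3 = (\<Union>W\<in>M. \<Union>w\<in>W. (\<lambda>(t, \<mu>). \<tau> W t \<mu>) `
     (star_choices \<Gamma> W \<times> {\<mu> \<in> exps n d. \<mu> ! \<nu> W (fst (b W w)) = 0}))"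
  define A where "A = g ` I \<union> A2 \<union> A3"
  have finK: "finite (K W)" if "W \<in> E" for W
    unfolding K_def using finW[OF that] finite_half_edges[OF fin] by (intro finite_PiE) auto
  have finI: "finite I" unfolding I_def using finM finK ME by (intro finite_SigmaI) auto
  have finA: "finite A" unfolding A_def A2_def A3_def
    using finI finE finM ME finW finite_star_choices[OF fin]
    by (intro finite_UnI finite_imageI finite_UN_I finite_cartesian_product) auto
  have cardK: "card (K W) = (\<Prod>w\<in>W. valence \<Gamma> w - 2)" if W: "W \<in> M" for W
  proof -
    \<comment> \<open>The half-edges \<open>a W w\<close> and \<open>b W w\<close> differ because
      their colours do, so removing them leaves \<open>d(w) - 2\<close>.\<close>
    have "card (half_edges_at \<Gamma> w - {a W w, b W w}) = valence \<Gamma> w - 2" if w: "w \<in> W" for w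
    proof -
      have "a W w \<noteq> b W w" using ab[OF W w] by metis
      then have "card {a W w, b W w} = 2" by simp
      then show ?thesis unfolding valence_def
        using ab[OF W w] by (subst card_Diff_subset) auto
    qed
    then show ?thesis unfolding K_def using finW W ME by (subst card_PiE) auto
  qed
  have cardI: "card I = L"
    unfolding I_def L_def M_def[symmetric] n_def[symmetric] d_def[symmetric]
    using finM finK ME by (subst card_SigmaI) (auto simp: card_cartesian_product cardK)
  have gens: "act (edge_monom es) (torus_chain \<Gamma> W t) \<in> (torus_gens \<Gamma> i k :: ('v, 'e, 'f) chain set)"
    if "set es \<subseteq> edges \<Gamma>" "length es = d" "W \<in> E" "star_choice \<Gamma> W t" for es W t
    using that k unfolding torus_gens_def E_def d_def by fastforce
  define Q where "Q = (chain_vs.span (A \<union> boundaries \<Gamma> i) :: ('v, 'e, 'f) chain set)"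
  have Q: "chain_vs.subspace Q" "boundaries \<Gamma> i \<subseteq> Q" "A \<subseteq> Q"
    unfolding Q_def by (auto intro: chain_vs.span_base)
  define cnt where "cnt W es = map (colour_count (\<nu> W) es) [0..<Delta_set \<Gamma> W]" for W es
  have \<nu>_lt: "\<nu> W e < Delta_set \<Gamma> W" if "e \<in> edges \<Gamma>" for W e
    using \<nu>_im[of W] that by auto
  have cnt: "cnt W es \<in> exps (Delta_set \<Gamma> W) d" if "set es \<subseteq> edges \<Gamma>" "length es = d" for W es
  proof -
    have "sum_list (cnt W es) = (\<Sum>j<Delta_set \<Gamma> W. colour_count (\<nu> W) es j)"
      unfolding cnt_def by (simp add: sum_list_sum_nth lessThan_atLeast0)
    also have "\<dots> = length es" by (rule sum_colour_count) (use \<nu>_lt that in auto)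
    finally show ?thesis using that unfolding exps_def cnt_def by simp
  qed
  have cnt_nth: "cnt W es ! j = colour_count (\<nu> W) es j" if "j < Delta_set \<Gamma> W" for W es j
    using that unfolding cnt_def by simp
  \<comment> \<open>Since \<open>Q\<close> contains the boundaries, membership may be tested after
    passing to representative edges.\<close>
  have normal: "act (edge_monom es) (torus_chain \<Gamma> W t) \<in> Q"
    if "set es \<subseteq> edges \<Gamma>" "W \<in> E" "star_choice \<Gamma> W t" "\<tau> W t (cnt W es) \<in> Q" for es W t
  proof -
    have "rep_monom (Delta_set \<Gamma> W) (r W) (nth (cnt W es)) =
        (rep_monom (Delta_set \<Gamma> W) (r W) (colour_count (\<nu> W) es) :: ('e, 'f) edge_poly)"
      unfolding rep_monom_def by (intro prod.cong) (auto simp: cnt_nth)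
    then have "act (edge_monom es) (torus_chain \<Gamma> W t) - \<tau> W t (cnt W es) \<in> boundaries \<Gamma> i"
      using edge_monom_to_rep_monom[OF fin _ that(3) \<nu> \<nu>_lt r that(1), of i] that(2)
      unfolding \<tau>_def E_def by simp
    then have "act (edge_monom es) (torus_chain \<Gamma> W t) - \<tau> W t (cnt W es) \<in> Q" using Q(2) by blast
    from chain_vs.subspace_add[OF Q(1) this that(4)] show ?thesis by simp
  qed
  have \<tau>_restrict: "\<tau> W t \<mu> = \<tau> W (restrict t W) \<mu>" for W t \<mu>
    unfolding \<tau>_def by (intro arg_cong[where f = "act _"] torus_chain_cong) simp
  have span: "chain_vs.span (torus_gens \<Gamma> i k) \<subseteq> Q"
  proof (rule chain_vs.span_minimal[OF _ Q(1)], rule subsetI)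
    fix x :: "('v, 'e, 'f) chain" assume "x \<in> torus_gens \<Gamma> i k"
    then obtain es W t where x: "x = act (edge_monom es) (torus_chain \<Gamma> W t)" and es: "set es \<subseteq> edges \<Gamma>"
      "length es = d" and W: "W \<in> E" and t: "star_choice \<Gamma> W t"
      unfolding torus_gens_def E_def d_def by auto
    show "x \<in> Q"
    proof (cases "W \<in> M")
      case False
      have "\<tau> W t (cnt W es) \<in> A2"
        unfolding A2_def \<tau>_restrict[of W t] using W False restrict_star_choices[OF t] cnt[OF es] by fast
      then show ?thesis unfolding x using normal[OF es(1) W t] Q(3) unfolding A_def by blast
    next
      case True
      have nW: "Delta_set \<Gamma> W = n" using Mn True by simp
      show ?thesis unfolding x
      proof (rule torus_reduction[OF fin W[unfolded E_def] \<nu>[of W], where a = "a W" and b = "b W" and d = d])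
        show "a W w \<in> half_edges_at \<Gamma> w \<and> b W w \<in> half_edges_at \<Gamma> w \<and> \<nu> W (fst (a W w)) \<noteq> \<nu> W (fst (b W w))"
          if "w \<in> W" for w using ab[OF True that] .
      next
        fix es t assume h: "star_choice \<Gamma> W t" "set es \<subseteq> edges \<Gamma>" "length es = d"
          "\<And>w. w \<in> W \<Longrightarrow> \<exists>c. t w = (a W w, b W w, c)"
        define \<kappa> where "\<kappa> = restrict (\<lambda>w. snd (snd (t w))) W"
        have tw: "t w = (a W w, b W w, \<kappa> w)" if w: "w \<in> W" for w
        proof -
          obtain c where "t w = (a W w, b W w, c)" using h(4)[OF w] by blast
          then show ?thesis using w unfolding \<kappa>_def by simp
        qed
        have "\<kappa> \<in> K W"
          unfolding K_def
        proof (rule PiE_I)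
          show "\<kappa> w \<in> half_edges_at \<Gamma> w - {a W w, b W w}" if "w \<in> W" for w
            using star_choiceD[OF h(1) that tw[OF that]] by auto
        qed (simp add: \<kappa>_def)
        then have inI: "(W, \<kappa>, cnt W es) \<in> I" unfolding I_def using True cnt[OF h(2,3), of W] nW by simp
        have geq: "g (W, \<kappa>, cnt W es) = \<tau> W t (cnt W es)"
          unfolding g_def \<tau>_def prod.case nW
          by (intro arg_cong[where f = "act _"] torus_chain_cong) (simp add: tw)
        have "g (W, \<kappa>, cnt W es) \<in> A" unfolding A_def using inI by blast
        then have "\<tau> W t (cnt W es) \<in> Q" using Q(3) unfolding geq by blast
        then show "act (edge_monom es) (torus_chain \<Gamma> W t) \<in> Q" by (rule normal[OF h(2) W h(1)])
      next
        fix es t w assume h: "star_choice \<Gamma> W t" "set es \<subseteq> edges \<Gamma>" "length es = d" "w \<in> W"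
          "colour_count (\<nu> W) es (\<nu> W (fst (b W w))) = 0"
        have "fst (b W w) \<in> edges \<Gamma>" using ab[OF True h(4)] unfolding half_edges_at_def by auto
        then have "cnt W es ! \<nu> W (fst (b W w)) = 0" using cnt_nth[OF \<nu>_lt] h(5) by simp
        then have "cnt W es \<in> {\<mu> \<in> exps n d. \<mu> ! \<nu> W (fst (b W w)) = 0}"
          using cnt[OF h(2,3), of W] nW by simp
        then have "\<tau> W t (cnt W es) \<in> A3"
          unfolding A3_def \<tau>_restrict[of W t] using True h(4) restrict_star_choices[OF h(1)] by fast
        then have "\<tau> W t (cnt W es) \<in> Q" using Q(3) unfolding A_def by blast
        then show "act (edge_monom es) (torus_chain \<Gamma> W t) \<in> Q" by (rule normal[OF h(2) W h(1)])
      qed (use Q es t in auto)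
    qed
  qed
  have gI: "g ` I \<subseteq> chain_vs.span (torus_gens \<Gamma> i k)"
  proof (rule order_trans[OF _ chain_vs.span_superset], rule image_subsetI)
    fix x assume "x \<in> I"
    then obtain W \<kappa> \<mu> where x: "x = (W, \<kappa>, \<mu>)" "W \<in> M" "\<kappa> \<in> K W" "\<mu> \<in> exps n d"
      unfolding I_def by auto
    obtain es where es: "set es \<subseteq> r W ` {..<n}" "length es = (\<Sum>j<n. \<mu> ! j)"
      "rep_monom n (r W) (nth \<mu>) = (edge_monom es :: ('e, 'f) edge_poly)"
      using rep_monom_eq_edge_monom[where r = "r W" and n = n and f = "nth \<mu>" and 'f = 'f] by blast
    have len: "length es = d"
      using es(2) x(4) unfolding exps_def by (auto simp: sum_list_sum_nth lessThan_atLeast0)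
    have edges: "set es \<subseteq> edges \<Gamma>"
    proof
      fix e assume "e \<in> set es"
      then obtain j where "j < n" "e = r W j" using es(1) by blast
      then show "e \<in> edges \<Gamma>" using r[of j W] Mn[OF x(2)] by simp
    qed
    have "star_choice \<Gamma> W (\<lambda>w. (a W w, b W w, \<kappa> w))"
      unfolding star_choice_def
    proof
      fix w assume w: "w \<in> W"
      have "a W w \<noteq> b W w" using ab[OF x(2) w] by metis
      moreover have "\<kappa> w \<in> half_edges_at \<Gamma> w - {a W w, b W w}" using x(3) w unfolding K_def by (rule PiE_mem)
      ultimately show "case (a W w, b W w, \<kappa> w) of (h1, h2, h3) \<Rightarrow>
          {h1, h2, h3} \<subseteq> half_edges_at \<Gamma> w \<and> h1 \<noteq> h2 \<and> h1 \<noteq> h3 \<and> h2 \<noteq> h3"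
        using ab[OF x(2) w] by auto
    qed
    from gens[OF edges len _ this] x(2) ME
    show "g x \<in> torus_gens \<Gamma> i k"
      unfolding x(1) g_def prod.case es(3) by blast
  qed
  have D: "D = class_dim \<Gamma> i (hclass \<Gamma> i ` (chain_vs.span (torus_gens \<Gamma> i k) :: ('v, 'e, 'f) chain set))"
    unfolding D_def torus_part_eq[OF fin] ..
  have ind: "\<forall>x\<in>I. c x = 0" if "(\<Sum>x\<in>I. smul (c x) (g x)) \<in> boundaries \<Gamma> i" for c
  proof (rule torus_independent[OF fin _ _ _ _ _ finI _ that])
    show "M \<subseteq> essential_sets \<Gamma> i" using ME unfolding E_def .
    show "cut_compatible \<Gamma> W (\<nu> W)" for W by (rule \<nu>_cut)
    show "\<nu> W (r W j) = j" if "W \<in> M" "j < n" for W j using r Mn that by auto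
    show "\<nu> W (fst (a W w)) \<noteq> \<nu> W (fst (b W w))" if "W \<in> M" "w \<in> W" for W w using ab that by blast
    show "I = (SIGMA W:M. PiE W (\<lambda>w. half_edges_at \<Gamma> w - {a W w, b W w}) \<times> exps n d)"
      unfolding I_def K_def ..
    show "g = (\<lambda>(W, \<kappa>, \<mu>). act (rep_monom n (r W) (nth \<mu>)) (torus_chain \<Gamma> W (\<lambda>w. (a W w, b W w, \<kappa> w))))"
      unfolding g_def ..
  qed
  note bounds = class_dim_bounds[OF boundaries_subspace chain_vs.subspace_span finA span[unfolded Q_def] finI gI ind]
  show "L \<le> D" using bounds(1) unfolding D cardI .
  have "card A \<le> card (g ` I) + card A2 + card A3"
    unfolding A_def by (meson add_mono card_Un_le le_trans order_refl)
  also have "card (g ` I) \<le> L" using card_image_le[OF finI, of g] cardI by simp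
  also have "card A2 \<le> (\<Sum>W\<in>E - M. card (star_choices \<Gamma> W) * card (exps (Delta_set \<Gamma> W) d))"
    unfolding A2_def
  proof (rule order_trans[OF card_UN_le sum_mono])
    show "finite (E - M)" using finE by simp
    fix W assume "W \<in> E - M"
    then have "finite (star_choices \<Gamma> W \<times> exps (Delta_set \<Gamma> W) d)"
      using finite_star_choices[OF fin] finW by simp
    from card_image_le[OF this]
    show "card ((\<lambda>(t, \<mu>). \<tau> W t \<mu>) ` (star_choices \<Gamma> W \<times> exps (Delta_set \<Gamma> W) d))
       \<le> card (star_choices \<Gamma> W) * card (exps (Delta_set \<Gamma> W) d)"
      by (simp add: card_cartesian_product)
  qed
  also have "card A3 \<le> (\<Sum>W\<in>M. \<Sum>w\<in>W. card (star_choices \<Gamma> W) * card (exps (n - 1) d))"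
    unfolding A3_def
  proof (rule order_trans[OF card_UN_le[OF finM] sum_mono])
    fix W assume W: "W \<in> M"
    show "card (\<Union>w\<in>W. (\<lambda>(t, \<mu>). \<tau> W t \<mu>) ` (star_choices \<Gamma> W \<times> {\<mu> \<in> exps n d. \<mu> ! \<nu> W (fst (b W w)) = 0}))
       \<le> (\<Sum>w\<in>W. card (star_choices \<Gamma> W) * card (exps (n - 1) d))"
    proof (rule order_trans[OF card_UN_le sum_mono])
      show "finite W" using finW W ME by blast
      fix w assume w: "w \<in> W"
      have "fst (b W w) \<in> edges \<Gamma>" using ab[OF W w] unfolding half_edges_at_def by auto
      then have "\<nu> W (fst (b W w)) < n" using \<nu>_lt Mn[OF W] by metis
      note c = card_exps_nth_zero[OF this, of d]
      let ?S = "{\<mu> \<in> exps n d. \<mu> ! \<nu> W (fst (b W w)) = 0}" and ?f = "\<lambda>(t, \<mu>). \<tau> W t \<mu>"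
      have "finite (star_choices \<Gamma> W \<times> ?S)"
        using finite_star_choices[OF fin] finW W ME by auto
      from card_image_le[OF this, of ?f]
      have "card (?f ` (star_choices \<Gamma> W \<times> ?S))
         \<le> card (star_choices \<Gamma> W) * card ?S"
        by (simp add: card_cartesian_product)
      also have "\<dots> \<le> card (star_choices \<Gamma> W) * card (exps (n - 1) d)" using c by simp
      finally show "card (?f ` (star_choices \<Gamma> W \<times> ?S))
         \<le> card (star_choices \<Gamma> W) * card (exps (n - 1) d)" .
    qed
  qed
  finally show "D \<le> L + (\<Sum>W\<in>essential_sets \<Gamma> i - maximal_sets \<Gamma> i.
           card (star_choices \<Gamma> W) * card (exps (Delta_set \<Gamma> W) (k - 2 * i)))
       + (\<Sum>W\<in>maximal_sets \<Gamma> i. \<Sum>w\<in>W. card (star_choices \<Gamma> W) * card (exps (Delta \<Gamma> i - 1) (k - 2 * i)))"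
    using bounds(2) unfolding D M_def E_def n_def d_def by simp
qed

text \<open>The numbering has a nonempty image because an essential vertex has an edge. Positivity
  supplies the condition \<open>1 \<le> n\<close> of \<open>card_exps_limit_zero\<close>.\<close>

lemma Delta_set_pos:
  assumes fin: "finite_graph \<Gamma>" and con: "connected_graph \<Gamma>" and ess: "essential \<Gamma> \<noteq> {}"
  shows "Delta_set \<Gamma> W > 0"
proof -
  obtain \<nu> where "component_numbering \<Gamma> W \<nu>"
    using component_numbering_exists[OF fin no_isolated_vertex[OF fin con ess]] by blast
  then have "\<nu> ` edges \<Gamma> = {..<Delta_set \<Gamma> W}" unfolding component_numbering_def by simp
  moreover have "edges \<Gamma> \<noteq> {}"
    using ess no_isolated_vertex[OF fin con ess] unfolding essential_def half_edges_at_def by blast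
  ultimately show ?thesis by (metis image_is_empty lessThan_0 gr0I)
qed

text \<open>The maximum exceeds 1, so it is attained by a set and not by the inserted default
  0.\<close>

lemma maximal_sets_nonempty:
  assumes "finite_graph \<Gamma>" "Delta \<Gamma> i > 1"
  shows "maximal_sets \<Gamma> i \<noteq> {}"
proof -
  have "Delta \<Gamma> i \<in> insert 0 (Delta_set \<Gamma> ` essential_sets \<Gamma> i)"
    unfolding Delta_def by (rule Max_in) (simp_all add: finite_essential_sets[OF assms(1)])
  then obtain W where "W \<in> essential_sets \<Gamma> i" "Delta_set \<Gamma> W = Delta \<Gamma> i"
    using assms(2) by auto
  then show ?thesis unfolding maximal_sets_def by blast
qed

theorem theorem4p7:
  fixes \<Gamma> :: "('v::linorder, 'e) cw_graph" and i :: nat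
  assumes "finite_graph \<Gamma>"
    and "connected_graph \<Gamma>"
    and "essential \<Gamma> \<noteq> {}"
    and "Delta \<Gamma> i > 1"
  shows "asymptotic
    (\<lambda>k. real (class_dim \<Gamma> i (torus_part \<Gamma> i k :: ('v, 'e, 'f::field) chain set set)))
    (\<lambda>k. \<Sum>W \<in> {W \<in> essential_sets \<Gamma> i. Delta_set \<Gamma> W = Delta \<Gamma> i}.
       1 / fact (Delta \<Gamma> i - 1) * (\<Prod>w \<in> W. real (valence \<Gamma> w) - 2) * real k ^ (Delta \<Gamma> i - 1))"
proof -
  define M where "M = maximal_sets \<Gamma> i"
  define E where "E = essential_sets \<Gamma> i"
  define q where "q = Delta \<Gamma> i - 1"
  have q: "Delta \<Gamma> i = Suc q" "1 \<le> q" using assms(4) unfolding q_def by auto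
  define D where "D k = real (class_dim \<Gamma> i (torus_part \<Gamma> i k :: ('v, 'e, 'f) chain set set))" for k
  define N where "N n k = real (card (exps n (k - 2 * i)))" for n k
  define P where "P = (\<Sum>W\<in>M. \<Prod>w\<in>W. real (valence \<Gamma> w) - 2)"
  \<comment> \<open>The error term: each summand counts monomials in at most \<open>q\<close>
    variables and grows more slowly than \<open>k ^ q\<close>.\<close>
  define R where "R k = (\<Sum>W\<in>E - M. real (card (star_choices \<Gamma> W)) * N (Delta_set \<Gamma> W) k)
     + (\<Sum>W\<in>M. \<Sum>w\<in>W. real (card (star_choices \<Gamma> W)) * N q k)" for k
  have finE: "finite E" unfolding E_def by (rule finite_essential_sets[OF assms(1)])
  have ME: "M \<subseteq> E" unfolding M_def E_def maximal_sets_def by auto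
  then have finM: "finite M" using finE by (rule finite_subset)
  have val: "3 \<le> valence \<Gamma> w" if "W \<in> M" "w \<in> W" for W w
    using that unfolding M_def maximal_sets_def essential_sets_def essential_def by auto
  have P: "P > 0"
    unfolding P_def
  proof (rule sum_pos[OF finM])
    show "M \<noteq> {}" unfolding M_def by (rule maximal_sets_nonempty[OF assms(1,4)])
    show "0 < (\<Prod>w\<in>W. real (valence \<Gamma> w) - 2)" if "W \<in> M" for W
      using val[OF that] by (intro prod_pos) fastforce
  qed
  have L: "real (\<Sum>W\<in>M. (\<Prod>w\<in>W. valence \<Gamma> w - 2) * card (exps (Delta \<Gamma> i) (k - 2 * i))) = P * N (Suc q) k" for k
  proof -
    \<comment> \<open>Truncated and real subtraction of 2 agree because essential vertices have
      valence at least 3.\<close>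
    have "real (\<Prod>w\<in>W. valence \<Gamma> w - 2) = (\<Prod>w\<in>W. real (valence \<Gamma> w) - 2)" if "W \<in> M" for W
      unfolding of_nat_prod using val[OF that] by (intro prod.cong refl) (fastforce simp: of_nat_diff)
    then show ?thesis unfolding P_def N_def q(1) by (simp add: sum_distrib_right del: of_nat_prod)
  qed
  have lower: "P * N (Suc q) k \<le> D k" and upper: "D k \<le> P * N (Suc q) k + R k" if "2 * i \<le> k" for k
  proof -
    note b = torus_dim_bounds[OF assms that, where 'f = 'f, folded M_def E_def]
    show "P * N (Suc q) k \<le> D k"
      unfolding L[symmetric] D_def using b(1) by (simp only: of_nat_le_iff)
    from b(2)[THEN of_nat_mono, where 'a = real]
    show "D k \<le> P * N (Suc q) k + R k"
      unfolding of_nat_add L D_def R_def N_def q_def[symmetric] by simp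
  qed
  have limN: "(\<lambda>k. N (Suc q) k / real k ^ q) \<longlonglongrightarrow> 1 / fact q"
    unfolding N_def by (rule card_exps_limit)
  have limN0: "(\<lambda>k. N n k / real k ^ q) \<longlonglongrightarrow> 0" if "1 \<le> n" "n \<le> q" for n
    unfolding N_def by (rule card_exps_limit_zero[OF that])
  have limR: "(\<lambda>k. R k / real k ^ q) \<longlonglongrightarrow> 0"
  proof -
    have less: "1 \<le> Delta_set \<Gamma> W \<and> Delta_set \<Gamma> W \<le> q" if "W \<in> E - M" for W
    proof -
      have "Delta_set \<Gamma> W \<le> Delta \<Gamma> i" "Delta_set \<Gamma> W \<noteq> Delta \<Gamma> i"
        using that Delta_set_le_Delta[OF assms(1)] unfolding E_def M_def maximal_sets_def by auto
      then show ?thesis using Delta_set_pos[OF assms(1-3), of W] q by linarith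
    qed
    have "(\<lambda>k. (\<Sum>W\<in>E - M. real (card (star_choices \<Gamma> W)) * (N (Delta_set \<Gamma> W) k / real k ^ q))
       + (\<Sum>W\<in>M. \<Sum>w\<in>W. real (card (star_choices \<Gamma> W)) * (N q k / real k ^ q)))
       \<longlonglongrightarrow> (\<Sum>W\<in>E - M. real (card (star_choices \<Gamma> W)) * 0) + (\<Sum>W\<in>M. \<Sum>w\<in>W. real (card (star_choices \<Gamma> W)) * 0)"
      using less q(2) by (intro tendsto_add tendsto_sum tendsto_mult tendsto_const limN0) auto
    then show ?thesis unfolding R_def by (simp add: add_divide_distrib sum_divide_distrib)
  qed
  \<comment> \<open>The dimension is squeezed between the leading term and the same term plus
    \<open>R\<close>.\<close>
  have limD: "(\<lambda>k. D k / real k ^ q) \<longlonglongrightarrow> P / fact q"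
  proof (rule tendsto_sandwich)
    show "\<forall>\<^sub>F k in sequentially. P * (N (Suc q) k / real k ^ q) \<le> D k / real k ^ q"
      using eventually_ge_at_top[of "2 * i"]
      by eventually_elim (use lower in \<open>simp add: divide_right_mono\<close>)
    show "\<forall>\<^sub>F k in sequentially. D k / real k ^ q \<le> P * (N (Suc q) k / real k ^ q) + R k / real k ^ q"
      using eventually_ge_at_top[of "2 * i"]
      by eventually_elim (use upper in \<open>simp add: divide_right_mono flip: add_divide_distrib\<close>)
    show "(\<lambda>k. P * (N (Suc q) k / real k ^ q)) \<longlonglongrightarrow> P / fact q"
      using tendsto_mult[OF tendsto_const limN, of P] by simp
    show "(\<lambda>k. P * (N (Suc q) k / real k ^ q) + R k / real k ^ q) \<longlonglongrightarrow> P / fact q"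
      using tendsto_add[OF tendsto_mult[OF tendsto_const limN, of P] limR] by simp
  qed
  define G where "G k = P / fact q * real k ^ q" for k
  have G: "(\<Sum>W \<in> {W \<in> essential_sets \<Gamma> i. Delta_set \<Gamma> W = Delta \<Gamma> i}.
       1 / fact (Delta \<Gamma> i - 1) * (\<Prod>w \<in> W. real (valence \<Gamma> w) - 2) * real k ^ (Delta \<Gamma> i - 1)) = G k" for k
    unfolding G_def P_def M_def maximal_sets_def q_def[symmetric]
    by (simp add: sum_divide_distrib sum_distrib_right)
  have c: "0 < P / fact q" using P by simp
  \<comment> \<open>A positive limit makes the dimension eventually nonzero, as
    \<open>asymptotic\<close> demands.\<close>
  have ev: "\<forall>\<^sub>F k in sequentially. 0 < D k / real k ^ q" using order_tendstoD(1)[OF limD c] .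
  have "\<forall>\<^sub>F k in sequentially. D k \<noteq> 0 \<and> G k \<noteq> 0"
    using ev eventually_ge_at_top[of 1]
  proof eventually_elim
    case (elim k)
    then show ?case using P by (auto simp: G_def)
  qed
  moreover have "(\<lambda>k. D k / G k) \<longlonglongrightarrow> 1"
  proof -
    have "(\<lambda>k. (D k / real k ^ q) / (P / fact q)) \<longlonglongrightarrow> (P / fact q) / (P / fact q)"
      by (rule tendsto_divide[OF limD tendsto_const]) (use P in simp)
    then show ?thesis using P by (simp add: G_def mult.commute)
  qed
  ultimately show ?thesis unfolding asymptotic_def G D_def by blast
qed

end
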